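(* Let $K\in\mathbb{N}_0$ and let $(\Psi^j)_{j=0}^\infty$ be a $K$-steerable frame-generating sequence with $\Psi^j\in\Pi_{N_j}(\mathbb{S}^{d-1})$ for each $j\in\mathbb{N}_0$. Assume the following conditions. (C1) $\|\Psi^j\|_{L^2(\mathbb{S}^{d-1})}^2\sim N_j^{d-1}$. (C2) There is a sequence $(M_j)_{j=0}^\infty\subset\mathbb{N}_0$ with $M_j\sim N_j$ such that $\Psi^j(n,k)=0$ if $n\notin\{M_j,M_j+1,\dots,N_j\}$. (C3) With the same sequence $(M_j)$ as in (C2), there is a constant $c>0$ independent of $n,k,j$ such that for all $M_j\le n\le N_j$ and $k\in\mathcal{I}_n^d$ $$\left|\frac{\Psi^j(n+1,k)+\Psi^j(n-1,k)}{2}-\Psi^j(n,k)\right|\le c\,N_j^{(d-6)/2}.$$ Then there is a constant $c>0$, independent of $j$, such that $$1-\xi_0^d(\Psi^j)\le c\,N_j^{-2},$$ and, consequently, $$\mathrm{Var}_{\mathrm{S}}(\Psi^j)\le c\,N_j^{-2}.$$ Here all relations and inequalities involving $N_j$ are understood for those $j\in\mathbb{N}_0$ with $N_j\ge1$, and the last inequality for those among them for which $\mathrm{Var}_{\mathrm{S}}(\Psi^j)$ is defined, i.e. $\xi_0(\Psi^j)\ne0$.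
   Context: Fix $d\ge3$. $\mathbb{S}^{d-1}\subset\mathbb{R}^d$ is the unit sphere with rotation-invariant measure $\omega_{d-1}$, $\omega_{d-1}(\mathbb{S}^{d-1})=1$; $L^2(\mathbb{S}^{d-1})$ (complex-valued) has inner product $\langle f_1,f_2\rangle_{\mathbb{S}^{d-1}}=\int f_1\overline{f_2}\,\mathrm{d}\omega_{d-1}$. $\mathcal{H}_n^d$ is the space of spherical harmonics of degree $n$, and $\Pi_N(\mathbb{S}^{d-1})=\bigoplus_{n=0}^N\mathcal{H}_n^d$. For nonnegative sequences, $a_j\sim b_j$ means there are constants $0<c_1\le c_2$ independent of $j$ with $c_1a_j\le b_j\le c_2a_j$ for all $j$. Basis of spherical harmonics. Use spherical coordinates $\theta_1\in[0,2\pi)$, $\theta_2,\dots,\theta_{d-1}\in[0,\pi]$ with $\eta_1=\sin\theta_{d-1}\cdots\sin\theta_2\sin\theta_1$, $\eta_2=\sin\theta_{d-1}\cdots\sin\theta_2\cos\theta_1$, $\eta_i=\sin\theta_{d-1}\cdots\sin\theta_i\cos\theta_{i-1}$ for $3\le i\le d-1$, $\eta_d=\cos\theta_{d-1}$. Let $$\mathcal{I}_n^d=\{(k_1,\dots,k_{d-2})\in\mathbb{N}_0^{d-3}\times\mathbb{Z}: n\ge k_1\ge\dots\ge k_{d-3}\ge|k_{d-2}|\},$$ and, with $k_0=n$, $$Y_k^{d,n}=A_k^n\prod_{j=0}^{d-3}C_{k_j-|k_{j+1}|}^{\frac{d-j-2}{2}+|k_{j+1}|}(\cos\theta_{d-j-1})\,\sin^{|k_{j+1}|}(\theta_{d-j-1})\,\exp(\mathrm{i}k_{d-2}\theta_1),$$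 where $C_m^\lambda$ are the Gegenbauer polynomials, determined by $(1-2ts+s^2)^{-\lambda}=\sum_{m\ge0}C_m^\lambda(t)s^m$, and $A_k^n>0$ is the normalization constant making $\|Y_k^{d,n}\|_{L^2(\mathbb{S}^{d-1})}=1$, namely $$(A_k^n)^2=\frac{2^{(d-4)(d-2)}}{\Gamma(d/2)}\prod_{j=0}^{d-3}\frac{2^{2|k_{j+1}|-j}(k_j-|k_{j+1}|)!\,(2k_j+d-j-2)\,\Gamma^2(\frac{d-j-2}{2}+|k_{j+1}|)}{\sqrt{\pi}\,\Gamma(k_j+|k_{j+1}|+d-j-2)}.$$ These form an orthonormal basis of $L^2(\mathbb{S}^{d-1})$, with $\{Y_k^{d,n}:k\in\mathcal{I}_n^d\}$ a basis of $\mathcal{H}_n^d$. Write $f(n,k)=\langle f,Y_k^{d,n}\rangle_{\mathbb{S}^{d-1}}$, with the convention $f(n,k)=0$ if $n=-1$ or $k\notin\mathcal{I}_n^d$. Polynomials on rotation groups. $(T^d(g)f)(x)=f(g^{-1}x)$ for $g\in SO(d)$. For $m\ge3$, $\mathcal{M}_N^1(SO(m))$ is the span of the functions $g\mapsto\langle T^m(g)Y,Y'\rangle_{\mathbb{S}^{m-1}}$ with $Y,Y'\in\mathcal{H}_n^m$, $0\le n\le N$; $\mathcal{M}_N^1(SO(2))=\mathrm{span}\{e^{\mathrm{i}n\gamma}: n=-N,\dots,N\}$, $\gamma$ being the rotation angle. $SO(d-1)$ is identified with $\{g\in SO(d): ge^d=e^d\}$, where $e^d=(0,\dots,0,1)^\top$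 is the North Pole. Frames. Fix an increasing sequence $(N_j)_{j=0}^\infty\subset\mathbb{N}_0$ and, for each $j$, points $g_{j,r}\in SO(d)$ and weights $\mu_{j,r}>0$, $r=1,\dots,r_j$, with $\int_{SO(d)}f_1f_2\,\mathrm{d}\mu_d=\sum_{r}\mu_{j,r}f_1(g_{j,r})f_2(g_{j,r})$ for all $f_1,f_2\in\mathcal{M}_{N_j}^1(SO(d))$ ($\mu_d$ = normalized Haar measure). A sequence with $\Psi^j\in\Pi_{N_j}(\mathbb{S}^{d-1})$ is frame-generating if $\{\sqrt{\mu_{j,r}}\,T^d(g_{j,r})\Psi^j: r=1,\dots,r_j,\ j\in\mathbb{N}_0\}$ is a frame for $L^2(\mathbb{S}^{d-1})$. Steerability. A sequence $(\Psi^j)$ of polynomials on $\mathbb{S}^{d-1}$ is $K$-steerable (w.r.t. $SO(d-1)$) if there exist $h_1,\dots,h_M\in SO(d-1)$ and $v_1,\dots,v_M\in\mathcal{M}_K^1(SO(d-1))$ with $T^d(h)\Psi^j=\sum_{p=1}^Mv_p(h)\,T^d(h_p)\Psi^j$ for all $h\in SO(d-1)$ and $j\in\mathbb{N}_0$. Space variance. For $f\neq0$, $$\xi_0(f)=\frac{\int_{\mathbb{S}^{d-1}}x|f(x)|^2\,\mathrm{d}\omega_{d-1}(x)}{\|f\|_{L^2(\mathbb{S}^{d-1})}^2}\in\mathbb{R}^d,\qquad \xi_0^d(f)=\langle\xi_0(f),e^d\rangle,\qquad \mathrm{Var}_{\mathrm{S}}(f)=\frac{1-\|\xi_0(f)\|_2^2}{\|\xi_0(f)\|_2^2},$$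 the last being defined when $\xi_0(f)\ne0$. *)

theory Defs
  imports
    "HOL-Probability.Probability"
    "HOL-Computational_Algebra.Formal_Power_Series"
    "Jordan_Normal_Form.Determinant"
begin

no_notation Finite_Cartesian_Product.vec_nth (infixl "$" 90)
no_notation Formal_Power_Series.fps_nth (infixl "$" 75)
hide_const (open) Finite_Cartesian_Product.vec Determinants.det

text \<open>
  The dimension is a natural number, because the sphere of \<open>\<real>\<^sup>d\<close> and that of \<open>\<real>\<^sup>d\<^sup>-\<^sup>1\<close> occur together.
  Points of \<open>\<real>\<^sup>d\<close> are vectors in \<open>carrier_vec d\<close>, so that the coordinate \<open>\<eta>\<^sub>i\<close> is \<open>\<eta> $ (i - 1)\<close>.
  A function on the sphere (on the rotation group) is a function on the type of all vectors
  (matrices) of which only the values on \<open>sphere_vec d\<close> (on \<open>SO d\<close>) are ever used.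
\<close>

section \<open>The sphere and its invariant measure\<close>

definition norm_vec :: "real vec \<Rightarrow> real" where
  "norm_vec x = sqrt (x \<bullet> x)"

definition sphere_vec :: "nat \<Rightarrow> real vec set" where
  "sphere_vec d = {x \<in> carrier_vec d. norm_vec x = 1}"

definition north_pole :: "nat \<Rightarrow> real vec" where
  "north_pole d = unit_vec d (d - 1)"

definition borel_vec :: "nat \<Rightarrow> real vec measure" where
  "borel_vec d = vimage_algebra (carrier_vec d) (\<lambda>x. \<lambda>i\<in>{..<d}. x $ i) (\<Pi>\<^sub>M i\<in>{..<d}. borel)"

definition lborel_vec :: "nat \<Rightarrow> real vec measure" where
  "lborel_vec d = distr (\<Pi>\<^sub>M i\<in>{..<d}. lborel) (borel_vec d) (vec d)"

text \<open>
  The rotation-invariant probability measure on the sphere is the image of the uniform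
  distribution on the unit ball under \<open>x \<mapsto> x / \<parallel>x\<parallel>\<close>. The origin, a null set, is sent to itself
  and is then discarded by the restriction to the sphere.
\<close>
definition sphere_measure :: "nat \<Rightarrow> real vec measure" where
  "sphere_measure d =
     restrict_space
       (distr (uniform_measure (lborel_vec d) {x \<in> carrier_vec d. norm_vec x \<le> 1}) (borel_vec d)
         (\<lambda>x. (1 / norm_vec x) \<cdot>\<^sub>v x))
       (sphere_vec d)"

definition inner_sphere :: "nat \<Rightarrow> (real vec \<Rightarrow> complex) \<Rightarrow> (real vec \<Rightarrow> complex) \<Rightarrow> complex" where
  "inner_sphere d f1 f2 = (LINT x|sphere_measure d. f1 x * cnj (f2 x))"

definition L2_sphere :: "nat \<Rightarrow> (real vec \<Rightarrow> complex) set" where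
  "L2_sphere d = {f \<in> borel_measurable (sphere_measure d).
     integrable (sphere_measure d) (\<lambda>x. (cmod (f x))\<^sup>2)}"

definition norm_sphere :: "nat \<Rightarrow> (real vec \<Rightarrow> complex) \<Rightarrow> real" where
  "norm_sphere d f = sqrt (LINT x|sphere_measure d. (cmod (f x))\<^sup>2)"

section \<open>Spherical harmonics\<close>

definition homogeneous_poly :: "nat \<Rightarrow> nat \<Rightarrow> (real vec \<Rightarrow> complex) \<Rightarrow> bool" where
  "homogeneous_poly d n p \<longleftrightarrow>
     (\<exists>c :: (nat \<Rightarrow> nat) \<Rightarrow> complex. \<forall>x \<in> carrier_vec d.
        p x = (\<Sum>a | a \<in> {..<d} \<rightarrow>\<^sub>E {..n} \<and> (\<Sum>i<d. a i) = n.
                 c a * of_real (\<Prod>i<d. (x $ i) ^ a i)))"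

definition partial :: "nat \<Rightarrow> nat \<Rightarrow> (real vec \<Rightarrow> complex) \<Rightarrow> real vec \<Rightarrow> complex" where
  "partial d i p x = vector_derivative (\<lambda>t. p (x + t \<cdot>\<^sub>v unit_vec d i)) (at 0)"

definition laplacian :: "nat \<Rightarrow> (real vec \<Rightarrow> complex) \<Rightarrow> real vec \<Rightarrow> complex" where
  "laplacian d p x = (\<Sum>i<d. partial d i (partial d i p) x)"

definition harmonics :: "nat \<Rightarrow> nat \<Rightarrow> (real vec \<Rightarrow> complex) set" where
  "harmonics d n = {f. \<exists>p. homogeneous_poly d n p \<and> (\<forall>x \<in> carrier_vec d. laplacian d p x = 0) \<and>
     (\<forall>x \<in> sphere_vec d. f x = p x)}"

definition sphere_polys :: "nat \<Rightarrow> nat \<Rightarrow> (real vec \<Rightarrow> complex) set" where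
  "sphere_polys d N = {f. \<exists>h. (\<forall>n\<le>N. h n \<in> harmonics d n) \<and>
     (\<forall>x \<in> sphere_vec d. f x = (\<Sum>n\<le>N. h n x))}"

section \<open>The basis in spherical coordinates\<close>

definition angle_range :: "nat \<Rightarrow> (nat \<Rightarrow> real) set" where
  "angle_range d = {\<theta>. 0 \<le> \<theta> 1 \<and> \<theta> 1 < 2 * pi \<and> (\<forall>i\<in>{2..d - 1}. 0 \<le> \<theta> i \<and> \<theta> i \<le> pi)}"

definition spherical_point :: "nat \<Rightarrow> (nat \<Rightarrow> real) \<Rightarrow> real vec" where
  "spherical_point d \<theta> = vec d (\<lambda>m. let i = m + 1 in
     (\<Prod>l\<in>{i..d - 1}. sin (\<theta> l)) * (if i = 1 then 1 else cos (\<theta> (i - 1))))"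

text \<open>
  The angles are not unique at points with \<open>\<eta>\<^sub>1 = \<eta>\<^sub>2 = 0\<close>, but the value of \<open>sph_harm\<close> below does
  not depend on the choice.
\<close>
definition angles :: "nat \<Rightarrow> real vec \<Rightarrow> nat \<Rightarrow> real" where
  "angles d x = (SOME \<theta>. \<theta> \<in> angle_range d \<and> spherical_point d \<theta> = x)"

text \<open>Coefficient of \<open>s\<^sup>m\<close> in the power series \<open>(1 - 2 t s + s\<^sup>2)\<close> to the power \<open>- a\<close>.\<close>
definition gegenbauer :: "nat \<Rightarrow> real \<Rightarrow> real \<Rightarrow> real" where
  "gegenbauer m a t =
     fps_nth (fps_compose (fps_binomial (- a)) (fps_X\<^sup>2 - fps_const (2 * t) * fps_X)) m"

text \<open>
  A multi-index \<open>(k\<^sub>1, \<dots>, k\<^bsub>d-2\<^esub>)\<close> is a list of length \<open>d - 2\<close>; with \<open>k\<^sub>0 = n\<close> the entry \<open>k\<^sub>j\<close> is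
  \<open>(int n # k) ! j\<close>.
\<close>
definition indices :: "nat \<Rightarrow> nat \<Rightarrow> int list set" where
  "indices d n = {k. length k = d - 2 \<and>
     (\<forall>j\<in>{1..d - 3}. 0 \<le> (int n # k) ! j) \<and>
     (\<forall>j<d - 2. \<bar>(int n # k) ! (j + 1)\<bar> \<le> (int n # k) ! j)}"

definition norm_const :: "nat \<Rightarrow> nat \<Rightarrow> int list \<Rightarrow> real" where
  "norm_const d n k = sqrt (
     2 powi ((int d - 4) * (int d - 2)) / Gamma (real d / 2) *
     (\<Prod>j\<in>{0..d - 3}. let a = (int n # k) ! j; b = \<bar>(int n # k) ! (j + 1)\<bar> in
        2 powi (2 * b - int j) * fact (nat (a - b)) * of_int (2 * a + int d - int j - 2)
        * (Gamma ((real d - real j - 2) / 2 + of_int b))\<^sup>2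
        / (sqrt pi * Gamma (of_int (a + b + int d - int j - 2)))))"

definition sph_harm :: "nat \<Rightarrow> nat \<Rightarrow> int list \<Rightarrow> real vec \<Rightarrow> complex" where
  "sph_harm d n k x = (let \<theta> = angles d x in
     of_real (norm_const d n k *
       (\<Prod>j\<in>{0..d - 3}. let a = (int n # k) ! j; b = \<bar>(int n # k) ! (j + 1)\<bar> in
          gegenbauer (nat (a - b)) ((real d - real j - 2) / 2 + of_int b) (cos (\<theta> (d - j - 1)))
          * sin (\<theta> (d - j - 1)) ^ nat b))
     * exp (\<i> * of_int ((int n # k) ! (d - 2)) * of_real (\<theta> 1)))"

text \<open>The degree is an integer here, since the degree \<open>n - 1\<close> with \<open>n = 0\<close> is needed.\<close>
definition coefficient :: "nat \<Rightarrow> (real vec \<Rightarrow> complex) \<Rightarrow> int \<Rightarrow> int list \<Rightarrow> complex" where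
  "coefficient d f n k =
     (if n < 0 \<or> k \<notin> indices d (nat n) then 0 else inner_sphere d f (sph_harm d (nat n) k))"

section \<open>Rotations\<close>

definition SO :: "nat \<Rightarrow> real mat set" where
  "SO d = {g \<in> carrier_mat d d. g * g\<^sup>T = 1\<^sub>m d \<and> g\<^sup>T * g = 1\<^sub>m d \<and> det g = 1}"

text \<open>For a rotation \<open>g\<close> the inverse matrix is \<open>g\<^sup>T\<close>.\<close>
definition rotate_fun :: "real mat \<Rightarrow> (real vec \<Rightarrow> complex) \<Rightarrow> real vec \<Rightarrow> complex" where
  "rotate_fun g f x = f (g\<^sup>T *\<^sub>v x)"

definition rotation2 :: "real \<Rightarrow> real mat" where
  "rotation2 \<gamma> = mat_of_rows_list 2 [[cos \<gamma>, - sin \<gamma>], [sin \<gamma>, cos \<gamma>]]"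

definition SO_polys :: "nat \<Rightarrow> nat \<Rightarrow> (real mat \<Rightarrow> complex) set" where
  "SO_polys m N =
     (if m = 2
      then {v. \<exists>c :: int \<Rightarrow> complex. \<forall>\<gamma>. v (rotation2 \<gamma>) =
              (\<Sum>n\<in>{- int N..int N}. c n * exp (\<i> * of_int n * of_real \<gamma>))}
      else {v. \<exists>(L :: nat) c n Y Y'.
              (\<forall>l<L. n l \<le> N \<and> Y l \<in> harmonics m (n l) \<and> Y' l \<in> harmonics m (n l)) \<and>
              (\<forall>g \<in> SO m. v g = (\<Sum>l<L. c l * inner_sphere m (rotate_fun g (Y l)) (Y' l)))})"

text \<open>\<open>SO m\<close> as the subgroup of \<open>SO (m + 1)\<close> fixing the north pole.\<close>
definition SO_embed :: "real mat \<Rightarrow> real mat" where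
  "SO_embed h = four_block_mat h (0\<^sub>m (dim_row h) 1) (0\<^sub>m 1 (dim_col h)) (1\<^sub>m 1)"

definition borel_SO :: "nat \<Rightarrow> real mat measure" where
  "borel_SO d = vimage_algebra (SO d) (\<lambda>g. \<lambda>(i, j)\<in>{..<d} \<times> {..<d}. g $$ (i, j))
     (\<Pi>\<^sub>M ij\<in>{..<d} \<times> {..<d}. borel)"

definition normalized_haar :: "nat \<Rightarrow> real mat measure \<Rightarrow> bool" where
  "normalized_haar d \<mu> \<longleftrightarrow> space \<mu> = SO d \<and> sets \<mu> = sets (borel_SO d) \<and> prob_space \<mu> \<and>
     (\<forall>g \<in> SO d. \<forall>A \<in> sets \<mu>. emeasure \<mu> ((\<lambda>h. g * h) ` A) = emeasure \<mu> A)"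

section \<open>Frames, steerability and space variance\<close>

definition quadrature ::
  "nat \<Rightarrow> real mat measure \<Rightarrow> nat \<Rightarrow> nat \<Rightarrow> (nat \<Rightarrow> real mat) \<Rightarrow> (nat \<Rightarrow> real) \<Rightarrow> bool" where
  "quadrature d \<mu> N R g w \<longleftrightarrow> (\<forall>r\<in>{1..R}. g r \<in> SO d \<and> w r > 0) \<and>
     (\<forall>f1 \<in> SO_polys d N. \<forall>f2 \<in> SO_polys d N.
        (LINT h|\<mu>. f1 h * f2 h) = (\<Sum>r = 1..R. of_real (w r) * f1 (g r) * f2 (g r)))"

definition is_frame :: "nat \<Rightarrow> 'i set \<Rightarrow> ('i \<Rightarrow> real vec \<Rightarrow> complex) \<Rightarrow> bool" where
  "is_frame d I \<phi> \<longleftrightarrow> (\<forall>i\<in>I. \<phi> i \<in> L2_sphere d) \<and>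
     (\<exists>A B. 0 < A \<and> A \<le> B \<and> (\<forall>f \<in> L2_sphere d.
        (\<lambda>i. (cmod (inner_sphere d f (\<phi> i)))\<^sup>2) summable_on I \<and>
        A * (norm_sphere d f)\<^sup>2 \<le> (\<Sum>\<^sub>\<infinity>i\<in>I. (cmod (inner_sphere d f (\<phi> i)))\<^sup>2) \<and>
        (\<Sum>\<^sub>\<infinity>i\<in>I. (cmod (inner_sphere d f (\<phi> i)))\<^sup>2) \<le> B * (norm_sphere d f)\<^sup>2))"

definition frame_generating ::
  "nat \<Rightarrow> (nat \<Rightarrow> nat) \<Rightarrow> (nat \<Rightarrow> nat) \<Rightarrow> (nat \<Rightarrow> nat \<Rightarrow> real mat) \<Rightarrow> (nat \<Rightarrow> nat \<Rightarrow> real)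
   \<Rightarrow> (nat \<Rightarrow> real vec \<Rightarrow> complex) \<Rightarrow> bool" where
  "frame_generating d N R g w \<Psi> \<longleftrightarrow> (\<forall>j. \<Psi> j \<in> sphere_polys d (N j)) \<and>
     is_frame d (SIGMA j:UNIV. {1..R j})
       (\<lambda>(j, r) x. of_real (sqrt (w j r)) * rotate_fun (g j r) (\<Psi> j) x)"

definition steerable :: "nat \<Rightarrow> nat \<Rightarrow> (nat \<Rightarrow> real vec \<Rightarrow> complex) \<Rightarrow> bool" where
  "steerable d K \<Psi> \<longleftrightarrow> (\<forall>j. \<exists>N. \<Psi> j \<in> sphere_polys d N) \<and>
     (\<exists>(M :: nat) hs v.
       (\<forall>p\<in>{1..M}. hs p \<in> SO (d - 1) \<and> v p \<in> SO_polys (d - 1) K) \<and>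
       (\<forall>h \<in> SO (d - 1). \<forall>j. \<forall>x \<in> sphere_vec d.
          rotate_fun (SO_embed h) (\<Psi> j) x =
            (\<Sum>p = 1..M. v p h * rotate_fun (SO_embed (hs p)) (\<Psi> j) x)))"

definition xi0 :: "nat \<Rightarrow> (real vec \<Rightarrow> complex) \<Rightarrow> real vec" where
  "xi0 d f = vec d (\<lambda>i.
     (LINT x|sphere_measure d. x $ i * (cmod (f x))\<^sup>2) / (norm_sphere d f)\<^sup>2)"

definition xi0_pole :: "nat \<Rightarrow> (real vec \<Rightarrow> complex) \<Rightarrow> real" where
  "xi0_pole d f = xi0 d f \<bullet> north_pole d"

definition Var_S :: "nat \<Rightarrow> (real vec \<Rightarrow> complex) \<Rightarrow> real" where
  "Var_S d f = (1 - (norm_vec (xi0 d f))\<^sup>2) / (norm_vec (xi0 d f))\<^sup>2"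

definition sim_on :: "nat set \<Rightarrow> (nat \<Rightarrow> real) \<Rightarrow> (nat \<Rightarrow> real) \<Rightarrow> bool" where
  "sim_on J a b \<longleftrightarrow> (\<exists>c1 c2. 0 < c1 \<and> c1 \<le> c2 \<and> (\<forall>j\<in>J. c1 * a j \<le> b j \<and> b j \<le> c2 * a j))"

end

(* In the basis of spherical harmonics the functions with a fixed tail k of the index form a chain
   on which the multiplication by the last coordinate is the Jacobi matrix of the Gegenbauer
   recurrence, with off-diagonal entries 1/2 + O(n^-2). Hence 1 - xi_0^d is, up to an error of
   order M_j^-2, a weighted sum of products of coefficients with their second differences, which
   (C3) and (C1) bound by means of the inequality of the arithmetic and geometric means. Only
   boundedly many chains occur: by steerability the values of Psi^j under a rotation in SO(d-1)
   about the north pole are trigonometric polynomials of degree at most K in the rotation angle,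
   which forces k_1 <= K. All integrals over the sphere are evaluated by rotation invariance alone:
   the integral of an infinitesimal rotation of a polynomial vanishes. The passage to the variance
   needs xi_0^d >= 1/2, which holds for large j, because the degrees of a frame are unbounded. *)
theory Submission
  imports Defs
begin

section \<open>Polynomial functions\<close>

text \<open>The measure on the sphere comes from the ball and not from angles. The basis functions
  are therefore turned into polynomials, \<open>solid\<close>, and their orthogonality into algebra:
  rotations yield linear relations between integrals, which the Gegenbauer recurrence solves by
  induction. The symmetry of the Jacobi matrix makes the norm constant along a chain. Its value is
  carried as a number \<open>ynorm d k\<close>; with finitely many chains these numbers merge into
  the final constant. The relation |x|^2 = 1 is the obstacle in the steerability argument: parts of
  different degree in the first d - 1 coordinates can cancel on a circle. A normal form in which x_0
  occurs at most linearly makes the parts unique. The exponent in (C3) is matched to (C1): a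
  coefficient c times a second difference of size E costs (\<eta>/2)|c|^2 + E^2/(2\<eta>). With
  \<eta> = N^-2, E^2 of order N^(d-6) and at most N + 1 terms per chain, the second part is of order
  N^(d-3) = N^-2 N^(d-1), that is N^-2 times the squared norm.\<close>

inductive hpoly :: "nat set \<Rightarrow> nat \<Rightarrow> (real vec \<Rightarrow> complex) \<Rightarrow> bool" for I where
  zero: "hpoly I D (\<lambda>x. 0)"
| const: "hpoly I 0 (\<lambda>x. c)"
| coord: "i \<in> I \<Longrightarrow> hpoly I D f \<Longrightarrow> hpoly I (Suc D) (\<lambda>x. of_real (x $ i) * f x)"
| add: "hpoly I D f \<Longrightarrow> hpoly I D g \<Longrightarrow> hpoly I D (\<lambda>x. f x + g x)"

lemma hpoly_mono: "hpoly I D f \<Longrightarrow> I \<subseteq> J \<Longrightarrow> hpoly J D f"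
  by (induction rule: hpoly.induct) (auto intro: hpoly.intros)

lemma hpoly_scale: "hpoly I D f \<Longrightarrow> hpoly I D (\<lambda>x. c * f x)"
proof (induction rule: hpoly.induct)
  case (coord i D f)
  then show ?case using hpoly.coord[OF coord(1,3)] by (simp add: mult.left_commute)
next
  case (add D f g)
  then show ?case using hpoly.add[OF add(3,4)] by (simp add: ring_distribs)
qed (auto intro: hpoly.intros)

lemma hpoly_coord: "i \<in> I \<Longrightarrow> hpoly I 1 (\<lambda>x. of_real (x $ i))"
  using hpoly.coord[OF _ hpoly.const[of I 1], of i] by simp

lemma hpoly_mult: "hpoly I D f \<Longrightarrow> hpoly I D' g \<Longrightarrow> hpoly I (D + D') (\<lambda>x. f x * g x)"
proof (induction rule: hpoly.induct)
  case (const c)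
  then show ?case by (simp add: hpoly_scale)
next
  case (coord i D f)
  then show ?case using hpoly.coord[OF coord(1) coord(3)[OF coord(4)]] by (simp add: mult.assoc)
next
  case (add D f g')
  then show ?case using hpoly.add[OF add(3)[OF add(5)] add(4)[OF add(5)]] by (simp add: ring_distribs)
qed (auto intro: hpoly.intros)

lemma hpoly_sum: "(\<And>a. a \<in> A \<Longrightarrow> hpoly I D (f a)) \<Longrightarrow> hpoly I D (\<lambda>x. \<Sum>a\<in>A. f a x)"
  by (induction A rule: infinite_finite_induct) (auto intro: hpoly.zero hpoly.add)

lemma hpoly_prod:
  "finite A \<Longrightarrow> (\<And>a. a \<in> A \<Longrightarrow> hpoly I (D a) (f a)) \<Longrightarrow> hpoly I (\<Sum>a\<in>A. D a) (\<lambda>x. \<Prod>a\<in>A. f a x)"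
  by (induction A rule: finite_induct) (auto intro: hpoly.const hpoly_mult)

lemma hpoly_power: "hpoly I D f \<Longrightarrow> hpoly I (n * D) (\<lambda>x. f x ^ n)"
  by (induction n) (auto intro: hpoly.const hpoly_mult)

lemma hpoly_cnj: "hpoly I D f \<Longrightarrow> hpoly I D (\<lambda>x. cnj (f x))"
  by (induction rule: hpoly.induct) (auto intro: hpoly.intros)

lemma hpoly_diff: "hpoly I D f \<Longrightarrow> hpoly I D g \<Longrightarrow> hpoly I D (\<lambda>x. f x - g x)"
  using hpoly.add[of I D f "\<lambda>x. (-1) * g x"] hpoly_scale[of I D g "-1"] by simp

text \<open>Arbitrary polynomials, for integrability and for the extra factors under the integrals.
  \<open>hpoly\<close> keeps more: the degree, for Euler's identity and for degrees in a rotation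
  angle, and the set of variables, because harmonics are built up one coordinate at a time.\<close>

inductive pfun :: "nat \<Rightarrow> (real vec \<Rightarrow> complex) \<Rightarrow> bool" for d where
  const: "pfun d (\<lambda>x. c)"
| coord: "i < d \<Longrightarrow> pfun d (\<lambda>x. of_real (x $ i))"
| add: "pfun d f \<Longrightarrow> pfun d g \<Longrightarrow> pfun d (\<lambda>x. f x + g x)"
| mult: "pfun d f \<Longrightarrow> pfun d g \<Longrightarrow> pfun d (\<lambda>x. f x * g x)"

named_theorems pfun_intros
declare pfun.intros [pfun_intros]

lemma hpoly_imp_pfun: "hpoly I D f \<Longrightarrow> I \<subseteq> {..<d} \<Longrightarrow> pfun d f"
proof (induction rule: hpoly.induct)
  case (coord i D f)
  then show ?case by (intro pfun.mult pfun.coord) auto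
qed (auto intro: pfun.intros)

lemma pfun_cnj [pfun_intros]: "pfun d f \<Longrightarrow> pfun d (\<lambda>x. cnj (f x))"
  by (induction rule: pfun.induct) (auto intro: pfun.intros)

lemma pfun_diff [pfun_intros]: "pfun d f \<Longrightarrow> pfun d g \<Longrightarrow> pfun d (\<lambda>x. f x - g x)"
  using pfun.add[of d f "\<lambda>x. (-1) * g x"] pfun.mult[OF pfun.const[of d "-1"], of g] by simp

lemma pfun_power [pfun_intros]: "pfun d f \<Longrightarrow> pfun d (\<lambda>x. f x ^ n)"
  by (induction n) (auto intro: pfun.intros)

section \<open>Trigonometric polynomials\<close>

text \<open>Trigonometric polynomials of degree at most \<open>K\<close> in the form p(cos) + sin
  q(cos). Polynomials restricted to a circle appear directly in this form, and p and q are unique.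
  The separate case \<open>q = 0\<close> is for \<open>K = 0\<close>, since the zero polynomial has
  degree 0.\<close>

definition trig_poly :: "nat \<Rightarrow> (real \<Rightarrow> complex) \<Rightarrow> bool" where
  "trig_poly K f \<longleftrightarrow> (\<exists>p q. degree p \<le> K \<and> (q = 0 \<or> degree q < K) \<and>
     (\<forall>\<gamma>. f \<gamma> = poly p (of_real (cos \<gamma>)) + of_real (sin \<gamma>) * poly q (of_real (cos \<gamma>))))"

lemma trig_poly_const: "trig_poly K (\<lambda>\<gamma>. c)"
  unfolding trig_poly_def by (rule exI[of _ "[:c:]"], rule exI[of _ 0]) auto

lemma trig_poly_cos: "trig_poly 1 (\<lambda>\<gamma>. of_real (cos \<gamma>))"
  unfolding trig_poly_def by (rule exI[of _ "[:0, 1:]"], rule exI[of _ 0]) auto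

lemma trig_poly_sin: "trig_poly 1 (\<lambda>\<gamma>. of_real (sin \<gamma>))"
  unfolding trig_poly_def by (rule exI[of _ 0], rule exI[of _ 1]) auto

lemma trig_poly_mono: "trig_poly K f \<Longrightarrow> K \<le> L \<Longrightarrow> trig_poly L f"
  unfolding trig_poly_def 
proof (elim exE conjE)
  fix p q assume "K \<le> L" "degree p \<le> K" "q = 0 \<or> degree q < K"
    "\<forall>\<gamma>. f \<gamma> = poly p (of_real (cos \<gamma>)) + of_real (sin \<gamma>) * poly q (of_real (cos \<gamma>))"
  then show "\<exists>p q. degree p \<le> L \<and> (q = 0 \<or> degree q < L) \<and>
     (\<forall>\<gamma>. f \<gamma> = poly p (of_real (cos \<gamma>)) + of_real (sin \<gamma>) * poly q (of_real (cos \<gamma>)))"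
    by (intro exI[of _ p] exI[of _ q]) auto
qed

lemma trig_poly_add: assumes "trig_poly K f" "trig_poly K g" shows "trig_poly K (\<lambda>\<gamma>. f \<gamma> + g \<gamma>)"
proof -
  obtain p q where 1: "degree p \<le> K" "q = 0 \<or> degree q < K"
     "\<And>\<gamma>. f \<gamma> = poly p (of_real (cos \<gamma>)) + of_real (sin \<gamma>) * poly q (of_real (cos \<gamma>))"
    using assms(1) unfolding trig_poly_def by blast
  obtain p' q' where 2: "degree p' \<le> K" "q' = 0 \<or> degree q' < K"
     "\<And>\<gamma>. g \<gamma> = poly p' (of_real (cos \<gamma>)) + of_real (sin \<gamma>) * poly q' (of_real (cos \<gamma>))"
    using assms(2) unfolding trig_poly_def by blast
  show ?thesis unfolding trig_poly_def
    using 1 2 by (intro exI[of _ "p + p'"] exI[of _ "q + q'"])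
      (auto simp: algebra_simps intro: degree_add_le degree_add_less)
qed

lemma trig_poly_mult: assumes "trig_poly K f" "trig_poly L g"
  shows "trig_poly (K + L) (\<lambda>\<gamma>. f \<gamma> * g \<gamma>)"
proof -
  obtain p q where 1: "degree p \<le> K" "q = 0 \<or> degree q < K"
     "\<And>\<gamma>. f \<gamma> = poly p (of_real (cos \<gamma>)) + of_real (sin \<gamma>) * poly q (of_real (cos \<gamma>))"
    using assms(1) unfolding trig_poly_def by blast
  obtain p' q' where 2: "degree p' \<le> L" "q' = 0 \<or> degree q' < L"
     "\<And>\<gamma>. g \<gamma> = poly p' (of_real (cos \<gamma>)) + of_real (sin \<gamma>) * poly q' (of_real (cos \<gamma>))"
    using assms(2) unfolding trig_poly_def by blast
  \<comment> \<open>The factor \<open>[:1, 0, -1:]\<close> is 1 - X^2 and stands for sin^2. Its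
    degree 2 is paid for by the two strict bounds on the degrees of q and q'.\<close>
  have a: "degree (p * p' + [:1, 0, -1:] * (q * q')) \<le> K + L"
  proof (rule degree_add_le)
    show "degree (p * p') \<le> K + L" using degree_mult_le[of p p'] 1 2 by linarith
    show "degree ([:1, 0, -1:] * (q * q')) \<le> K + L"
    proof (cases "q = 0 \<or> q' = 0")
      case False
      then have "degree ([:1, 0, -1:] * (q * q')) = 2 + (degree q + degree q')"
        by (subst degree_mult_eq) (auto simp: degree_mult_eq)
      then show ?thesis using False 1 2 by linarith
    qed auto
  qed
  have h: "r * s = 0 \<or> degree (r * s) < A + B" if "degree r \<le> A" "s = 0 \<or> degree s < B"
    for r s :: "complex poly" and A B
    using that degree_mult_le[of r s] by (cases "s = 0") auto
  have b: "p * q' + q * p' = 0 \<or> degree (p * q' + q * p') < K + L"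
    using h[OF 1(1) 2(2)] h[OF 2(1) 1(2)] by (auto simp: mult.commute add.commute intro: degree_add_less)
  have sq: "of_real (sin \<gamma>) * (of_real (sin \<gamma>)) = (1 - of_real (cos \<gamma>) * of_real (cos \<gamma>) :: complex)" for \<gamma>
  proof -
    have "sin \<gamma> * sin \<gamma> = 1 - cos \<gamma> * cos \<gamma>"
      using sin_cos_squared_add[of \<gamma>] by (simp add: power2_eq_square)
    then show ?thesis by (metis of_real_1 of_real_diff of_real_mult)
  qed
  have "f \<gamma> * g \<gamma> = poly (p * p' + [:1, 0, -1:] * (q * q')) (of_real (cos \<gamma>))
     + of_real (sin \<gamma>) * poly (p * q' + q * p') (of_real (cos \<gamma>))" for \<gamma>
  proof -
    have "(P + s * Q) * (P' + s * Q') = P * P' + s * s * (Q * Q') + s * (P * Q' + Q * P')"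
      for P Q P' Q' s :: complex by (simp add: algebra_simps)
    note this[of "poly p (of_real (cos \<gamma>))" "of_real (sin \<gamma>)" "poly q (of_real (cos \<gamma>))"
        "poly p' (of_real (cos \<gamma>))" "poly q' (of_real (cos \<gamma>))"]
    then show ?thesis
      unfolding 1 2 sq by (simp only:) (simp add: algebra_simps)
  qed
  then show ?thesis unfolding trig_poly_def using a b by blast
qed

lemma trig_poly_scale: "trig_poly K f \<Longrightarrow> trig_poly K (\<lambda>\<gamma>. c * f \<gamma>)"
  using trig_poly_mult[OF trig_poly_const[of 0 c]] by simp

lemma trig_poly_sum: "(\<And>a. a \<in> A \<Longrightarrow> trig_poly K (f a)) \<Longrightarrow> trig_poly K (\<lambda>\<gamma>. \<Sum>a\<in>A. f a \<gamma>)"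
  by (induction A rule: infinite_finite_induct) (auto intro: trig_poly_const trig_poly_add)

lemma trig_poly_power: "trig_poly K f \<Longrightarrow> trig_poly (n * K) (\<lambda>\<gamma>. f \<gamma> ^ n)"
  by (induction n) (auto intro: trig_poly_const trig_poly_mult)

text \<open>Replacing \<gamma> by -\<gamma> separates the even part from the odd part. Each
  polynomial then vanishes at all cosines in (-1, 1), an infinite set on which the sine can be
  divided out.\<close>

lemma trig_poly_unique:
  assumes "\<And>\<gamma>. poly p (of_real (cos \<gamma>)) + of_real (sin \<gamma>) * poly q (of_real (cos \<gamma>)) = (0 :: complex)"
  shows "p = 0" "q = 0"
proof -
  have n: "poly p (of_real (cos \<gamma>)) = 0 \<and> of_real (sin \<gamma>) * poly q (of_real (cos \<gamma>)) = 0" for \<gamma>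
  proof -
    have "poly p (of_real (cos \<gamma>)) - of_real (sin \<gamma>) * poly q (of_real (cos \<gamma>)) = 0"
      using assms[of "-\<gamma>"] by simp
    moreover have "2 * poly p (of_real (cos \<gamma>)) =
        (poly p (of_real (cos \<gamma>)) + of_real (sin \<gamma>) * poly q (of_real (cos \<gamma>)))
      + (poly p (of_real (cos \<gamma>)) - of_real (sin \<gamma>) * poly q (of_real (cos \<gamma>)))" by simp
    ultimately have "poly p (of_real (cos \<gamma>)) = 0" using assms[of \<gamma>] by simp
    then show ?thesis using assms[of \<gamma>] by simp
  qed
  have inf: "infinite ((of_real :: real \<Rightarrow> complex) ` {-1<..<1})"
  proof
    assume "finite ((of_real :: real \<Rightarrow> complex) ` {-1<..<1})"
    then have "finite {-1<..<1::real}" by (rule finite_imageD) (simp add: inj_on_def)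
    then show False using infinite_Ioo[of "-1::real" 1] by simp
  qed
  have z: "r = 0" if "\<And>t. t \<in> {-1<..<1} \<Longrightarrow> poly r (of_real t) = 0" for r :: "complex poly"
  proof (rule ccontr)
    assume "r \<noteq> 0"
    then have "finite {x. poly r x = 0}" by (rule poly_roots_finite)
    moreover have "of_real ` {-1<..<1} \<subseteq> {x. poly r x = 0}" using that by auto
    ultimately show False using inf finite_subset by blast
  qed
  show "p = 0" 
  proof (rule z)
    fix t :: real assume "t \<in> {-1<..<1}"
    then show "poly p (of_real t) = 0" using n[of "arccos t"] by simp
  qed
  show "q = 0"
  proof (rule z)
    fix t :: real assume t: "t \<in> {-1<..<1}"
    then have "sin (arccos t) \<noteq> 0" by (simp add: sin_arccos_nonzero)
    then show "poly q (of_real t) = 0" using n[of "arccos t"] t by simp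
  qed
qed

lemma trig_poly_differentiable: "trig_poly K f \<Longrightarrow> f differentiable (at \<gamma>)"
proof -
  assume "trig_poly K f"
  then obtain p q where "f = (\<lambda>\<gamma>. poly p (of_real (cos \<gamma>)) + of_real (sin \<gamma>) * poly q (of_real (cos \<gamma>)))"
    unfolding trig_poly_def by blast
  moreover have "\<exists>D. ((\<lambda>\<gamma>. poly p (of_real (cos \<gamma>)) + of_real (sin \<gamma>) * poly q (of_real (cos \<gamma>)))
      has_vector_derivative D) (at \<gamma>)"
  proof -
    have c: "((\<lambda>\<gamma>. complex_of_real (cos \<gamma>)) has_vector_derivative of_real (- sin \<gamma>)) (at \<gamma>)"
      by (intro has_vector_derivative_of_real) (auto intro!: derivative_eq_intros simp: has_real_derivative_iff_has_vector_derivative[symmetric])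
    have s: "((\<lambda>\<gamma>. complex_of_real (sin \<gamma>)) has_vector_derivative of_real (cos \<gamma>)) (at \<gamma>)"
      by (intro has_vector_derivative_of_real) (auto intro!: derivative_eq_intros simp: has_real_derivative_iff_has_vector_derivative[symmetric])
    have P: "((\<lambda>\<gamma>. poly r (complex_of_real (cos \<gamma>))) has_vector_derivative
       of_real (- sin \<gamma>) * poly (pderiv r) (of_real (cos \<gamma>))) (at \<gamma>)" for r
      using field_vector_diff_chain_at[OF c, of "poly r"] by (simp add: o_def poly_DERIV)
    show ?thesis by (rule exI, rule has_vector_derivative_add[OF P has_vector_derivative_mult[OF s P]])
  qed
  ultimately show ?thesis using vector_derivative_works by (metis differentiableI_vector)
qed

text \<open>Finite sums of products of a trigonometric polynomial in the angle and a polynomial in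
  the point. Integration over the point touches only the second factors, so that differentiation
  under the integral sign reduces to linearity.\<close>

inductive separated :: "nat \<Rightarrow> nat \<Rightarrow> (real \<Rightarrow> real vec \<Rightarrow> complex) \<Rightarrow> bool" for d K where
  zero: "separated d K (\<lambda>\<gamma> x. 0)"
| step: "trig_poly K \<tau> \<Longrightarrow> pfun d g \<Longrightarrow> separated d K f \<Longrightarrow> separated d K (\<lambda>\<gamma> x. \<tau> \<gamma> * g x + f \<gamma> x)"

lemma separated_single: "trig_poly K \<tau> \<Longrightarrow> pfun d g \<Longrightarrow> separated d K (\<lambda>\<gamma> x. \<tau> \<gamma> * g x)"
  using separated.step[OF _ _ separated.zero] by simp

lemma separated_pfun: "pfun d g \<Longrightarrow> separated d K (\<lambda>\<gamma>. g)"
  using separated_single[OF trig_poly_const[of K 1]] by simp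

lemma separated_add: "separated d K f \<Longrightarrow> separated d K g \<Longrightarrow> separated d K (\<lambda>\<gamma> x. f \<gamma> x + g \<gamma> x)"
proof (induction rule: separated.induct)
  case (step \<tau> h f)
  then show ?case using separated.step[OF step(1,2) step(4)[OF step(5)]] by (simp add: add.assoc)
qed simp

lemma separated_mult:
  "separated d K f \<Longrightarrow> separated d L g \<Longrightarrow> separated d (K + L) (\<lambda>\<gamma> x. f \<gamma> x * g \<gamma> x)"
proof (induction rule: separated.induct)
  case (step \<tau> h f)
  have "separated d (K + L) (\<lambda>\<gamma> x. (\<tau> \<gamma> * h x) * g \<gamma> x)"
    using step(5)
  proof (induction rule: separated.induct)
    case (step \<tau>' h' f')
    have "separated d (K + L) (\<lambda>\<gamma> x. (\<tau> \<gamma> * \<tau>' \<gamma>) * (h x * h' x) + \<tau> \<gamma> * h x * f' \<gamma> x)"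
      using step \<open>trig_poly K \<tau>\<close> \<open>pfun d h\<close>
      by (intro separated.step trig_poly_mult pfun.mult) auto
    then show ?case by (simp add: algebra_simps)
  qed (auto intro: separated.zero)
  from separated_add[OF this step(4)[OF step(5)]] show ?case by (simp add: ring_distribs)
qed (auto intro: separated.zero)

lemma separated_sum:
  "(\<And>a. a \<in> A \<Longrightarrow> separated d K (f a)) \<Longrightarrow> separated d K (\<lambda>\<gamma> x. \<Sum>a\<in>A. f a \<gamma> x)"
  by (induction A rule: infinite_finite_induct) (auto intro: separated.zero separated_add)

lemma separated_mono: "separated d K f \<Longrightarrow> K \<le> L \<Longrightarrow> separated d L f"
  by (induction rule: separated.induct) (auto intro: separated.intros trig_poly_mono)

text \<open>Every coordinate of the moved point has degree 1 in the angle, so a homogeneous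
  polynomial of degree \<open>D\<close> gets degree at most \<open>D\<close> there. This is the
  source of the degree bound for \<open>SO_polys\<close> on a circle of rotations.\<close>

lemma hpoly_separated:
  assumes "hpoly I D f"
    and "\<And>i. i \<in> I \<Longrightarrow> separated d 1 (s i)"
    and R: "\<And>i \<gamma> x. i \<in> I \<Longrightarrow> x \<in> carrier_vec d \<Longrightarrow> of_real (R \<gamma> x $ i) = s i \<gamma> x"
  shows "\<exists>F. separated d D F \<and> (\<forall>\<gamma>. \<forall>x\<in>carrier_vec d. f (R \<gamma> x) = F \<gamma> x)"
  using assms(1)
proof (induction rule: hpoly.induct)
  case (zero D) then show ?case by (auto intro: separated.zero)
next
  case (const c) then show ?case by (auto intro: separated_pfun pfun.const)
next
  case (coord i D f)
  then obtain F where F: "separated d D F" "\<And>\<gamma> x. x \<in> carrier_vec d \<Longrightarrow> f (R \<gamma> x) = F \<gamma> x" by blast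
  have "separated d (Suc D) (\<lambda>\<gamma> x. s i \<gamma> x * F \<gamma> x)"
    using separated_mult[OF assms(2)[OF coord(1)] F(1)] by simp
  then show ?case using F(2) R[OF coord(1)] by (intro exI conjI) auto
next
  case (add D f g)
  then obtain F G where "separated d D F" "\<And>\<gamma> x. x \<in> carrier_vec d \<Longrightarrow> f (R \<gamma> x) = F \<gamma> x"
    "separated d D G" "\<And>\<gamma> x. x \<in> carrier_vec d \<Longrightarrow> g (R \<gamma> x) = G \<gamma> x" by metis
  then show ?case by (intro exI[of _ "\<lambda>\<gamma> x. F \<gamma> x + G \<gamma> x"]) (auto intro: separated_add)
qed

lemma pfun_separated:
  assumes "pfun d f"
    and "\<And>i. i < d \<Longrightarrow> separated d 1 (s i)"
    and R: "\<And>i \<gamma> x. i < d \<Longrightarrow> x \<in> carrier_vec d \<Longrightarrow> of_real (R \<gamma> x $ i) = s i \<gamma> x"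
  shows "\<exists>K F. separated d K F \<and> (\<forall>\<gamma>. \<forall>x\<in>carrier_vec d. f (R \<gamma> x) = F \<gamma> x)"
  using assms(1)
proof (induction rule: pfun.induct)
  case (const c) then show ?case by (auto intro: separated_pfun pfun.const)
next
  case (coord i)
  then show ?case using assms(2)[OF coord] R[OF coord] by (intro exI conjI) auto
next
  case (add f g)
  then obtain K L F G where h: "separated d K F" "\<And>\<gamma> x. x \<in> carrier_vec d \<Longrightarrow> f (R \<gamma> x) = F \<gamma> x"
    "separated d L G" "\<And>\<gamma> x. x \<in> carrier_vec d \<Longrightarrow> g (R \<gamma> x) = G \<gamma> x" by metis
  have "separated d (max K L) (\<lambda>\<gamma> x. F \<gamma> x + G \<gamma> x)"
    by (intro separated_add separated_mono[OF h(1)] separated_mono[OF h(3)]) auto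
  then show ?case using h by (intro exI conjI) auto
next
  case (mult f g)
  then obtain K L F G where h: "separated d K F" "\<And>\<gamma> x. x \<in> carrier_vec d \<Longrightarrow> f (R \<gamma> x) = F \<gamma> x"
    "separated d L G" "\<And>\<gamma> x. x \<in> carrier_vec d \<Longrightarrow> g (R \<gamma> x) = G \<gamma> x" by metis
  have "separated d (K + L) (\<lambda>\<gamma> x. F \<gamma> x * G \<gamma> x)"
    by (intro separated_mult h)
  then show ?case using h by (intro exI conjI) auto
qed

declare [[simproc del: measurable]]

section \<open>Rotation invariance of the measure on the sphere\<close>

lemma norm_vec_eq: "x \<in> carrier_vec d \<Longrightarrow> norm_vec x = sqrt (\<Sum>m<d. (x $ m)\<^sup>2)"
  by (auto simp: norm_vec_def scalar_prod_def power2_eq_square atLeast0LessThan)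

lemma sphere_vec_iff: "x \<in> sphere_vec d \<longleftrightarrow> x \<in> carrier_vec d \<and> (\<Sum>m<d. (x $ m)\<^sup>2) = 1"
  by (auto simp: sphere_vec_def norm_vec_eq)

lemma sphere_vec_Int_carrier [simp]: "sphere_vec d \<inter> carrier_vec d = sphere_vec d"
  by (auto simp: sphere_vec_def)

lemma sphere_vec_carrier: "x \<in> sphere_vec d \<Longrightarrow> x \<in> carrier_vec d"
  by (simp add: sphere_vec_def)

lemma space_borel_vec [simp]: "space (borel_vec d) = carrier_vec d"
  by (simp add: borel_vec_def)

lemma measurable_borel_vec_coord:
  assumes "i < d" shows "(\<lambda>x. x $ i) \<in> borel_measurable (borel_vec d)"
proof -
  have "(\<lambda>x. \<lambda>i\<in>{..<d}. x $ i) \<in> borel_vec d \<rightarrow>\<^sub>M (\<Pi>\<^sub>M i\<in>{..<d}. borel)"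
    unfolding borel_vec_def by (rule measurable_vimage_algebra1) (auto simp: space_PiM)
  from measurable_compose[OF this measurable_component_singleton[of i]] show ?thesis using assms by simp
qed

lemma measurable_borel_vecI:
  assumes "\<And>x. x \<in> space N \<Longrightarrow> f x \<in> carrier_vec d"
    and "\<And>i. i < d \<Longrightarrow> (\<lambda>x. f x $ i) \<in> borel_measurable N"
  shows "f \<in> N \<rightarrow>\<^sub>M borel_vec d"
  unfolding borel_vec_def
proof (rule measurable_vimage_algebra2)
  show "f \<in> space N \<rightarrow> carrier_vec d" using assms by auto
  show "(\<lambda>x. \<lambda>i\<in>{..<d}. f x $ i) \<in> N \<rightarrow>\<^sub>M (\<Pi>\<^sub>M i\<in>{..<d}. borel)"
    using assms(2) by (intro measurable_restrict) auto
qed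

lemma measurable_norm_vec [measurable]: "norm_vec \<in> borel_measurable (borel_vec d)"
proof -
  have [measurable]: "(\<lambda>x. \<Sum>m<d. (x $ m)\<^sup>2) \<in> borel_measurable (borel_vec d)"
    by (intro borel_measurable_sum borel_measurable_power measurable_borel_vec_coord) auto
  have "(\<lambda>x. sqrt (\<Sum>m<d. (x $ m)\<^sup>2)) \<in> borel_measurable (borel_vec d)"
    by measurable
  then show ?thesis by (subst measurable_cong[OF norm_vec_eq]) auto
qed

abbreviation ball_vec :: "nat \<Rightarrow> real vec set" where
  "ball_vec d \<equiv> {x \<in> carrier_vec d. norm_vec x \<le> 1}"

abbreviation normalize_vec :: "real vec \<Rightarrow> real vec" where
  "normalize_vec x \<equiv> (1 / norm_vec x) \<cdot>\<^sub>v x"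

lemma ball_vec_sets [measurable]: "ball_vec d \<in> sets (borel_vec d)"
proof -
  have "{x \<in> space (borel_vec d). norm_vec x \<le> 1} \<in> sets (borel_vec d)" by measurable
  then show ?thesis by simp
qed

lemma sphere_vec_sets [measurable]: "sphere_vec d \<in> sets (borel_vec d)"
proof -
  have "{x \<in> space (borel_vec d). norm_vec x = 1} \<in> sets (borel_vec d)" by measurable
  then show ?thesis by (simp add: sphere_vec_def)
qed

lemma measurable_normalize_vec [measurable]: "normalize_vec \<in> borel_vec d \<rightarrow>\<^sub>M borel_vec d"
proof (rule measurable_borel_vecI)
  fix i assume i: "i < d"
  note [measurable] = measurable_borel_vec_coord[OF i]
  have "(\<lambda>x. 1 / norm_vec x * x $ i) \<in> borel_measurable (borel_vec d)" by measurable
  moreover have "normalize_vec x $ i = 1 / norm_vec x * x $ i" if "x \<in> space (borel_vec d)" for x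
    using i that by simp
  ultimately show "(\<lambda>x. normalize_vec x $ i) \<in> borel_measurable (borel_vec d)"
    by (subst measurable_cong) auto
qed auto

lemma sets_lborel_vec [simp, measurable_cong]: "sets (lborel_vec d) = sets (borel_vec d)"
  by (simp add: lborel_vec_def)

lemma space_lborel_vec [simp]: "space (lborel_vec d) = carrier_vec d"
  by (simp add: lborel_vec_def)

lemma measurable_lborel_vec: "f \<in> borel_vec d \<rightarrow>\<^sub>M N \<Longrightarrow> f \<in> lborel_vec d \<rightarrow>\<^sub>M N"
  using measurable_cong_sets[of "lborel_vec d" "borel_vec d" N N] by simp

lemma measurable_uniform_lborel_vec:
  "f \<in> borel_vec d \<rightarrow>\<^sub>M N \<Longrightarrow> f \<in> uniform_measure (lborel_vec d) A \<rightarrow>\<^sub>M N"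
  using measurable_cong_sets[of "uniform_measure (lborel_vec d) A" "borel_vec d" N N] by simp

lemma measurable_vec_PiM: "vec d \<in> (\<Pi>\<^sub>M i\<in>{..<d}. lborel) \<rightarrow>\<^sub>M borel_vec d"
proof (rule measurable_borel_vecI)
  fix i assume "i < d"
  then show "(\<lambda>x. vec d x $ i) \<in> borel_measurable (\<Pi>\<^sub>M i\<in>{..<d}. lborel)"
    using measurable_component_singleton[of i "{..<d}" "\<lambda>_. lborel"] by simp
qed simp

subsection \<open>Shears and rotations\<close>

text \<open>With the other coordinates fixed, a shear translates coordinate \<open>i\<close>;
  Fubini's theorem and the translation invariance of Lebesgue measure on the line give the
  claim.\<close>

lemma distr_PiM_shear:
  fixes t :: real
  assumes i: "i < d" "l < d" "i \<noteq> l"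
  defines "P \<equiv> (\<Pi>\<^sub>M i\<in>{..<d}. lborel) :: (nat \<Rightarrow> real) measure"
  defines "S \<equiv> (\<lambda>x :: nat \<Rightarrow> real. x(i := x i + t * x l))"
  shows "distr P P S = P" and "S \<in> P \<rightarrow>\<^sub>M P"
proof -
  interpret product_sigma_finite "\<lambda>_ :: nat. lborel :: real measure" ..
  have [measurable]: "(\<lambda>x. x m) \<in> P \<rightarrow>\<^sub>M borel" if "m < d" for m
    unfolding P_def using that measurable_component_singleton[of m "{..<d}" "\<lambda>_. lborel :: real measure"] by simp
  have "(\<lambda>x. x i + t * x l) \<in> borel_measurable P" using i by measurable
  then show S: "S \<in> P \<rightarrow>\<^sub>M P"
    unfolding S_def P_def
  proof (intro measurable_fun_upd)
    show "{..<d} = {..<d} \<union> {i}" using i by auto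
    show "(\<lambda>x. x) \<in> PiM {..<d} (\<lambda>_. lborel :: real measure) \<rightarrow>\<^sub>M PiM {..<d} (\<lambda>_. lborel)"
      by (rule measurable_ident_sets) simp
  qed simp
  show "distr P P S = P"
  proof (rule measure_eqI)
    fix A assume "A \<in> sets (distr P P S)"
    then have A [measurable]: "A \<in> sets P" by simp
    let ?J = "{..<d} - {i}"
    have ins: "insert i ({..<d} - {i}) = {..<d}" using i by (simp add: insert_absorb)
    have f: "(\<lambda>x. indicator A (S x) :: ennreal) \<in> borel_measurable P"
      by (rule measurable_compose[OF S borel_measurable_indicator[OF A]])
    have m: "(\<lambda>y. indicator A (x(i := y)) :: ennreal) \<in> borel_measurable borel" if "x \<in> space (PiM ?J (\<lambda>_. lborel :: real measure))" for x
    proof -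
      have "(\<lambda>y. x(i := y)) \<in> (lborel :: real measure) \<rightarrow>\<^sub>M P"
        unfolding P_def
      proof (rule measurable_fun_upd)
        show "{..<d} = ?J \<union> {i}" using i by auto
        show "(\<lambda>y. x) \<in> (lborel :: real measure) \<rightarrow>\<^sub>M PiM ?J (\<lambda>_. lborel)"
          using that by (rule measurable_const)
        show "(\<lambda>y. y) \<in> (lborel :: real measure) \<rightarrow>\<^sub>M lborel" by (rule measurable_ident_sets) simp
      qed
      from measurable_compose[OF this borel_measurable_indicator[OF A]] show ?thesis by simp
    qed
    have "emeasure (distr P P S) A = (\<integral>\<^sup>+ x. indicator A (S x) \<partial>P)"
      using nn_integral_indicator[of A "distr P P S"] nn_integral_distr[OF S, of "indicator A"] A
      by (simp add: borel_measurable_indicator)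
    also have "\<dots> = (\<integral>\<^sup>+ x. (\<integral>\<^sup>+ y. indicator A (S (x(i := y))) \<partial>lborel) \<partial>PiM ?J (\<lambda>_. lborel))"
      using product_nn_integral_insert[of ?J i "\<lambda>x. indicator A (S x)"] f unfolding P_def ins by simp
    also have "\<dots> = (\<integral>\<^sup>+ x. (\<integral>\<^sup>+ y. indicator A (x(i := y)) \<partial>lborel) \<partial>PiM ?J (\<lambda>_. lborel))"
    proof (rule nn_integral_cong)
      fix x assume x: "x \<in> space (PiM ?J (\<lambda>_. lborel :: real measure))"
      have "S (x(i := y)) = x(i := t * x l + 1 * y)" for y using i by (auto simp: S_def)
      then show "(\<integral>\<^sup>+ y. indicator A (S (x(i := y))) \<partial>lborel) = (\<integral>\<^sup>+ y. indicator A (x(i := y)) \<partial>lborel)"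
        using nn_integral_real_affine[OF m[OF x], of 1 "t * x l"] by simp
    qed
    also have "\<dots> = (\<integral>\<^sup>+ x. indicator A x \<partial>P)"
      using product_nn_integral_insert[of ?J i "indicator A"] A unfolding P_def ins
      by (simp add: borel_measurable_indicator)
    finally show "emeasure (distr P P S) A = emeasure P A" using A by simp
  qed simp
qed

definition shear_vec :: "nat \<Rightarrow> nat \<Rightarrow> nat \<Rightarrow> real \<Rightarrow> real vec \<Rightarrow> real vec" where
  "shear_vec d i l t x = vec d (\<lambda>m. if m = i then x $ i + t * x $ l else x $ m)"

definition plane_rot :: "nat \<Rightarrow> nat \<Rightarrow> nat \<Rightarrow> real \<Rightarrow> real vec \<Rightarrow> real vec" where
  "plane_rot d i l \<gamma> x = vec d (\<lambda>m. if m = i then cos \<gamma> * x $ i - sin \<gamma> * x $ l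
     else if m = l then sin \<gamma> * x $ i + cos \<gamma> * x $ l else x $ m)"

lemma plane_rot_carrier [simp]: "plane_rot d i l \<gamma> x \<in> carrier_vec d"
  by (simp add: plane_rot_def)

lemma measurable_shear_vec: "i < d \<Longrightarrow> l < d \<Longrightarrow> shear_vec d i l t \<in> borel_vec d \<rightarrow>\<^sub>M borel_vec d"
  unfolding shear_vec_def
proof (rule measurable_borel_vecI)
  fix m assume "i < d" "l < d" "m < d"
  then show "(\<lambda>x. vec d (\<lambda>m. if m = i then x $ i + t * x $ l else x $ m) $ m) \<in> borel_measurable (borel_vec d)"
    by (cases "m = i") (auto intro!: borel_measurable_add borel_measurable_times
        borel_measurable_const measurable_borel_vec_coord)
qed simp

lemma measurable_plane_rot [measurable]:
  "i < d \<Longrightarrow> l < d \<Longrightarrow> plane_rot d i l \<gamma> \<in> borel_vec d \<rightarrow>\<^sub>M borel_vec d"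
  unfolding plane_rot_def
proof (rule measurable_borel_vecI)
  fix m assume "i < d" "l < d" "m < d"
  then show "(\<lambda>x. vec d (\<lambda>m. if m = i then cos \<gamma> * x $ i - sin \<gamma> * x $ l
     else if m = l then sin \<gamma> * x $ i + cos \<gamma> * x $ l else x $ m) $ m) \<in> borel_measurable (borel_vec d)"
    by (cases "m = i"; cases "m = l")
      (auto intro!: borel_measurable_add borel_measurable_diff borel_measurable_times
        borel_measurable_const measurable_borel_vec_coord)
qed simp

lemma distr_lborel_vec_shear:
  assumes i: "i < d" "l < d" "i \<noteq> l"
  shows "distr (lborel_vec d) (borel_vec d) (shear_vec d i l t) = lborel_vec d"
proof -
  let ?P = "(\<Pi>\<^sub>M i\<in>{..<d}. lborel) :: (nat \<Rightarrow> real) measure"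
  let ?S = "\<lambda>x :: nat \<Rightarrow> real. x(i := x i + t * x l)"
  note S = distr_PiM_shear[OF i]
  have "distr (lborel_vec d) (borel_vec d) (shear_vec d i l t)
      = distr ?P (borel_vec d) (shear_vec d i l t \<circ> vec d)"
    unfolding lborel_vec_def by (intro distr_distr measurable_shear_vec measurable_vec_PiM i)
  also have "\<dots> = distr ?P (borel_vec d) (vec d \<circ> ?S)"
    by (rule distr_cong) (use i in \<open>auto simp: shear_vec_def\<close>)
  also have "\<dots> = distr (distr ?P ?P ?S) (borel_vec d) (vec d)"
    by (intro distr_distr[symmetric] measurable_vec_PiM S)
  also have "\<dots> = lborel_vec d" unfolding S lborel_vec_def ..
  finally show ?thesis .
qed

text \<open>The classical factorization of a rotation into three shears, with coefficient
  -tan(\<gamma>/2) in the outer two and sin \<gamma> in the middle one. At a half-turn the tangent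
  is infinite, whence the condition on the cosine.\<close>

lemma plane_rot_shears:
  assumes i: "i < d" "l < d" "i \<noteq> l" and c: "cos \<gamma> \<noteq> -1"
  defines "\<alpha> \<equiv> - sin \<gamma> / (1 + cos \<gamma>)"
  assumes x: "x \<in> carrier_vec d"
  shows "plane_rot d i l \<gamma> x = (shear_vec d i l \<alpha> \<circ> (shear_vec d l i (sin \<gamma>) \<circ> shear_vec d i l \<alpha>)) x"
proof -
  have c': "1 + cos \<gamma> \<noteq> 0" using c by (simp add: add_eq_0_iff)
  have "sin \<gamma> * sin \<gamma> = (1 - cos \<gamma>) * (1 + cos \<gamma>)"
    using sin_cos_squared_add[of \<gamma>] by (simp add: power2_eq_square algebra_simps)
  then have a: "\<alpha> * sin \<gamma> = cos \<gamma> - 1" using c' by (simp add: \<alpha>_def field_simps)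
  have b: "\<alpha> * (1 + cos \<gamma>) = - sin \<gamma>" using c' by (simp add: \<alpha>_def)
  have 1: "x $ l + sin \<gamma> * (x $ i + \<alpha> * x $ l) = sin \<gamma> * x $ i + cos \<gamma> * x $ l"
  proof -
    have "x $ l + sin \<gamma> * (x $ i + \<alpha> * x $ l) = sin \<gamma> * x $ i + (1 + \<alpha> * sin \<gamma>) * x $ l"
      by (simp add: algebra_simps)
    then show ?thesis by (simp add: a)
  qed
  have "x $ i + \<alpha> * x $ l + \<alpha> * (sin \<gamma> * x $ i + cos \<gamma> * x $ l)
      = (1 + \<alpha> * sin \<gamma>) * x $ i + (\<alpha> * (1 + cos \<gamma>)) * x $ l" by (simp add: algebra_simps)
  then have 2: "x $ i + \<alpha> * x $ l + \<alpha> * (sin \<gamma> * x $ i + cos \<gamma> * x $ l) = cos \<gamma> * x $ i - sin \<gamma> * x $ l"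
    by (simp add: a b)
  show ?thesis
    by (rule eq_vecI) (use i in \<open>auto simp: plane_rot_def shear_vec_def 1 2\<close>)
qed

lemma distr_comp_invariant:
  assumes "f \<in> N \<rightarrow>\<^sub>M N" "g \<in> N \<rightarrow>\<^sub>M N" "sets M = sets N" "distr M N f = M" "distr M N g = M"
  shows "distr M N (f \<circ> g) = M"
proof -
  have g: "g \<in> M \<rightarrow>\<^sub>M N" using assms by (simp cong: measurable_cong_sets)
  have "distr M N (f \<circ> g) = distr (distr M N g) N f"
    using assms(1) g by (rule distr_distr[symmetric])
  then show ?thesis using assms by simp
qed

lemma distr_lborel_vec_rot:
  assumes i: "i < d" "l < d" "i \<noteq> l" and c: "cos \<gamma> \<noteq> -1"
  shows "distr (lborel_vec d) (borel_vec d) (plane_rot d i l \<gamma>) = lborel_vec d"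
proof -
  let ?a = "- sin \<gamma> / (1 + cos \<gamma>)"
  have "distr (lborel_vec d) (borel_vec d) (plane_rot d i l \<gamma>) = distr (lborel_vec d) (borel_vec d)
      (shear_vec d i l ?a \<circ> (shear_vec d l i (sin \<gamma>) \<circ> shear_vec d i l ?a))"
    by (rule distr_cong) (use plane_rot_shears[OF i c] in auto)
  also have "\<dots> = lborel_vec d"
    by (intro distr_comp_invariant measurable_comp[of _ "borel_vec d" "borel_vec d"] measurable_shear_vec
      distr_lborel_vec_shear i i(3)[symmetric]) simp_all
  finally show ?thesis .
qed

lemma sum_squares_plane_rot:
  assumes i: "i < l" "l < d" "J \<subseteq> {..<d}" "i \<in> J \<longleftrightarrow> l \<in> J"
  shows "(\<Sum>m\<in>J. (plane_rot d i l \<gamma> x $ m)\<^sup>2) = (\<Sum>m\<in>J. (x $ m)\<^sup>2)"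
proof (cases "i \<in> J")
  case True
  have fin: "finite J" using i finite_subset by blast
  have split: "(\<Sum>m\<in>J. h m) = h i + h l + (\<Sum>m\<in>J - {i} - {l}. h m)" for h :: "nat \<Rightarrow> real"
    using fin True i sum.remove[of J i h] sum.remove[of "J - {i}" l h] by auto
  have "(\<Sum>m\<in>J - {i} - {l}. (plane_rot d i l \<gamma> x $ m)\<^sup>2) = (\<Sum>m\<in>J - {i} - {l}. (x $ m)\<^sup>2)"
    by (rule sum.cong) (use i in \<open>auto simp: plane_rot_def\<close>)
  moreover have "(cos \<gamma> * a - sin \<gamma> * b)\<^sup>2 + (sin \<gamma> * a + cos \<gamma> * b)\<^sup>2 = a\<^sup>2 + b\<^sup>2" for a b
  proof -
    have "(C * a - S * b)\<^sup>2 + (S * a + C * b)\<^sup>2 = (S\<^sup>2 + C\<^sup>2) * a\<^sup>2 + (S\<^sup>2 + C\<^sup>2) * b\<^sup>2" for S C :: real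
      by (simp add: power2_eq_square algebra_simps)
    from this[of "cos \<gamma>" "sin \<gamma>"] show ?thesis by simp
  qed
  ultimately show ?thesis unfolding split using i by (simp add: plane_rot_def)
next
  case False
  then show ?thesis using i by (intro sum.cong) (auto simp: plane_rot_def)
qed

lemma norm_plane_rot:
  "i < l \<Longrightarrow> l < d \<Longrightarrow> x \<in> carrier_vec d \<Longrightarrow> norm_vec (plane_rot d i l \<gamma> x) = norm_vec x"
  by (simp add: norm_vec_eq[of _ d] sum_squares_plane_rot)

lemma plane_rot_sphere:
  "i < l \<Longrightarrow> l < d \<Longrightarrow> x \<in> carrier_vec d \<Longrightarrow> plane_rot d i l \<gamma> x \<in> sphere_vec d \<longleftrightarrow> x \<in> sphere_vec d"
  by (simp add: sphere_vec_def norm_plane_rot)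

abbreviation radial_measure :: "nat \<Rightarrow> real vec measure" where
  "radial_measure d \<equiv> distr (uniform_measure (lborel_vec d) (ball_vec d)) (borel_vec d) normalize_vec"

text \<open>Rotations preserve the norm, hence the ball, and commute with the radial projection. So
  the invariance of Lebesgue measure passes first to the uniform measure on the ball and then to its
  image.\<close>

lemma distr_radial_measure_rot:
  assumes i: "i < l" "l < d" and c: "cos \<gamma> \<noteq> -1"
  shows "distr (radial_measure d) (borel_vec d) (plane_rot d i l \<gamma>) = radial_measure d"
proof -
  let ?R = "plane_rot d i l \<gamma>" and ?U = "uniform_measure (lborel_vec d) (ball_vec d)"
  have R [measurable]: "?R \<in> borel_vec d \<rightarrow>\<^sub>M borel_vec d" using i by (intro measurable_plane_rot) auto
  have U: "distr ?U (borel_vec d) ?R = ?U"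
  proof (rule measure_eqI)
    fix A assume "A \<in> sets (distr ?U (borel_vec d) ?R)"
    then have A [measurable]: "A \<in> sets (borel_vec d)" by simp
    have RA: "?R -` A \<inter> carrier_vec d \<in> sets (borel_vec d)"
      using measurable_sets[OF R A] by simp
    have RU: "?R \<in> ?U \<rightarrow>\<^sub>M borel_vec d" by (rule measurable_uniform_lborel_vec[OF R])
    have "emeasure (distr ?U (borel_vec d) ?R) A = emeasure ?U (?R -` A \<inter> carrier_vec d)"
      by (subst emeasure_distr[OF RU A]) simp
    also have "\<dots> = emeasure (lborel_vec d) (ball_vec d \<inter> (?R -` A \<inter> carrier_vec d))
        / emeasure (lborel_vec d) (ball_vec d)"
      using RA by (intro emeasure_uniform_measure) (auto simp: ball_vec_sets)
    also have "ball_vec d \<inter> (?R -` A \<inter> carrier_vec d) = ?R -` (ball_vec d \<inter> A) \<inter> carrier_vec d"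
      using i by (auto simp: norm_plane_rot)
    also have "emeasure (lborel_vec d) \<dots> = emeasure (distr (lborel_vec d) (borel_vec d) ?R) (ball_vec d \<inter> A)"
    proof -
      have "ball_vec d \<inter> A \<in> sets (borel_vec d)" using ball_vec_sets A by (rule sets.Int)
      then show ?thesis using measurable_lborel_vec[OF R] by (subst emeasure_distr) auto
    qed
    also have "\<dots> = emeasure (lborel_vec d) (ball_vec d \<inter> A)"
      using i c by (subst distr_lborel_vec_rot) auto
    finally show "emeasure (distr ?U (borel_vec d) ?R) A = emeasure ?U A"
      by (simp add: ball_vec_sets A)
  qed simp
  have NU: "normalize_vec \<in> ?U \<rightarrow>\<^sub>M borel_vec d" and RU: "?R \<in> ?U \<rightarrow>\<^sub>M borel_vec d"
    by (intro measurable_uniform_lborel_vec measurable_normalize_vec R)+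
  have "distr (radial_measure d) (borel_vec d) ?R = distr ?U (borel_vec d) (?R \<circ> normalize_vec)"
    by (rule distr_distr[OF R NU])
  also have "\<dots> = distr ?U (borel_vec d) (normalize_vec \<circ> ?R)"
  proof (rule distr_cong)
    fix x assume "x \<in> space ?U"
    then have x: "x \<in> carrier_vec d" by simp
    have "norm_vec (?R x) = norm_vec x" using x i by (intro norm_plane_rot)
    then show "(?R \<circ> normalize_vec) x = (normalize_vec \<circ> ?R) x"
      using x i by (intro eq_vecI) (auto simp: plane_rot_def add_divide_distrib diff_divide_distrib)
  qed auto
  also have "\<dots> = distr (distr ?U (borel_vec d) ?R) (borel_vec d) normalize_vec"
    by (rule distr_distr[OF measurable_normalize_vec RU, symmetric])
  finally show ?thesis unfolding U .
qed

lemma space_sphere_measure [simp]: "space (sphere_measure d) = sphere_vec d"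
  by (auto simp: sphere_measure_def space_restrict_space sphere_vec_def)

lemma sphere_measure_measurable:
  "f \<in> borel_vec d \<rightarrow>\<^sub>M N \<Longrightarrow> f \<in> sphere_measure d \<rightarrow>\<^sub>M N"
  unfolding sphere_measure_def by (rule measurable_restrict_space1) simp

text \<open>The sphere is invariant, so its indicator may be composed with the rotation; the
  integral over the restricted measure becomes one over the invariant radial measure.\<close>

lemma sphere_integral_rot:
  fixes f :: "real vec \<Rightarrow> complex"
  assumes i: "i < l" "l < d" and c: "cos \<gamma> \<noteq> -1" and f [measurable]: "f \<in> borel_measurable (borel_vec d)"
  shows "(LINT x|sphere_measure d. f (plane_rot d i l \<gamma> x)) = (LINT x|sphere_measure d. f x)"
proof -
  let ?R = "plane_rot d i l \<gamma>"
  have R [measurable]: "?R \<in> borel_vec d \<rightarrow>\<^sub>M borel_vec d" using i by (intro measurable_plane_rot) auto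
  have "(LINT x|sphere_measure d. f (?R x))
      = (LINT x|radial_measure d. indicator (sphere_vec d) x *\<^sub>R f (?R x))"
    unfolding sphere_measure_def by (rule integral_restrict_space) (simp add: sphere_vec_sets)
  also have "\<dots> = (LINT x|radial_measure d. indicator (sphere_vec d) (?R x) *\<^sub>R f (?R x))"
    by (rule Bochner_Integration.integral_cong) (use i in \<open>auto simp: plane_rot_sphere indicator_def\<close>)
  also have "\<dots> = (LINT x|distr (radial_measure d) (borel_vec d) ?R. indicator (sphere_vec d) x *\<^sub>R f x)"
  proof (rule integral_distr[symmetric])
    show "?R \<in> radial_measure d \<rightarrow>\<^sub>M borel_vec d"
      using R measurable_cong_sets[of "radial_measure d" "borel_vec d" "borel_vec d" "borel_vec d"] by simp
    show "(\<lambda>x. indicat_real (sphere_vec d) x *\<^sub>R f x) \<in> borel_measurable (borel_vec d)"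
      by (intro borel_measurable_scaleR borel_measurable_indicator sphere_vec_sets f)
  qed
  also have "\<dots> = (LINT x|radial_measure d. indicator (sphere_vec d) x *\<^sub>R f x)"
    by (simp only: distr_radial_measure_rot[OF i c])
  also have "\<dots> = (LINT x|sphere_measure d. f x)"
    unfolding sphere_measure_def by (rule integral_restrict_space[symmetric]) (simp add: sphere_vec_sets)
  finally show ?thesis .
qed

subsection \<open>Finiteness and positivity\<close>

lemma lborel_vec_box:
  assumes "\<And>i. i < d \<Longrightarrow> a \<le> (b :: real)"
  shows box_vec_sets: "{x \<in> carrier_vec d. \<forall>i<d. a \<le> x $ i \<and> x $ i \<le> b} \<in> sets (borel_vec d)" (is "?B \<in> _")
    and "emeasure (lborel_vec d) {x \<in> carrier_vec d. \<forall>i<d. a \<le> x $ i \<and> x $ i \<le> b} = ennreal (b - a) ^ d"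
proof -
  interpret product_sigma_finite "\<lambda>_ :: nat. lborel :: real measure" ..
  have "{x \<in> space (borel_vec d). \<forall>i\<in>{..<d}. a \<le> x $ i \<and> x $ i \<le> b} \<in> sets (borel_vec d)"
  proof (rule sets.sets_Collect_finite_All)
    fix i assume "i \<in> {..<d}"
    then have [measurable]: "(\<lambda>x. x $ i) \<in> borel_measurable (borel_vec d)"
      by (simp add: measurable_borel_vec_coord)
    show "{x \<in> space (borel_vec d). a \<le> x $ i \<and> x $ i \<le> b} \<in> sets (borel_vec d)" by measurable
  qed simp
  then show B: "?B \<in> sets (borel_vec d)" by (simp add: Ball_def)
  have "emeasure (lborel_vec d) ?B = emeasure (\<Pi>\<^sub>M i\<in>{..<d}. lborel) (vec d -` ?B \<inter> space (\<Pi>\<^sub>M i\<in>{..<d}. lborel))"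
    unfolding lborel_vec_def using B by (intro emeasure_distr measurable_vec_PiM)
  also have "vec d -` ?B \<inter> space (\<Pi>\<^sub>M i\<in>{..<d}. lborel) = Pi\<^sub>E {..<d} (\<lambda>_. {a..b})"
    by (auto simp: space_PiM PiE_def Pi_def)
  also have "emeasure (\<Pi>\<^sub>M i\<in>{..<d}. lborel) \<dots> = (\<Prod>i<d. emeasure lborel {a..b})"
    by (intro emeasure_PiM) measurable
  also have "\<dots> = (\<Prod>i<d. ennreal (b - a))"
    by (rule prod.cong) (use assms in auto)
  finally show "emeasure (lborel_vec d) ?B = ennreal (b - a) ^ d" by simp
qed

text \<open>The box has positive volume and stays away from the origin. It serves twice: the ball
  has positive volume, and a set of positive mass is projected into the sphere instead of being left
  at the origin.\<close>

lemma box_subset_ball: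
  assumes "d > 0"
  shows "{x \<in> carrier_vec d. \<forall>i<d. 1 / (2 * real d) \<le> x $ i \<and> x $ i \<le> 1 / real d} \<subseteq> ball_vec d"
proof safe
  fix x assume x: "x \<in> carrier_vec d" "\<forall>i<d. 1 / (2 * real d) \<le> x $ i \<and> x $ i \<le> 1 / real d"
  have "(\<Sum>m<d. (x $ m)\<^sup>2) \<le> (\<Sum>m<d. 1 / real d)"
  proof (rule sum_mono)
    fix m assume "m \<in> {..<d}"
    then have m: "0 \<le> x $ m" "x $ m \<le> 1 / real d" using x(2) by (auto intro: order_trans[rotated])
    have "1 / real d \<le> 1" using assms by (auto simp: field_simps)
    then have "(x $ m)\<^sup>2 \<le> x $ m * 1"
      unfolding power2_eq_square using m by (intro mult_left_mono) auto
    then show "(x $ m)\<^sup>2 \<le> 1 / real d" using m by simp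
  qed
  then show "norm_vec x \<le> 1" using assms x by (simp add: norm_vec_eq)
qed

lemma emeasure_ball_vec:
  assumes "d > 0"
  shows "emeasure (lborel_vec d) (ball_vec d) \<noteq> 0" "emeasure (lborel_vec d) (ball_vec d) \<noteq> \<infinity>"
proof -
  have le: "1 / (2 * real d) \<le> 1 / real d" using assms by (auto simp: field_simps)
  have "0 < ennreal (1 / real d - 1 / (2 * real d)) ^ d"
    using assms by (auto simp: field_simps ennreal_power)
  also have "\<dots> = emeasure (lborel_vec d)
      {x \<in> carrier_vec d. \<forall>i<d. 1 / (2 * real d) \<le> x $ i \<and> x $ i \<le> 1 / real d}"
    using le by (subst lborel_vec_box) auto
  also have "\<dots> \<le> emeasure (lborel_vec d) (ball_vec d)"
    by (rule emeasure_mono[OF box_subset_ball[OF assms]]) (simp add: ball_vec_sets)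
  finally show "emeasure (lborel_vec d) (ball_vec d) \<noteq> 0" by simp
  have "ball_vec d \<subseteq> {x \<in> carrier_vec d. \<forall>i<d. -1 \<le> x $ i \<and> x $ i \<le> 1}"
  proof safe
    fix x i assume x: "x \<in> carrier_vec d" "norm_vec x \<le> 1" and i: "i < d"
    have "(x $ i)\<^sup>2 \<le> (\<Sum>m<d. (x $ m)\<^sup>2)" using i by (intro member_le_sum) auto
    also have "\<dots> \<le> 1" using x by (simp add: norm_vec_eq)
    finally have "\<bar>x $ i\<bar> \<le> 1" by (simp add: abs_square_le_1)
    then show "-1 \<le> x $ i" "x $ i \<le> 1" by auto
  qed
  then have "emeasure (lborel_vec d) (ball_vec d)
      \<le> emeasure (lborel_vec d) {x \<in> carrier_vec d. \<forall>i<d. -1 \<le> x $ i \<and> x $ i \<le> 1}"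
    by (rule emeasure_mono) (simp add: lborel_vec_box)
  also have "\<dots> = ennreal 2 ^ d" by (subst lborel_vec_box) auto
  also have "\<dots> < \<infinity>" by (subst ennreal_power) (auto simp del: ennreal_numeral)
  finally show "emeasure (lborel_vec d) (ball_vec d) \<noteq> \<infinity>" by simp
qed

lemma prob_space_radial_measure: "d > 0 \<Longrightarrow> prob_space (radial_measure d)"
  using prob_space_uniform_measure[OF emeasure_ball_vec, of d]
  by (rule prob_space.prob_space_distr) (auto intro: measurable_uniform_lborel_vec measurable_normalize_vec)

lemma finite_measure_sphere: "d > 0 \<Longrightarrow> finite_measure (sphere_measure d)"
  unfolding sphere_measure_def
  using prob_space.finite_measure[OF prob_space_radial_measure]
  by (rule finite_measure_restrict_space) (simp_all add: sphere_vec_sets)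

text \<open>Gives the constant basis function a positive norm, on which the contradiction with the
  lower frame bound rests.\<close>

lemma sphere_measure_pos:
  assumes "d > 0" shows "measure (sphere_measure d) (sphere_vec d) > 0"
proof -
  interpret prob_space "radial_measure d" using prob_space_radial_measure[OF assms] .
  let ?B = "{x \<in> carrier_vec d. \<forall>i<d. 1 / (2 * real d) \<le> x $ i \<and> x $ i \<le> 1 / real d}"
  let ?V = "emeasure (lborel_vec d) (ball_vec d)"
  have le: "1 / (2 * real d) \<le> 1 / real d" using assms by (auto simp: field_simps)
  have B [measurable]: "?B \<in> sets (borel_vec d)" using le by (intro lborel_vec_box) auto
  have sub: "?B \<subseteq> normalize_vec -` sphere_vec d \<inter> carrier_vec d"
  proof (rule subsetI)
    fix x assume "x \<in> ?B"
    then have x: "x \<in> carrier_vec d" "\<forall>i<d. 1 / (2 * real d) \<le> x $ i \<and> x $ i \<le> 1 / real d" by auto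
    have "0 < 1 / (2 * real d)" using assms by simp
    then have "x $ 0 > 0" using x(2) assms by (metis less_le_trans)
    moreover have "(x $ 0)\<^sup>2 \<le> (\<Sum>m<d. (x $ m)\<^sup>2)" using assms by (intro member_le_sum) auto
    ultimately have "(\<Sum>m<d. (x $ m)\<^sup>2) > 0" by (meson less_le_trans zero_less_power)
    moreover have "(\<Sum>m<d. (normalize_vec x $ m)\<^sup>2) = (1 / norm_vec x)\<^sup>2 * (\<Sum>m<d. (x $ m)\<^sup>2)"
      unfolding sum_distrib_left by (rule sum.cong) (use x in \<open>auto simp: power_mult_distrib power_divide\<close>)
    ultimately have "normalize_vec x \<in> sphere_vec d"
      using x by (auto simp: sphere_vec_iff norm_vec_eq power_divide)
    then show "x \<in> normalize_vec -` sphere_vec d \<inter> carrier_vec d" using x by simp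
  qed
  have "0 < ennreal (1 / real d - 1 / (2 * real d)) ^ d"
    using assms by (auto simp: field_simps ennreal_power)
  also have "\<dots> = emeasure (lborel_vec d) (ball_vec d \<inter> ?B)"
    using le box_subset_ball[OF assms] lborel_vec_box(2)[of d "1 / (2 * real d)" "1 / real d"]
    by (simp add: Int_absorb1)
  finally have "0 < emeasure (lborel_vec d) (ball_vec d \<inter> ?B) / ?V"
    using emeasure_ball_vec[OF assms] by (simp add: ennreal_zero_less_divide less_top)
  also have "\<dots> = emeasure (uniform_measure (lborel_vec d) (ball_vec d)) ?B"
    by (rule emeasure_uniform_measure[symmetric]) (simp_all add: ball_vec_sets B)
  also have "\<dots> \<le> emeasure (uniform_measure (lborel_vec d) (ball_vec d)) (normalize_vec -` sphere_vec d \<inter> carrier_vec d)"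
    using measurable_sets[OF measurable_normalize_vec sphere_vec_sets, of d] by (intro emeasure_mono[OF sub]) simp
  also have "\<dots> = emeasure (radial_measure d) (sphere_vec d)"
    by (subst emeasure_distr[OF measurable_uniform_lborel_vec[OF measurable_normalize_vec] sphere_vec_sets]) simp
  also have "\<dots> = emeasure (sphere_measure d) (sphere_vec d)"
    unfolding sphere_measure_def by (subst emeasure_restrict_space) (auto simp: sphere_vec_sets)
  finally show ?thesis
    using finite_measure.emeasure_eq_measure[OF finite_measure_sphere[OF assms]] by simp
qed

lemma pfun_measurable: "pfun d f \<Longrightarrow> f \<in> borel_measurable (borel_vec d)"
proof (induction rule: pfun.induct)
  case (coord i)
  then have [measurable]: "(\<lambda>x. x $ i) \<in> borel_measurable (borel_vec d)" by (rule measurable_borel_vec_coord)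
  show ?case by measurable
qed (auto intro: borel_measurable_add borel_measurable_times borel_measurable_const)

lemma sphere_coord_le:
  assumes "x \<in> sphere_vec d" "i < d" shows "\<bar>x $ i\<bar> \<le> 1"
proof -
  have "(x $ i)\<^sup>2 \<le> (\<Sum>m<d. (x $ m)\<^sup>2)" using assms(2) by (intro member_le_sum) auto
  then show ?thesis using assms by (simp add: sphere_vec_iff abs_square_le_1)
qed

lemma pfun_bounded: "pfun d f \<Longrightarrow> \<exists>B. \<forall>x\<in>sphere_vec d. norm (f x) \<le> B"
proof (induction rule: pfun.induct)
  case (coord i)
  then show ?case by (intro exI[of _ 1]) (auto simp: sphere_coord_le)
next
  case (add f g)
  then obtain A B where "\<forall>x\<in>sphere_vec d. norm (f x) \<le> A" "\<forall>x\<in>sphere_vec d. norm (g x) \<le> B" by auto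
  then show ?case by (intro exI[of _ "A + B"]) (auto intro: norm_triangle_mono)
next
  case (mult f g)
  then obtain A B where "\<forall>x\<in>sphere_vec d. norm (f x) \<le> A" "\<forall>x\<in>sphere_vec d. norm (g x) \<le> B" by auto
  then show ?case
    by (intro exI[of _ "A * B"]) (auto simp: norm_mult intro!: mult_mono intro: order_trans[OF norm_ge_zero])
qed auto

lemma pfun_integrable:
  assumes "d > 0" "pfun d f" shows "integrable (sphere_measure d) f"
proof -
  obtain B where "\<forall>x\<in>sphere_vec d. norm (f x) \<le> B" using pfun_bounded[OF assms(2)] by blast
  then show ?thesis
    using assms by (intro finite_measure.integrable_const_bound[of _ _ B] finite_measure_sphere AE_I2
      sphere_measure_measurable pfun_measurable) auto
qed

section \<open>Infinitesimal rotations\<close>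

lemma plane_rot_coord:
  "m < d \<Longrightarrow> plane_rot d i l \<gamma> x $ m = (if m = i then cos \<gamma> * x $ i - sin \<gamma> * x $ l
     else if m = l then sin \<gamma> * x $ i + cos \<gamma> * x $ l else x $ m)"
  by (simp add: plane_rot_def)

lemma plane_rot_0 [simp]: "i < d \<Longrightarrow> l < d \<Longrightarrow> x \<in> carrier_vec d \<Longrightarrow> plane_rot d i l 0 x = x"
  by (rule eq_vecI) (auto simp: plane_rot_def)

lemma plane_rot_separated:
  assumes "i < d" "l < d" "m < d"
  shows "separated d 1 (\<lambda>\<gamma> x. of_real (plane_rot d i l \<gamma> x $ m))"
proof -
  have a: "separated d 1 (\<lambda>\<gamma> x. of_real (cos \<gamma>) * of_real (x $ i) + (of_real (- 1) * of_real (sin \<gamma>)) * of_real (x $ l))"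
    using assms by (intro separated_add separated_single trig_poly_cos trig_poly_scale trig_poly_sin pfun.coord)
  have b: "separated d 1 (\<lambda>\<gamma> x. of_real (sin \<gamma>) * of_real (x $ i) + of_real (cos \<gamma>) * of_real (x $ l))"
    using assms by (intro separated_add separated_single trig_poly_cos trig_poly_sin pfun.coord)
  have c: "separated d 1 (\<lambda>\<gamma> x. of_real (x $ m))"
    using assms by (intro separated_pfun pfun.coord)
  show ?thesis using a b c assms(3) by (cases "m = i"; cases "m = l") (auto simp: plane_rot_coord)
qed

lemma cos_ne_minus_one: "\<bar>\<gamma>\<bar> \<le> 1 \<Longrightarrow> cos \<gamma> \<noteq> (-1 :: real)"
proof -
  assume "\<bar>\<gamma>\<bar> \<le> 1"
  then have "- (pi / 2) < \<gamma>" "\<gamma> < pi / 2" using pi_gt3 by linarith+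
  then have "cos \<gamma> > 0" by (rule cos_gt_zero_pi)
  then show ?thesis by simp
qed

lemma separated_derivative:
  assumes "separated d K F" "d > 0"
  shows "\<exists>G. pfun d G \<and> (\<forall>\<gamma>. pfun d (F \<gamma>)) \<and> (\<forall>x. ((\<lambda>\<gamma>. F \<gamma> x) has_vector_derivative G x) (at 0)) \<and>
    ((\<lambda>\<gamma>. LINT x|sphere_measure d. F \<gamma> x) has_vector_derivative (LINT x|sphere_measure d. G x)) (at 0)"
  using assms(1)
proof (induction rule: separated.induct)
  case zero
  then show ?case by (intro exI[of _ "\<lambda>_. 0"]) (auto intro: pfun.const)
next
  case (step \<tau> g f)
  then obtain G where G: "pfun d G" "\<And>\<gamma>. pfun d (f \<gamma>)" "\<And>x. ((\<lambda>\<gamma>. f \<gamma> x) has_vector_derivative G x) (at 0)"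
    "((\<lambda>\<gamma>. LINT x|sphere_measure d. f \<gamma> x) has_vector_derivative (LINT x|sphere_measure d. G x)) (at 0)" by blast
  define D where "D = vector_derivative \<tau> (at 0)"
  have \<tau>: "(\<tau> has_vector_derivative D) (at 0)"
    using trig_poly_differentiable[OF step(1), of 0] unfolding D_def vector_derivative_works .
  have [simp]: "integrable (sphere_measure d) g" "integrable (sphere_measure d) G"
    "\<And>\<gamma>. integrable (sphere_measure d) (f \<gamma>)"
    using assms(2) step(2) G by (auto intro: pfun_integrable)
  show ?case
  proof (intro exI[of _ "\<lambda>x. D * g x + G x"] conjI allI)
    show "pfun d (\<lambda>x. D * g x + G x)" "pfun d (\<lambda>x. \<tau> \<gamma> * g x + f \<gamma> x)" for \<gamma>
      using step(2) G by (auto intro!: pfun_intros)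
    show "((\<lambda>\<gamma>. \<tau> \<gamma> * g x + f \<gamma> x) has_vector_derivative D * g x + G x) (at 0)" for x
      by (intro has_vector_derivative_add has_vector_derivative_mult_left \<tau> G)
    have "((\<lambda>\<gamma>. \<tau> \<gamma> * (LINT x|sphere_measure d. g x) + (LINT x|sphere_measure d. f \<gamma> x))
      has_vector_derivative D * (LINT x|sphere_measure d. g x) + (LINT x|sphere_measure d. G x)) (at 0)"
      by (intro has_vector_derivative_add has_vector_derivative_mult_left \<tau> G)
    then show "((\<lambda>\<gamma>. LINT x|sphere_measure d. \<tau> \<gamma> * g x + f \<gamma> x) has_vector_derivative
      (LINT x|sphere_measure d. D * g x + G x)) (at 0)" by simp
  qed
qed

text \<open>For small angles the integral over the rotated point is constant in the angle, so its
  derivative at 0 vanishes. The separated form of the integrand identifies this derivative with the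
  integral of \<open>p'\<close>.\<close>

lemma sphere_integral_rot_deriv:
  assumes i: "i < l" "l < d" and p: "pfun d p"
    and deriv: "\<And>x. x \<in> sphere_vec d \<Longrightarrow> ((\<lambda>\<gamma>. p (plane_rot d i l \<gamma> x)) has_vector_derivative p' x) (at 0)"
  shows "(LINT x|sphere_measure d. p' x) = 0"
proof -
  have d: "d > 0" using i by simp
  obtain K F where F: "separated d K F" "\<And>\<gamma> x. x \<in> carrier_vec d \<Longrightarrow> p (plane_rot d i l \<gamma> x) = F \<gamma> x"
    using pfun_separated[OF p plane_rot_separated refl, of i l] i by auto
  obtain G where G: "pfun d G" "\<And>x. ((\<lambda>\<gamma>. F \<gamma> x) has_vector_derivative G x) (at 0)"
    "((\<lambda>\<gamma>. LINT x|sphere_measure d. F \<gamma> x) has_vector_derivative (LINT x|sphere_measure d. G x)) (at 0)"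
    using separated_derivative[OF F(1) d] by blast
  have "p' x = G x" if "x \<in> sphere_vec d" for x
  proof -
    have "(\<lambda>\<gamma>. p (plane_rot d i l \<gamma> x)) = (\<lambda>\<gamma>. F \<gamma> x)" using F(2) that by (auto simp: sphere_vec_def)
    then show ?thesis using deriv[OF that] G(2)[of x] vector_derivative_unique_at by metis
  qed
  then have eq: "(LINT x|sphere_measure d. p' x) = (LINT x|sphere_measure d. G x)"
    by (intro Bochner_Integration.integral_cong) auto
  \<comment> \<open>Angles below 1 are less than a quarter turn, so the excluded half-turn does not
    occur; near 0 is enough for a derivative at 0.\<close>
  have "(LINT x|sphere_measure d. F \<gamma> x) = (LINT x|sphere_measure d. p x)" if "\<gamma> \<in> ball 0 1" for \<gamma>
  proof -
    have "(LINT x|sphere_measure d. F \<gamma> x) = (LINT x|sphere_measure d. p (plane_rot d i l \<gamma> x))"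
      using F(2) by (intro Bochner_Integration.integral_cong) (auto simp: sphere_vec_def)
    also have "\<dots> = (LINT x|sphere_measure d. p x)"
      using that p i by (intro sphere_integral_rot cos_ne_minus_one pfun_measurable) auto
    finally show ?thesis .
  qed
  then have "((\<lambda>\<gamma>. LINT x|sphere_measure d. F \<gamma> x) has_vector_derivative 0) (at 0)"
    by (intro has_vector_derivative_transform_within_open[OF has_vector_derivative_const[of "LINT x|sphere_measure d. p x"], of "ball 0 1"]) auto
  then show ?thesis using G(3) eq vector_derivative_unique_at by metis
qed

text \<open>\<open>G i\<close> is the partial derivative of \<open>f\<close> in coordinate
  \<open>i\<close>. The sum is Euler's identity, and the last part is the chain rule for a rotation
  that moves a single variable of \<open>f\<close>. The induction on \<open>hpoly\<close> produces
  \<open>G\<close> by the product rule, without a coefficient representation of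
  \<open>f\<close>.\<close>

lemma hpoly_gradient:
  assumes "hpoly I D f" and I: "I \<subseteq> {..<d}"
  shows "\<exists>G. (\<forall>i\<in>I. pfun d (G i)) \<and> (\<forall>x. (\<Sum>i\<in>I. of_real (x $ i) * G i x) = of_nat D * f x) \<and>
    (\<forall>i\<in>I. \<forall>l<d. l \<notin> I \<longrightarrow> (\<forall>x\<in>carrier_vec d.
      ((\<lambda>\<gamma>. f (plane_rot d i l \<gamma> x)) has_vector_derivative (- of_real (x $ l) * G i x)) (at 0)))"
  using assms(1)
proof (induction rule: hpoly.induct)
  case (zero D)
  then show ?case by (intro exI[of _ "\<lambda>_ _. 0"]) (auto intro: pfun.const)
next
  case (const c)
  then show ?case by (intro exI[of _ "\<lambda>_ _. 0"]) (auto intro: pfun.const)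
next
  case (coord i0 D f)
  then obtain G where G: "\<And>i. i \<in> I \<Longrightarrow> pfun d (G i)"
    "\<And>x. (\<Sum>i\<in>I. of_real (x $ i) * G i x) = of_nat D * f x"
    "\<And>i l x. i \<in> I \<Longrightarrow> l < d \<Longrightarrow> l \<notin> I \<Longrightarrow> x \<in> carrier_vec d \<Longrightarrow>
      ((\<lambda>\<gamma>. f (plane_rot d i l \<gamma> x)) has_vector_derivative (- of_real (x $ l) * G i x)) (at 0)" by blast
  have fin: "finite I" using I finite_subset by blast
  define H where "H i x = (if i = i0 then f x else 0) + of_real (x $ i0) * G i x" for i x
  have "pfun d (H i)" if "i \<in> I" for i
  proof -
    have "pfun d (\<lambda>x. if i = i0 then f x else 0)"
      using hpoly_imp_pfun[OF coord(2) I] by (cases "i = i0") (auto intro: pfun.const)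
    then show ?thesis
      unfolding H_def using G(1)[OF that] coord(1) I by (intro pfun.add pfun.mult pfun.coord) auto
  qed
  moreover have "(\<Sum>i\<in>I. of_real (x $ i) * H i x) = of_nat (Suc D) * (of_real (x $ i0) * f x)" for x
  proof -
    have "(\<Sum>i\<in>I. of_real (x $ i) * H i x) = (\<Sum>i\<in>I. of_real (x $ i) * (if i = i0 then f x else 0))
        + of_real (x $ i0) * (\<Sum>i\<in>I. of_real (x $ i) * G i x)"
      unfolding H_def by (simp add: ring_distribs sum.distrib sum_distrib_left mult.left_commute)
    also have "(\<Sum>i\<in>I. of_real (x $ i) * (if i = i0 then f x else 0)) = of_real (x $ i0) * f x"
      using fin coord(1) by (simp add: if_distrib[of "\<lambda>u. _ * u"] cong: if_cong)
    finally show ?thesis unfolding G(2) by (simp add: algebra_simps)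
  qed
  moreover have "((\<lambda>\<gamma>. of_real (plane_rot d i l \<gamma> x $ i0) * f (plane_rot d i l \<gamma> x)) has_vector_derivative
      (- of_real (x $ l) * H i x)) (at 0)" if il: "i \<in> I" "l < d" "l \<notin> I" "x \<in> carrier_vec d" for i l x
  proof -
    have i: "i < d" "i0 < d" "i0 \<noteq> l" using il coord(1) I by auto
    have "((\<lambda>\<gamma>. plane_rot d i l \<gamma> x $ i0) has_real_derivative (if i = i0 then - x $ l else 0)) (at 0)"
      using i by (auto simp: plane_rot_coord intro!: derivative_eq_intros)
    then have "((\<lambda>\<gamma>. complex_of_real (plane_rot d i l \<gamma> x $ i0)) has_vector_derivative
        of_real (if i = i0 then - x $ l else 0)) (at 0)"
      by (intro has_vector_derivative_of_real) (simp add: has_real_derivative_iff_has_vector_derivative)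
    from has_vector_derivative_mult[OF this G(3)[OF il]]
    show ?thesis
      by (rule has_vector_derivative_eq_rhs) (use i il in \<open>auto simp: H_def algebra_simps\<close>)
  qed
  ultimately show ?case by (intro exI[of _ H] conjI ballI allI impI) simp_all
next
  case (add D f g)
  let ?grad = "\<lambda>f G. (\<forall>i\<in>I. pfun d (G i)) \<and> (\<forall>x. (\<Sum>i\<in>I. of_real (x $ i) * G i x) = of_nat D * f x) \<and>
    (\<forall>i\<in>I. \<forall>l<d. l \<notin> I \<longrightarrow> (\<forall>x\<in>carrier_vec d.
      ((\<lambda>\<gamma>. f (plane_rot d i l \<gamma> x)) has_vector_derivative (- of_real (x $ l) * G i x)) (at 0)))"
  obtain G G' where "?grad f G" "?grad g G'" using add by blast
  then have G: "\<And>i. i \<in> I \<Longrightarrow> pfun d (G i)" "\<And>i. i \<in> I \<Longrightarrow> pfun d (G' i)"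
    "\<And>x. (\<Sum>i\<in>I. of_real (x $ i) * G i x) = of_nat D * f x"
    "\<And>x. (\<Sum>i\<in>I. of_real (x $ i) * G' i x) = of_nat D * g x"
    "\<And>i l x. i \<in> I \<Longrightarrow> l < d \<Longrightarrow> l \<notin> I \<Longrightarrow> x \<in> carrier_vec d \<Longrightarrow>
      ((\<lambda>\<gamma>. f (plane_rot d i l \<gamma> x)) has_vector_derivative (- of_real (x $ l) * G i x)) (at 0)"
    "\<And>i l x. i \<in> I \<Longrightarrow> l < d \<Longrightarrow> l \<notin> I \<Longrightarrow> x \<in> carrier_vec d \<Longrightarrow>
      ((\<lambda>\<gamma>. g (plane_rot d i l \<gamma> x)) has_vector_derivative (- of_real (x $ l) * G' i x)) (at 0)"
    by simp_all
  have "((\<lambda>\<gamma>. f (plane_rot d i l \<gamma> x) + g (plane_rot d i l \<gamma> x)) has_vector_derivative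
      (- of_real (x $ l) * (G i x + G' i x))) (at 0)" if il: "i \<in> I" "l < d" "l \<notin> I" "x \<in> carrier_vec d" for i l x
    using has_vector_derivative_add[OF G(5)[OF il] G(6)[OF il]]
    by (rule has_vector_derivative_eq_rhs) (simp add: algebra_simps)
  moreover have "(\<Sum>i\<in>I. of_real (x $ i) * (G i x + G' i x)) = of_nat D * (f x + g x)" for x
    using G(3,4)[of x] by (simp add: ring_distribs sum.distrib)
  ultimately show ?case using G(1,2)
    by (intro exI[of _ "\<lambda>i x. G i x + G' i x"] conjI ballI allI impI pfun.add) simp_all
qed

section \<open>Squared norms of the leading coordinates and invariance under their rotations\<close>

definition sq_upto :: "nat \<Rightarrow> real vec \<Rightarrow> real" where
  "sq_upto M x = (\<Sum>m\<le>M. (x $ m)\<^sup>2)"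

lemma sq_upto_plane_rot:
  "i < l \<Longrightarrow> l \<le> M \<Longrightarrow> M < d \<Longrightarrow> sq_upto M (plane_rot d i l \<gamma> x) = sq_upto M x"
  unfolding sq_upto_def by (rule sum_squares_plane_rot) auto

lemma hpoly_sq_upto: "{..M} \<subseteq> I \<Longrightarrow> hpoly I 2 (\<lambda>x. of_real (sq_upto M x))"
proof -
  assume "{..M} \<subseteq> I"
  then have "hpoly I (2 * 1) (\<lambda>x. \<Sum>m\<le>M. of_real (x $ m) ^ 2)"
    by (intro hpoly_sum hpoly_power hpoly_coord) auto
  then show ?thesis by (simp add: sq_upto_def)
qed

lemma pfun_sq_upto [pfun_intros]: "M < d \<Longrightarrow> pfun d (\<lambda>x. of_real (sq_upto M x))"
  by (rule hpoly_imp_pfun[OF hpoly_sq_upto[OF subset_refl]]) auto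

lemma sq_upto_sphere: "d > 0 \<Longrightarrow> x \<in> sphere_vec d \<Longrightarrow> sq_upto (d - 1) x = 1"
proof -
  assume "d > 0" "x \<in> sphere_vec d"
  moreover have "{..d - 1} = {..<d}" using \<open>d > 0\<close> by auto
  ultimately show ?thesis by (simp add: sphere_vec_iff sq_upto_def)
qed

text \<open>The factors allowed to accompany an integrand: infinitesimal rotations of the
  coordinates up to \<open>M\<close> treat them as constants. In the inductions below they absorb
  squared norms and Gegenbauer factors of higher levels.\<close>

definition rot_inv :: "nat \<Rightarrow> nat \<Rightarrow> (real vec \<Rightarrow> complex) \<Rightarrow> bool" where
  "rot_inv d M q \<longleftrightarrow> pfun d q \<and>
     (\<forall>i l \<gamma>. \<forall>x\<in>carrier_vec d. i < l \<and> l \<le> M \<longrightarrow> q (plane_rot d i l \<gamma> x) = q x)"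

lemma rot_inv_mult: "rot_inv d M p \<Longrightarrow> rot_inv d M q \<Longrightarrow> rot_inv d M (\<lambda>x. p x * q x)"
  by (auto simp: rot_inv_def intro: pfun.mult)

lemma rot_inv_mono: "rot_inv d M q \<Longrightarrow> M' \<le> M \<Longrightarrow> rot_inv d M' q"
  by (auto simp: rot_inv_def)

lemma rot_inv_const: "rot_inv d M (\<lambda>x. c)"
  by (auto simp: rot_inv_def intro: pfun.const)

lemma rot_inv_sq_upto: "M \<le> M' \<Longrightarrow> M' < d \<Longrightarrow> rot_inv d M (\<lambda>x. of_real (sq_upto M' x))"
  by (auto simp: rot_inv_def sq_upto_plane_rot intro: pfun_sq_upto)

text \<open>The integral of the infinitesimal rotations \<open>x\<^sub>i \<partial>\<^sub>z - z \<partial>\<^sub>i\<close> applied to \<open>x\<^sub>i A F q\<close>, summed over \<open>i\<close>,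
  where \<open>z\<close> is the last of the coordinates and Euler's identity is used for \<open>F\<close>.\<close>
lemma sphere_integral_lie:
  assumes M: "Suc M < d" and F: "hpoly {..M} D F" and A: "pfun d A" "pfun d A'" and q: "rot_inv d (Suc M) q"
    and deriv: "\<And>i x. i \<le> M \<Longrightarrow> x \<in> carrier_vec d \<Longrightarrow>
      ((\<lambda>\<gamma>. A (plane_rot d i (Suc M) \<gamma> x)) has_vector_derivative A' x * of_real (x $ i)) (at 0)"
  shows "(LINT x|sphere_measure d. of_real (sq_upto (Suc M) x - (x $ Suc M)\<^sup>2) * A' x * F x * q x)
    = of_nat (Suc M + D) * (LINT x|sphere_measure d. of_real (x $ Suc M) * A x * F x * q x)"
proof -
  have sub: "{..M} \<subseteq> {..<d}" using M by auto
  have d: "d > 0" using M by simp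
  obtain G where "\<forall>i\<in>{..M}. pfun d (G i)"
    and G2: "\<forall>x. (\<Sum>i\<le>M. of_real (x $ i) * G i x) = of_nat D * F x"
    and "\<forall>i\<in>{..M}. \<forall>l<d. l \<notin> {..M} \<longrightarrow> (\<forall>x\<in>carrier_vec d.
      ((\<lambda>\<gamma>. F (plane_rot d i l \<gamma> x)) has_vector_derivative (- of_real (x $ l) * G i x)) (at 0))"
    using hpoly_gradient[OF F sub] by blast
  then have G: "\<And>i. i \<le> M \<Longrightarrow> pfun d (G i)"
    "\<And>x. (\<Sum>i\<le>M. of_real (x $ i) * G i x) = of_nat D * F x"
    "\<And>i l x. i \<le> M \<Longrightarrow> l < d \<Longrightarrow> l > M \<Longrightarrow> x \<in> carrier_vec d \<Longrightarrow>
      ((\<lambda>\<gamma>. F (plane_rot d i l \<gamma> x)) has_vector_derivative (- of_real (x $ l) * G i x)) (at 0)"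
    by auto
  define z where "z = (\<lambda>x :: real vec. complex_of_real (x $ Suc M))"
  \<comment> \<open>The product rule for x_i A F q. The three terms come from x_i, whose derivative
    is -z, from A, and from F with its gradient G; q is constant along the rotation.\<close>
  define P where "P = (\<lambda>i x. - 1 * z x * A x * F x * q x + of_real (x $ i)^2 * A' x * F x * q x
    - of_real (x $ i) * G i x * (z x * A x * q x))"
  have pf: "pfun d F" "pfun d q" "pfun d z" using hpoly_imp_pfun[OF F sub] q M by (auto simp: rot_inv_def z_def intro: pfun.coord)
  have P0: "(LINT x|sphere_measure d. P i x) = 0" if i: "i \<le> M" for i
  proof (rule sphere_integral_rot_deriv[of i "Suc M" d "\<lambda>x. of_real (x $ i) * (A x * (F x * q x))"])
    show "pfun d (\<lambda>x. of_real (x $ i) * (A x * (F x * q x)))"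
      using pf A i M by (intro pfun.mult pfun.coord) auto
    fix x assume "x \<in> sphere_vec d"
    then have x: "x \<in> carrier_vec d" by (rule sphere_vec_carrier)
    have 1: "((\<lambda>\<gamma>. complex_of_real (plane_rot d i (Suc M) \<gamma> x $ i)) has_vector_derivative - z x) (at 0)"
    proof -
      have "((\<lambda>\<gamma>. plane_rot d i (Suc M) \<gamma> x $ i) has_real_derivative - x $ Suc M) (at 0)"
        using i M by (auto simp: plane_rot_coord intro!: derivative_eq_intros)
      then show ?thesis
        using has_vector_derivative_of_real[of "\<lambda>\<gamma>. plane_rot d i (Suc M) \<gamma> x $ i" "- x $ Suc M" "at 0"]
        by (simp add: has_real_derivative_iff_has_vector_derivative z_def)
    qed
    have 3: "((\<lambda>\<gamma>. F (plane_rot d i (Suc M) \<gamma> x) * q (plane_rot d i (Suc M) \<gamma> x)) has_vector_derivative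
        (- z x * G i x) * q x) (at 0)"
    proof -
      have "q (plane_rot d i (Suc M) \<gamma> x) = q x" for \<gamma> using q i x by (auto simp: rot_inv_def)
      then show ?thesis using has_vector_derivative_mult_left[OF G(3)[OF i M _ x], of "q x"] by (simp add: z_def)
    qed
    have "plane_rot d i (Suc M) 0 x = x" using i M x by simp
    from has_vector_derivative_mult[OF 1 has_vector_derivative_mult[OF deriv[OF i x] 3], unfolded this]
    show "((\<lambda>\<gamma>. of_real (plane_rot d i (Suc M) \<gamma> x $ i) * (A (plane_rot d i (Suc M) \<gamma> x) *
      (F (plane_rot d i (Suc M) \<gamma> x) * q (plane_rot d i (Suc M) \<gamma> x)))) has_vector_derivative P i x) (at 0)"
      by (rule has_vector_derivative_eq_rhs) (simp add: P_def algebra_simps power2_eq_square)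
  qed (use i M in auto)
  have "pfun d (P i)" if "i \<le> M" for i
    unfolding P_def using pf A G(1)[OF that] that M
    by (intro pfun_diff pfun.add pfun.mult pfun_power pfun.coord pfun.const) auto
  then have "(LINT x|sphere_measure d. (\<Sum>i\<le>M. P i x)) = (\<Sum>i\<le>M. LINT x|sphere_measure d. P i x)"
    using d by (intro Bochner_Integration.integral_sum pfun_integrable) auto
  also have "\<dots> = 0" using P0 by (intro sum.neutral) auto
  finally have 0: "(LINT x|sphere_measure d. (\<Sum>i\<le>M. P i x)) = 0" .
  \<comment> \<open>Summed over i, the first terms give M + 1 equal copies, the second ones the
    squared norm without z^2, and the third ones D times F by Euler's identity. This is where the
    factor M + 1 + D arises.\<close>
  have eq: "(\<Sum>i\<le>M. P i x) = of_real (sq_upto (Suc M) x - (x $ Suc M)\<^sup>2) * A' x * F x * q x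
      - of_nat (Suc M + D) * (z x * A x * F x * q x)" for x
  proof -
    have "(\<Sum>i\<le>M. P i x) = - of_nat (Suc M) * (z x * A x * F x * q x)
        + (\<Sum>i\<le>M. of_real (x $ i)^2) * (A' x * F x * q x) - (\<Sum>i\<le>M. of_real (x $ i) * G i x) * (z x * A x * q x)"
    proof -
      have "P i x = - (z x * A x * F x * q x) + of_real (x $ i)^2 * (A' x * F x * q x)
          - of_real (x $ i) * G i x * (z x * A x * q x)" for i
        by (simp add: P_def algebra_simps)
      then show ?thesis
        by (simp add: sum.distrib sum_subtractf flip: sum_distrib_right) (simp add: algebra_simps)
    qed
    moreover have "(\<Sum>i\<le>M. complex_of_real (x $ i)^2) = of_real (sq_upto (Suc M) x - (x $ Suc M)\<^sup>2)"
      by (simp add: sq_upto_def)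
    ultimately show ?thesis unfolding G(2) by (simp add: algebra_simps)
  qed
  note 1 = 0[unfolded eq]
  have p1: "pfun d (\<lambda>x. of_real (sq_upto (Suc M) x - (x $ Suc M)\<^sup>2) * A' x * F x * q x)"
    and p2: "pfun d (\<lambda>x. of_nat (Suc M + D) * (z x * A x * F x * q x))"
  proof -
    have "pfun d (\<lambda>x. of_real (sq_upto (Suc M) x) - of_real (x $ Suc M) ^ 2)"
      using M by (intro pfun_diff pfun_power pfun.coord pfun_sq_upto)
    then show "pfun d (\<lambda>x. of_real (sq_upto (Suc M) x - (x $ Suc M)\<^sup>2) * A' x * F x * q x)"
      using pf A by (intro pfun.mult) simp_all
    show "pfun d (\<lambda>x. of_nat (Suc M + D) * (z x * A x * F x * q x))"
      using pf A by (intro pfun.mult pfun.const)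
  qed
  have "(LINT x|sphere_measure d. of_real (sq_upto (Suc M) x - (x $ Suc M)\<^sup>2) * A' x * F x * q x)
      = (LINT x|sphere_measure d. of_nat (Suc M + D) * (z x * A x * F x * q x))"
    using 1 unfolding Bochner_Integration.integral_diff[OF pfun_integrable[OF d p1] pfun_integrable[OF d p2]] by simp
  then show ?thesis unfolding integral_mult_right_zero by (simp only: z_def)
qed

section \<open>Homogenized Gegenbauer polynomials\<close>

text \<open>\<open>hgeg a n z \<rho>\<close> is \<open>r\<^sup>n C\<^sub>n\<^sup>a(z / r)\<close> with \<open>\<rho> = r\<^sup>2\<close>, a polynomial in \<open>z\<close> and \<open>\<rho>\<close>.\<close>
fun hgeg :: "real \<Rightarrow> nat \<Rightarrow> real \<Rightarrow> real \<Rightarrow> real" where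
  "hgeg a 0 z \<rho> = 1"
| "hgeg a (Suc 0) z \<rho> = 2 * a * z"
| "hgeg a (Suc (Suc n)) z \<rho> =
     (2 * (real n + 1 + a) * z * hgeg a (Suc n) z \<rho> - (real n + 2 * a) * \<rho> * hgeg a n z \<rho>) / (real n + 2)"

fun hgeg_deriv :: "real \<Rightarrow> nat \<Rightarrow> real \<Rightarrow> real \<Rightarrow> real" where
  "hgeg_deriv a 0 z \<rho> = 0"
| "hgeg_deriv a (Suc 0) z \<rho> = 2 * a"
| "hgeg_deriv a (Suc (Suc n)) z \<rho> =
     (2 * (real n + 1 + a) * (hgeg a (Suc n) z \<rho> + z * hgeg_deriv a (Suc n) z \<rho>)
      - (real n + 2 * a) * \<rho> * hgeg_deriv a n z \<rho>) / (real n + 2)"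

lemma hgeg_recurrence:
  "2 * (real n + 1 + a) * z * hgeg a (Suc n) z \<rho>
    = (real n + 2) * hgeg a (Suc (Suc n)) z \<rho> + (real n + 2 * a) * \<rho> * hgeg a n z \<rho>"
proof -
  have "(real n + 2) * hgeg a (Suc (Suc n)) z \<rho>
      = 2 * (real n + 1 + a) * z * hgeg a (Suc n) z \<rho> - (real n + 2 * a) * \<rho> * hgeg a n z \<rho>"
    by (simp add: field_simps)
  then show ?thesis by simp
qed

lemma hgeg_deriv_recurrence:
  "(real n + 2) * hgeg_deriv a (Suc (Suc n)) z \<rho>
    = 2 * (real n + 1 + a) * (hgeg a (Suc n) z \<rho> + z * hgeg_deriv a (Suc n) z \<rho>)
      - (real n + 2 * a) * \<rho> * hgeg_deriv a n z \<rho>"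
  by (simp add: field_simps)

lemma hgeg_has_deriv: "((\<lambda>z. hgeg a n z \<rho>) has_real_derivative hgeg_deriv a n z \<rho>) (at z)"
proof (induction a n z \<rho> rule: hgeg.induct)
  case (3 a n z \<rho>)
  have "((\<lambda>z. 2 * (real n + 1 + a) * z * hgeg a (Suc n) z \<rho>) has_real_derivative
      2 * (real n + 1 + a) * (hgeg a (Suc n) z \<rho> + z * hgeg_deriv a (Suc n) z \<rho>)) (at z)"
    by (auto intro!: derivative_eq_intros 3 simp: algebra_simps)
  moreover have "((\<lambda>z. (real n + 2 * a) * \<rho> * hgeg a n z \<rho>) has_real_derivative
      (real n + 2 * a) * \<rho> * hgeg_deriv a n z \<rho>) (at z)"
    by (intro DERIV_cmult 3)
  ultimately show ?case unfolding hgeg.simps hgeg_deriv.simps by (intro DERIV_cdivide DERIV_diff)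
qed (auto intro!: derivative_eq_intros)

declare hgeg.simps(3) [simp del] hgeg_deriv.simps(3) [simp del]

text \<open>Homogenized form of (1 - t^2) C_n' = -n t C_n + (n + 2a - 1) C_(n-1). The differentiated
  recurrence is multiplied by \<rho> - z^2, the two lower cases are inserted, and the recurrence
  itself removes the lowest polynomial. It serves to eliminate the derivative that
  \<open>sphere_integral_lie\<close> leaves under the integral.\<close>

lemma hgeg_deriv_identity:
  "(\<rho> - z\<^sup>2) * hgeg_deriv a (Suc n) z \<rho>
    = - (real n + 1) * z * hgeg a (Suc n) z \<rho> + (real n + 2 * a) * \<rho> * hgeg a n z \<rho>"
proof (induction n rule: less_induct)
  case (less n)
  define U where "U = hgeg a n z \<rho>"
  consider "n = 0" | "n = 1" | m where "n = Suc (Suc m)"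
    by (metis One_nat_def not0_implies_Suc)
  then show ?case
  proof cases
    case 3
    define C0 C1 C2 D1 D2 where "C0 = hgeg a m z \<rho>" and "C1 = hgeg a (Suc m) z \<rho>"
      and "C2 = hgeg a (Suc (Suc m)) z \<rho>" and "D1 = hgeg_deriv a (Suc m) z \<rho>" and "D2 = hgeg_deriv a (Suc (Suc m)) z \<rho>"
    define C3 D3 where "C3 = hgeg a (Suc (Suc (Suc m))) z \<rho>" and "D3 = hgeg_deriv a (Suc (Suc (Suc m))) z \<rho>"
    define k where "k = real m"
    have k: "k \<ge> 0" by (simp add: k_def)
    have e1: "(\<rho> - z\<^sup>2) * D1 = - (k + 1) * z * C1 + (k + 2 * a) * \<rho> * C0"
      using less[of m] 3 by (simp add: C0_def C1_def D1_def k_def)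
    have e2: "(\<rho> - z\<^sup>2) * D2 = - (k + 2) * z * C2 + (k + 1 + 2 * a) * \<rho> * C1"
      using less[of "Suc m"] 3 by (simp add: C1_def C2_def D2_def k_def algebra_simps)
    have r2: "(k + 2 * a) * \<rho> * C0 = 2 * (k + 1 + a) * z * C1 - (k + 2) * C2"
      using hgeg_recurrence[of m a z \<rho>] by (simp add: C0_def C1_def C2_def k_def)
    have r3: "(k + 3) * C3 = 2 * (k + 2 + a) * z * C2 - (k + 1 + 2 * a) * \<rho> * C1"
      using hgeg_recurrence[of "Suc m" a z \<rho>] by (simp add: C3_def C1_def C2_def k_def algebra_simps)
    have d3: "(k + 3) * D3 = 2 * (k + 2 + a) * (C2 + z * D2) - (k + 1 + 2 * a) * \<rho> * D1"
      using hgeg_deriv_recurrence[of "Suc m" a z \<rho>]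
      by (simp add: D3_def D2_def D1_def C2_def k_def algebra_simps)
    have "(k + 3) * ((\<rho> - z\<^sup>2) * D3) = (\<rho> - z\<^sup>2) * ((k + 3) * D3)" by simp
    also have "\<dots> = 2 * (k + 2 + a) * ((\<rho> - z\<^sup>2) * C2 + z * ((\<rho> - z\<^sup>2) * D2))
        - (k + 1 + 2 * a) * \<rho> * ((\<rho> - z\<^sup>2) * D1)"
      unfolding d3 by (simp add: algebra_simps)
    also have "\<dots> = - (k + 3) * z * (2 * (k + 2 + a) * z * C2 - (k + 1 + 2 * a) * \<rho> * C1)
        + (k + 3) * (k + 2 + 2 * a) * \<rho> * C2"
      unfolding e1 e2 r2 by (simp add: power2_eq_square algebra_simps)
    also have "\<dots> = (k + 3) * (- (k + 3) * z * C3 + (k + 2 + 2 * a) * \<rho> * C2)"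
      unfolding r3[symmetric] by (simp add: algebra_simps)
    finally have "(\<rho> - z\<^sup>2) * D3 = - (k + 3) * z * C3 + (k + 2 + 2 * a) * \<rho> * C2"
      using k by (subst (asm) mult_cancel_left) auto
    then show ?thesis unfolding 3 by (simp add: C2_def C3_def D3_def k_def algebra_simps)
  next
    case 2
    have h: "hgeg a (Suc (Suc 0)) z \<rho> = 2 * a * (1 + a) * z * z - a * \<rho>"
      "hgeg_deriv a (Suc (Suc 0)) z \<rho> = 4 * a * (1 + a) * z"
      by (simp_all add: hgeg.simps(3) hgeg_deriv.simps(3) field_simps)
    show ?thesis unfolding 2 One_nat_def h by (simp add: power2_eq_square algebra_simps)
  qed (simp_all add: power2_eq_square algebra_simps)
qed

lemma hgeg_homogeneous: "hgeg a n (s * z) (s\<^sup>2 * \<rho>) = s ^ n * hgeg a n z \<rho>"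
proof (induction n rule: less_induct)
  case (less n)
  consider "n = 0" | "n = 1" | m where "n = Suc (Suc m)"
    by (metis One_nat_def not0_implies_Suc)
  then show ?case
  proof cases
    case 3
    show ?thesis using less[of m] less[of "Suc m"] unfolding 3
      by (simp add: hgeg.simps(3) power2_eq_square field_simps)
  qed simp_all
qed

lemma hpoly_hgeg:
  assumes "l \<in> I" "{..M} \<subseteq> I"
  shows "hpoly I n (\<lambda>x. of_real (hgeg a n (x $ l) (sq_upto M x)))"
proof (induction n rule: less_induct)
  case (less n)
  consider "n = 0" | "n = 1" | m where "n = Suc (Suc m)"
    by (metis One_nat_def not0_implies_Suc)
  then show ?case
  proof cases
    case 1
    then show ?thesis using hpoly.const[of I 1] by simp
  next
    case 2
    then show ?thesis using hpoly_scale[OF hpoly_coord[OF assms(1)], of "of_real (2 * a)"] by (simp add: mult.assoc)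
  next
    case 3
    have "hpoly I (Suc (Suc m)) (\<lambda>x. of_real (2 * (real m + 1 + a) / (real m + 2)) *
        (of_real (x $ l) * of_real (hgeg a (Suc m) (x $ l) (sq_upto M x)))
        - of_real ((real m + 2 * a) / (real m + 2)) * (of_real (sq_upto M x) * of_real (hgeg a m (x $ l) (sq_upto M x))))"
      (is "hpoly I _ ?f")
    proof (intro hpoly_diff hpoly_scale)
      show "hpoly I (Suc (Suc m)) (\<lambda>x. of_real (x $ l) * of_real (hgeg a (Suc m) (x $ l) (sq_upto M x)))"
        using less[of "Suc m"] 3 assms by (intro hpoly.coord) auto
      show "hpoly I (Suc (Suc m)) (\<lambda>x. of_real (sq_upto M x) * of_real (hgeg a m (x $ l) (sq_upto M x)))"
        using hpoly_mult[OF hpoly_sq_upto[OF assms(2)] less[of m]] 3 by simp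
    qed
    also have "?f = (\<lambda>x. of_real (hgeg a n (x $ l) (sq_upto M x)))"
      unfolding 3 hgeg.simps(3) hgeg_deriv.simps(3) by (rule ext) (simp flip: of_real_mult of_real_diff of_real_divide add: diff_divide_distrib mult.assoc)
    finally show ?thesis unfolding 3 .
  qed
qed

lemma pfun_hgeg [pfun_intros]:
  "l < d \<Longrightarrow> M < d \<Longrightarrow> pfun d (\<lambda>x. of_real (hgeg a n (x $ l) (sq_upto M x)))"
  by (rule hpoly_imp_pfun[OF hpoly_hgeg[of l "{..<d}"]]) auto

lemma pfun_hgeg_deriv:
  assumes "l < d" "M < d"
  shows "pfun d (\<lambda>x. of_real (hgeg_deriv a n (x $ l) (sq_upto M x)))"
proof (induction n rule: less_induct)
  case (less n)
  consider "n = 0" | "n = 1" | m where "n = Suc (Suc m)"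
    by (metis One_nat_def not0_implies_Suc)
  then show ?case
  proof cases
    case 3
    have "pfun d (\<lambda>x. of_real (2 * (real m + 1 + a) / (real m + 2)) *
        (of_real (hgeg a (Suc m) (x $ l) (sq_upto M x)) + of_real (x $ l) * of_real (hgeg_deriv a (Suc m) (x $ l) (sq_upto M x)))
        - of_real ((real m + 2 * a) / (real m + 2)) * (of_real (sq_upto M x) * of_real (hgeg_deriv a m (x $ l) (sq_upto M x))))"
      (is "pfun d ?f")
      using less[of m] less[of "Suc m"] 3 assms
      by (intro pfun_diff pfun.mult pfun.add pfun_hgeg pfun_sq_upto pfun.coord pfun.const) simp_all
    also have "?f = (\<lambda>x. of_real (hgeg_deriv a n (x $ l) (sq_upto M x)))"
      unfolding 3 hgeg.simps(3) hgeg_deriv.simps(3) by (rule ext) (simp flip: of_real_mult of_real_add of_real_diff of_real_divide add: diff_divide_distrib mult.assoc)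
    finally show ?thesis .
  qed (auto intro: pfun.const)
qed

lemma rot_inv_hgeg:
  "M < l \<Longrightarrow> l < d \<Longrightarrow> M \<le> M' \<Longrightarrow> M' < d \<Longrightarrow> rot_inv d M (\<lambda>x. of_real (hgeg a n (x $ l) (sq_upto M' x)))"
  by (auto simp: rot_inv_def sq_upto_plane_rot plane_rot_coord intro: pfun_hgeg)

text \<open>The condition on \<open>a\<close> ties the Gegenbauer parameter to the weight:
  \<open>F\<close> will be the squared modulus of a harmonic of degree D/2 in M + 1 variables. With
  it the factor M + 1 + D of \<open>sphere_integral_lie\<close> becomes 2a + 1, as in the classical
  Gegenbauer weight.\<close>

context
  fixes d M D :: nat and F :: "real vec \<Rightarrow> complex" and a :: real
  assumes M: "Suc M < d" and F: "hpoly {..M} D F" and a: "a > 0" "2 * a = real (D + M)"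
begin

private abbreviation z :: "real vec \<Rightarrow> real" where "z x \<equiv> x $ Suc M"
private abbreviation "\<rho> x \<equiv> sq_upto (Suc M) x"
private abbreviation "C n x \<equiv> complex_of_real (hgeg a n (z x) (\<rho> x))"
private abbreviation "I f \<equiv> (LINT x|sphere_measure d. f x :: complex)"

private lemma cancel: "complex_of_real c * X = 0 \<Longrightarrow> c \<noteq> 0 \<Longrightarrow> X = 0"
  by simp

private lemma d: "d > 0" using M by simp

private lemma pfun_F: "pfun d F"
  by (rule hpoly_imp_pfun[OF F]) (use M in auto)

private lemma int_add: "pfun d f \<Longrightarrow> pfun d g \<Longrightarrow> I (\<lambda>x. f x + g x) = I f + I g"
  by (intro Bochner_Integration.integral_add pfun_integrable d)

private lemma int_three_term:
  assumes "pfun d h"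
  shows "of_real (2 * (real n + 1 + a)) * I (\<lambda>x. of_real (z x) * C (Suc n) x * h x)
    = of_real (real n + 2) * I (\<lambda>x. C (Suc (Suc n)) x * h x) + of_real (real n + 2 * a) * I (\<lambda>x. of_real (\<rho> x) * C n x * h x)"
proof -
  have "of_real (2 * (real n + 1 + a)) * I (\<lambda>x. of_real (z x) * C (Suc n) x * h x)
      = I (\<lambda>x. of_real (2 * (real n + 1 + a)) * (of_real (z x) * C (Suc n) x * h x))" by simp
  also have "\<dots> = I (\<lambda>x. of_real (real n + 2) * (C (Suc (Suc n)) x * h x)
      + of_real (real n + 2 * a) * (of_real (\<rho> x) * C n x * h x))"
  proof (rule Bochner_Integration.integral_cong[OF refl])
    fix x
    show "of_real (2 * (real n + 1 + a)) * (of_real (z x) * C (Suc n) x * h x)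
      = of_real (real n + 2) * (C (Suc (Suc n)) x * h x) + of_real (real n + 2 * a) * (of_real (\<rho> x) * C n x * h x)"
      using arg_cong[OF hgeg_recurrence[of n a "z x" "\<rho> x"], of complex_of_real]
      unfolding of_real_mult of_real_add by (metis (no_types, lifting) mult.assoc ring_class.ring_distribs(2))
  qed
  also have "\<dots> = I (\<lambda>x. of_real (real n + 2) * (C (Suc (Suc n)) x * h x))
      + I (\<lambda>x. of_real (real n + 2 * a) * (of_real (\<rho> x) * C n x * h x))"
    using M assms by (intro int_add pfun.mult pfun.const pfun_hgeg pfun_sq_upto) auto
  finally show ?thesis by simp
qed

private lemma lie:
  assumes q: "rot_inv d (Suc M) q"
  shows "I (\<lambda>x. of_real ((\<rho> x - (z x)\<^sup>2) * hgeg_deriv a n (z x) (\<rho> x)) * (F x * q x))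
    = of_real (2 * a + 1) * I (\<lambda>x. of_real (z x) * C n x * (F x * q x))"
proof -
  have "I (\<lambda>x. of_real (\<rho> x - (z x)\<^sup>2) * of_real (hgeg_deriv a n (z x) (\<rho> x)) * F x * q x)
      = of_nat (Suc M + D) * I (\<lambda>x. of_real (z x) * C n x * F x * q x)"
  proof (rule sphere_integral_lie[OF M F _ _ q])
    show "pfun d (C n)" "pfun d (\<lambda>x. of_real (hgeg_deriv a n (z x) (\<rho> x)))"
      using M by (auto intro: pfun_hgeg pfun_hgeg_deriv)
    fix i and x :: "real vec" assume i: "i \<le> M" and x: "x \<in> carrier_vec d"
    have r: "\<rho> (plane_rot d i (Suc M) \<gamma> x) = \<rho> x" for \<gamma> using i M by (intro sq_upto_plane_rot) auto
    have "((\<lambda>\<gamma>. z (plane_rot d i (Suc M) \<gamma> x)) has_real_derivative x $ i) (at 0)"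
      using i M by (auto simp: plane_rot_coord intro!: derivative_eq_intros)
    then have "((\<lambda>\<gamma>. hgeg a n (z (plane_rot d i (Suc M) \<gamma> x)) (\<rho> x)) has_real_derivative
        hgeg_deriv a n (z (plane_rot d i (Suc M) 0 x)) (\<rho> x) * x $ i) (at 0)"
      by (rule DERIV_chain2[OF hgeg_has_deriv])
    then have "((\<lambda>\<gamma>. hgeg a n (z (plane_rot d i (Suc M) \<gamma> x)) (\<rho> (plane_rot d i (Suc M) \<gamma> x))) has_real_derivative
        hgeg_deriv a n (z x) (\<rho> x) * x $ i) (at 0)"
      using r i M x by simp
    then show "((\<lambda>\<gamma>. C n (plane_rot d i (Suc M) \<gamma> x)) has_vector_derivative
        of_real (hgeg_deriv a n (z x) (\<rho> x)) * of_real (x $ i)) (at 0)"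
      unfolding of_real_mult[symmetric]
      by (rule has_vector_derivative_of_real)
  qed
  moreover have "complex_of_nat (Suc M + D) = of_real (2 * a + 1)" using a by simp
  ultimately show ?thesis by (simp add: mult.assoc)
qed

text \<open>Elimination of the derivative from \<open>lie\<close> by
  \<open>hgeg_deriv_identity\<close>. What remains is a relation between two of the three integrals
  in the recurrence, so that both relations together determine the third from either one.\<close>

private lemma lie_Suc:
  assumes q: "rot_inv d (Suc M) q"
  shows "of_real (real n + 2 * a) * I (\<lambda>x. of_real (\<rho> x) * C n x * (F x * q x))
    = of_real (real n + 2 * a + 2) * I (\<lambda>x. of_real (z x) * C (Suc n) x * (F x * q x))"
proof -
  have q': "pfun d q" using q by (simp add: rot_inv_def)
  have "of_real (2 * a + 1) * I (\<lambda>x. of_real (z x) * C (Suc n) x * (F x * q x))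
      = I (\<lambda>x. of_real ((\<rho> x - (z x)\<^sup>2) * hgeg_deriv a (Suc n) (z x) (\<rho> x)) * (F x * q x))"
    by (rule lie[OF q, symmetric])
  also have "\<dots> = I (\<lambda>x. of_real (- (real n + 1)) * (of_real (z x) * C (Suc n) x * (F x * q x))
      + of_real (real n + 2 * a) * (of_real (\<rho> x) * C n x * (F x * q x)))"
    unfolding hgeg_deriv_identity by (intro Bochner_Integration.integral_cong refl) (simp add: algebra_simps)
  also have "\<dots> = I (\<lambda>x. of_real (- (real n + 1)) * (of_real (z x) * C (Suc n) x * (F x * q x)))
      + I (\<lambda>x. of_real (real n + 2 * a) * (of_real (\<rho> x) * C n x * (F x * q x)))"
    using M pfun_F q' by (intro int_add pfun.mult pfun.const pfun_hgeg pfun_sq_upto pfun.coord) auto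
  finally show ?thesis unfolding integral_mult_right_zero by (simp add: algebra_simps)
qed

text \<open>Recurrence and \<open>lie_Suc\<close> express the integral of C_(m+2) F q as a multiple
  of m times that of \<rho> C_m F q. The latter falls under the induction hypothesis once \<rho> is
  moved into \<open>q\<close>, which is why \<open>q\<close> has to be arbitrary.\<close>

private lemma hgeg_integral_zero:
  assumes "rot_inv d (Suc M) q"
  shows "I (\<lambda>x. C (Suc n) x * (F x * q x)) = 0"
  using assms
proof (induction n arbitrary: q rule: less_induct)
  case (less n)
  note q = less.prems
  have q': "pfun d q" using q by (simp add: rot_inv_def)
  show ?case
  proof (cases n)
    case 0
    have "I (\<lambda>x. of_real (z x) * C 0 x * (F x * q x)) = 0"
      using lie[OF q, of 0] a by (simp flip: of_real_add)
    moreover have "I (\<lambda>x. C (Suc 0) x * (F x * q x)) = I (\<lambda>x. of_real (2 * a) * (of_real (z x) * C 0 x * (F x * q x)))"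
      by (intro Bochner_Integration.integral_cong refl) simp
    ultimately show ?thesis unfolding 0 by simp
  next
    case (Suc m)
    define X Y W where "X = I (\<lambda>x. of_real (z x) * C (Suc m) x * (F x * q x))"
      and "Y = I (\<lambda>x. of_real (\<rho> x) * C m x * (F x * q x))" and "W = I (\<lambda>x. C (Suc (Suc m)) x * (F x * q x))"
    have 1: "of_real (2 * (real m + 1 + a)) * X = of_real (real m + 2) * W + of_real (real m + 2 * a) * Y"
      unfolding X_def Y_def W_def using pfun_F q' by (intro int_three_term pfun.mult)
    have 2: "of_real (real m + 2 * a) * Y = of_real (real m + 2 * a + 2) * X"
      unfolding X_def Y_def by (rule lie_Suc[OF q])
    \<comment> \<open>For m = 0 the integral \<open>Y\<close> itself may be nonzero; the factor m
      disposes of this case.\<close>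
    have mY: "of_nat m * Y = 0"
    proof (cases m)
      case (Suc k)
      have "I (\<lambda>x. C (Suc k) x * (F x * (of_real (\<rho> x) * q x))) = 0"
        using Suc \<open>n = Suc m\<close> M by (intro less.IH rot_inv_mult rot_inv_sq_upto q) auto
      moreover have "Y = I (\<lambda>x. C (Suc k) x * (F x * (of_real (\<rho> x) * q x)))"
        unfolding Y_def Suc by (intro Bochner_Integration.integral_cong refl) simp
      ultimately show ?thesis by simp
    qed simp
    have "of_real (real m + 2 * a + 2) * (of_real (real m + 2) * W)
        = of_real (2 * (real m + 1 + a)) * (of_real (real m + 2 * a + 2) * X)
          - of_real (real m + 2 * a + 2) * (of_real (real m + 2 * a) * Y)"
    proof -
      have "of_real (real m + 2) * W = of_real (2 * (real m + 1 + a)) * X - of_real (real m + 2 * a) * Y"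
        using 1 by simp
      then show ?thesis by (simp only: right_diff_distrib mult.left_commute)
    qed
    also have "\<dots> = of_real (real m + 2 * a) * (of_nat m * Y)"
      unfolding 2[symmetric] by (simp add: algebra_simps)
    finally have "complex_of_real ((real m + 2 * a + 2) * (real m + 2)) * W = 0"
      using mY by (simp add: mult.assoc)
    moreover have "(real m + 2 * a + 2) * (real m + 2) \<noteq> 0" using a by simp
    ultimately have "W = 0" by (rule cancel)
    then show ?thesis unfolding Suc W_def .
  qed
qed

text \<open>Induction on the smaller degree n. The recurrence writes C_n through z C_(n-1) and
  \<rho> C_(n-2); the factor z is then moved onto C_n', which changes n' by one. Since n - 1 < n' -
  1, the degrees remain in strict order, and every \<rho> goes into \<open>q\<close>.\<close>

private lemma hgeg_orthogonal_less:
  assumes "rot_inv d (Suc M) q" "n < n'"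
  shows "I (\<lambda>x. C n x * C n' x * (F x * q x)) = 0"
  using assms
proof (induction n arbitrary: n' q rule: less_induct)
  case (less n)
  note q = less.prems(1)
  have q': "pfun d q" using q by (simp add: rot_inv_def)
  obtain k where k: "n' = Suc k" using less.prems(2) by (cases n') auto
  consider "n = 0" | m where "n = Suc m" by (cases n) auto
  then show ?case
  proof cases
    case 1
    then show ?thesis using hgeg_integral_zero[OF q, of k] k by simp
  next
    case (2 m)
    have z: "I (\<lambda>x. of_real (z x) * C n' x * (C m x * (F x * q x))) = 0"
    proof -
      have "I (\<lambda>x. C m x * C (Suc (Suc k)) x * (F x * q x)) = 0"
        using less.prems 2 k by (intro less.IH) auto
      then have A: "I (\<lambda>x. C (Suc (Suc k)) x * (C m x * (F x * q x))) = 0" by (simp add: mult_ac)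
      have "I (\<lambda>x. C m x * C k x * (F x * (of_real (\<rho> x) * q x))) = 0"
        using less.prems 2 k M by (intro less.IH rot_inv_mult rot_inv_sq_upto) auto
      then have B: "I (\<lambda>x. of_real (\<rho> x) * C k x * (C m x * (F x * q x))) = 0" by (simp add: mult_ac)
      have "of_real (2 * (real k + 1 + a)) * I (\<lambda>x. of_real (z x) * C (Suc k) x * (C m x * (F x * q x))) = 0"
        using M pfun_F q' by (subst int_three_term) (auto simp: A B intro!: pfun.mult pfun_hgeg)
      moreover have "2 * (real k + 1 + a) \<noteq> 0" using a by simp
      ultimately show ?thesis unfolding k by (rule cancel)
    qed
    show ?thesis
    proof (cases m)
      case 0
      have "I (\<lambda>x. C n x * C n' x * (F x * q x)) = I (\<lambda>x. of_real (2 * a) * (of_real (z x) * C n' x * (C m x * (F x * q x))))"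
        unfolding 2 0 by (intro Bochner_Integration.integral_cong refl) (simp add: mult_ac)
      also have "\<dots> = 0" unfolding integral_mult_right_zero z by simp
      finally show ?thesis .
    next
      case (Suc j)
      have "I (\<lambda>x. of_real (z x) * C (Suc j) x * (C n' x * (F x * q x))) = 0"
        using z unfolding Suc by (simp add: mult_ac)
      moreover have "I (\<lambda>x. C j x * C n' x * (F x * (of_real (\<rho> x) * q x))) = 0"
        using less.prems 2 Suc M by (intro less.IH rot_inv_mult rot_inv_sq_upto) auto
      then have "I (\<lambda>x. of_real (\<rho> x) * C j x * (C n' x * (F x * q x))) = 0" by (simp add: mult_ac)
      moreover have "pfun d (\<lambda>x. C n' x * (F x * q x))"
        using M pfun_F q' by (intro pfun.mult pfun_hgeg) auto
      ultimately have "of_real (real j + 2) * I (\<lambda>x. C (Suc (Suc j)) x * (C n' x * (F x * q x))) = 0"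
        using int_three_term[of "\<lambda>x. C n' x * (F x * q x)" j] by simp
      moreover have "real j + 2 \<noteq> 0" by simp
      ultimately have "I (\<lambda>x. C (Suc (Suc j)) x * (C n' x * (F x * q x))) = 0"
        by (rule cancel)
      then show ?thesis unfolding 2 Suc by (simp only: mult.assoc)
    qed
  qed
qed

lemma hgeg_orthogonal:
  assumes "rot_inv d (Suc M) q" "n \<noteq> n'"
  shows "(LINT x|sphere_measure d. complex_of_real (hgeg a n (x $ Suc M) (sq_upto (Suc M) x)) *
    complex_of_real (hgeg a n' (x $ Suc M) (sq_upto (Suc M) x)) * (F x * q x)) = 0"
  using hgeg_orthogonal_less[OF assms(1), of n n'] hgeg_orthogonal_less[OF assms(1), of n' n] assms(2)
  by (cases n n' rule: linorder_cases) (auto simp: mult_ac)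

end

section \<open>Solid spherical harmonics\<close>

text \<open>The degree at level \<open>m\<close>, that is in the coordinates \<open>x\<^sub>0, \<dots>, x\<^bsub>m+1\<^esub>\<close>, is \<open>\<bar>\<kappa> m\<bar>\<close>;
  only \<open>\<kappa> 0\<close> carries a sign.\<close>
primrec solid :: "(nat \<Rightarrow> int) \<Rightarrow> nat \<Rightarrow> real vec \<Rightarrow> complex" where
  "solid \<kappa> 0 x = (if \<kappa> 0 \<ge> 0 then (of_real (x $ 1) + \<i> * of_real (x $ 0)) ^ nat (\<kappa> 0)
     else (of_real (x $ 1) - \<i> * of_real (x $ 0)) ^ nat (- \<kappa> 0))"
| "solid \<kappa> (Suc m) x =
     of_real (hgeg (of_int \<bar>\<kappa> m\<bar> + (real m + 1) / 2) (nat (\<kappa> (Suc m) - \<bar>\<kappa> m\<bar>)) (x $ Suc (Suc m)) (sq_upto (Suc (Suc m)) x))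
     * solid \<kappa> m x"

definition admissible :: "nat \<Rightarrow> (nat \<Rightarrow> int) \<Rightarrow> bool" where
  "admissible m \<kappa> \<longleftrightarrow> (\<forall>i<m. \<bar>\<kappa> i\<bar> \<le> \<kappa> (Suc i))"

lemma admissible_Suc: "admissible (Suc m) \<kappa> \<longleftrightarrow> admissible m \<kappa> \<and> \<bar>\<kappa> m\<bar> \<le> \<kappa> (Suc m)"
  by (auto simp: admissible_def less_Suc_eq)

lemma hpoly_solid: "admissible m \<kappa> \<Longrightarrow> hpoly {..Suc m} (nat \<bar>\<kappa> m\<bar>) (solid \<kappa> m)"
proof (induction m)
  case 0
  have "hpoly {..Suc 0} (n * 1) (\<lambda>x. (of_real (x $ 1) + c * of_real (x $ 0)) ^ n)" for c n
    by (intro hpoly_power hpoly.add hpoly_scale hpoly_coord) auto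
  from this[of "nat (\<kappa> 0)" \<i>] this[of "nat (- \<kappa> 0)" "- \<i>"] show ?case
    by (cases "\<kappa> 0 \<ge> 0") (auto simp: abs_if)
next
  case (Suc m)
  then have adm: "admissible m \<kappa>" "\<bar>\<kappa> m\<bar> \<le> \<kappa> (Suc m)" by (auto simp: admissible_Suc)
  have "hpoly {..Suc (Suc m)} (nat (\<kappa> (Suc m) - \<bar>\<kappa> m\<bar>) + nat \<bar>\<kappa> m\<bar>) (solid \<kappa> (Suc m))"
    unfolding solid.simps by (intro hpoly_mult hpoly_hgeg hpoly_mono[OF Suc.IH[OF adm(1)]]) auto
  moreover have "nat (\<kappa> (Suc m) - \<bar>\<kappa> m\<bar>) + nat \<bar>\<kappa> m\<bar> = nat \<bar>\<kappa> (Suc m)\<bar>" using adm(2) by linarith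
  ultimately show ?case by (simp only:)
qed

lemma solid_cong: "(\<And>i. i \<le> m \<Longrightarrow> \<kappa> i = \<kappa>' i) \<Longrightarrow> solid \<kappa> m = solid \<kappa>' m"
  by (induction m) (auto simp: fun_eq_iff)

lemma pfun_solid: "admissible m \<kappa> \<Longrightarrow> Suc m < d \<Longrightarrow> pfun d (solid \<kappa> m)"
  by (rule hpoly_imp_pfun[OF hpoly_solid]) auto

text \<open>The first angle is measured from the axis of x_1 towards that of x_0, so x_1 + i x_0 is
  the complex coordinate of the plane; the rotation by \<gamma> runs against this orientation, hence
  the minus sign.\<close>

lemma solid_0_rot:
  assumes "1 < d"
  shows "solid \<kappa> 0 (plane_rot d 0 1 \<gamma> x) = cis (- of_int (\<kappa> 0) * \<gamma>) * solid \<kappa> 0 x"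
proof -
  have 1: "of_real (plane_rot d 0 1 \<gamma> x $ 1) + \<i> * of_real (plane_rot d 0 1 \<gamma> x $ 0)
      = cis (- \<gamma>) * (of_real (x $ 1) + \<i> * of_real (x $ 0))"
    using assms by (simp add: plane_rot_coord complex_eq_iff)
  have 2: "of_real (plane_rot d 0 1 \<gamma> x $ 1) - \<i> * of_real (plane_rot d 0 1 \<gamma> x $ 0)
      = cis \<gamma> * (of_real (x $ 1) - \<i> * of_real (x $ 0))"
    using assms by (simp add: plane_rot_coord complex_eq_iff)
  have 3: "cis (- \<gamma>) ^ nat k = cis (- of_int k * \<gamma>)" if "k \<ge> 0" for k
  proof -
    have "real (nat k) * - \<gamma> = - of_int k * \<gamma>" using that by simp
    then show ?thesis by (simp only: Complex.DeMoivre)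
  qed
  have 4: "cis \<gamma> ^ nat (- k) = cis (- of_int k * \<gamma>)" if "k < 0" for k
  proof -
    have "real (nat (- k)) * \<gamma> = - of_int k * \<gamma>" using that by simp
    then show ?thesis by (simp only: Complex.DeMoivre)
  qed
  show ?thesis
  proof (cases "\<kappa> 0 \<ge> 0")
    case True
    then show ?thesis by (simp only: solid.simps if_True 1 power_mult_distrib 3)
  next
    case False
    then have "\<kappa> 0 < 0" by simp
    show ?thesis by (simp only: solid.simps False if_False 2 power_mult_distrib 4[OF \<open>\<kappa> 0 < 0\<close>])
  qed
qed

text \<open>If the degrees already differ at a lower level, the top Gegenbauer factors are invariant
  under rotations of the lower coordinates and join \<open>q\<close>. Otherwise only the top degrees
  differ, and \<open>hgeg_orthogonal\<close> applies with the weight |solid|^2, homogeneous of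
  degree twice the common lower degree.\<close>

lemma solid_orthogonal:
  assumes "Suc m < d" "admissible m \<kappa>" "admissible m \<kappa>'" "\<exists>i\<le>m. \<kappa> i \<noteq> \<kappa>' i" "rot_inv d (Suc m) q"
  shows "(LINT x|sphere_measure d. solid \<kappa> m x * cnj (solid \<kappa>' m x) * q x) = 0"
  using assms
proof (induction m arbitrary: q)
  case 0
  then have ne: "\<kappa> 0 \<noteq> \<kappa>' 0" by auto
  define k where "k = \<kappa> 0 - \<kappa>' 0"
  define f where "f x = solid \<kappa> 0 x * cnj (solid \<kappa>' 0 x) * q x" for x
  have k: "k \<noteq> 0" using ne by (simp add: k_def)
  \<comment> \<open>With this angle the integrand is multiplied by exactly e^(-i), which is not 1;
    moreover it is at most 1 in modulus, so that rotation invariance is available.\<close>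
  define \<gamma> where "\<gamma> = 1 / real_of_int k"
  have g: "\<bar>\<gamma>\<bar> \<le> 1" using k by (simp add: \<gamma>_def)
  have "pfun d q" using 0 by (simp add: rot_inv_def)
  then have pf: "pfun d f" unfolding f_def using 0 by (intro pfun.mult pfun_cnj pfun_solid) auto
  have "f (plane_rot d 0 1 \<gamma> x) = cis (- 1) * f x" if "x \<in> carrier_vec d" for x
  proof -
    have q: "q (plane_rot d 0 1 \<gamma> x) = q x" using 0 that by (auto simp: rot_inv_def)
    have eq: "cis (- of_int (\<kappa> 0) * \<gamma>) * cnj (cis (- of_int (\<kappa>' 0) * \<gamma>)) = cis (-1)"
    proof -
      have "- of_int (\<kappa> 0) * \<gamma> + of_int (\<kappa>' 0) * \<gamma> = - (of_int k * \<gamma>)"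
        by (simp add: k_def algebra_simps)
      also have "\<dots> = -1" using k by (simp add: \<gamma>_def)
      finally show ?thesis by (simp add: cis_cnj cis_mult)
    qed
    have "1 < d" using 0 by simp
    with q have "f (plane_rot d 0 1 \<gamma> x) = (cis (- of_int (\<kappa> 0) * \<gamma>) * cnj (cis (- of_int (\<kappa>' 0) * \<gamma>))) * f x"
      unfolding f_def by (simp only: solid_0_rot complex_cnj_mult mult_ac)
    then show ?thesis unfolding eq .
  qed
  then have "(LINT x|sphere_measure d. f (plane_rot d 0 1 \<gamma> x)) = (LINT x|sphere_measure d. cis (-1) * f x)"
    by (intro Bochner_Integration.integral_cong) (auto simp: sphere_vec_def)
  moreover have "(LINT x|sphere_measure d. f (plane_rot d 0 1 \<gamma> x)) = (LINT x|sphere_measure d. f x)"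
    using 0 pf g by (intro sphere_integral_rot cos_ne_minus_one pfun_measurable) auto
  ultimately have "(1 - cis (-1)) * (LINT x|sphere_measure d. f x) = 0"
    by (simp add: algebra_simps)
  moreover have "cis (-1) \<noteq> 1"
  proof
    assume "cis (-1) = 1"
    then have "sin (1 :: real) = 0" by (simp add: complex_eq_iff)
    moreover have "sin (1 :: real) > 0" using pi_gt3 by (intro sin_gt_zero) auto
    ultimately show False by simp
  qed
  ultimately show ?case unfolding f_def by simp
next
  case (Suc m)
  then have adm: "admissible m \<kappa>" "\<bar>\<kappa> m\<bar> \<le> \<kappa> (Suc m)" "admissible m \<kappa>'" "\<bar>\<kappa>' m\<bar> \<le> \<kappa>' (Suc m)"
    by (auto simp: admissible_Suc)
  define A where "A \<kappa> x = complex_of_real (hgeg (of_int \<bar>\<kappa> m\<bar> + (real m + 1) / 2) (nat (\<kappa> (Suc m) - \<bar>\<kappa> m\<bar>))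
    (x $ Suc (Suc m)) (sq_upto (Suc (Suc m)) x))" for \<kappa> :: "nat \<Rightarrow> int" and x
  have s: "solid \<kappa> (Suc m) x = A \<kappa> x * solid \<kappa> m x" for \<kappa> x by (simp add: A_def)
  show ?case
  proof (cases "\<exists>i\<le>m. \<kappa> i \<noteq> \<kappa>' i")
    case True
    have "rot_inv d (Suc m) (\<lambda>x. A \<kappa> x * A \<kappa>' x * q x)"
      unfolding A_def using Suc.prems by (intro rot_inv_mult rot_inv_hgeg rot_inv_mono[OF Suc.prems(5)]) auto
    then have "(LINT x|sphere_measure d. solid \<kappa> m x * cnj (solid \<kappa>' m x) * (A \<kappa> x * A \<kappa>' x * q x)) = 0"
      using Suc.prems adm True by (intro Suc.IH) auto
    moreover have "cnj (A \<kappa>' x) = A \<kappa>' x" for x by (simp add: A_def)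
    ultimately show ?thesis by (simp only: s complex_cnj_mult mult_ac)
  next
    case False
    then have eq: "solid \<kappa>' m = solid \<kappa> m" "\<kappa>' m = \<kappa> m" by (auto intro: solid_cong)
    define D where "D = nat \<bar>\<kappa> m\<bar> + nat \<bar>\<kappa> m\<bar>"
    have F: "hpoly {..Suc m} D (\<lambda>x. solid \<kappa> m x * cnj (solid \<kappa> m x))"
      unfolding D_def by (intro hpoly_mult hpoly_cnj hpoly_solid adm)
    have D: "2 * (of_int \<bar>\<kappa> m\<bar> + (real m + 1) / 2) = real (D + Suc m)"
      unfolding D_def of_nat_add by (simp add: field_simps)
    have ne: "nat (\<kappa> (Suc m) - \<bar>\<kappa> m\<bar>) \<noteq> nat (\<kappa>' (Suc m) - \<bar>\<kappa> m\<bar>)"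
    proof -
      obtain i where i: "i \<le> Suc m" "\<kappa> i \<noteq> \<kappa>' i" using Suc.prems(4) by blast
      have "i = Suc m" using False i by (cases "i \<le> m") auto
      then have "\<kappa> (Suc m) \<noteq> \<kappa>' (Suc m)" using i by simp
      then show ?thesis using adm(2,4) eq(2) by linarith
    qed
    have "of_int \<bar>\<kappa> m\<bar> + (real m + 1) / 2 > 0" by (intro add_nonneg_pos) auto
    from hgeg_orthogonal[OF Suc.prems(1) F this D Suc.prems(5) ne]
    have "(LINT x|sphere_measure d. A \<kappa> x * A \<kappa>' x * (solid \<kappa> m x * cnj (solid \<kappa> m x) * q x)) = 0"
      by (simp add: A_def eq)
    moreover have "cnj (A \<kappa>' x) = A \<kappa>' x" for x by (simp add: A_def)
    ultimately show ?thesis by (simp only: s complex_cnj_mult mult_ac eq)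
  qed
qed

section \<open>Completeness of the solid harmonics\<close>

inductive_set lin_span :: "(real vec \<Rightarrow> complex) set \<Rightarrow> (real vec \<Rightarrow> complex) set" for S where
  zero: "(\<lambda>x. 0) \<in> lin_span S"
| step: "f \<in> S \<Longrightarrow> g \<in> lin_span S \<Longrightarrow> (\<lambda>x. c * f x + g x) \<in> lin_span S"

lemma lin_span_base: "f \<in> S \<Longrightarrow> f \<in> lin_span S"
  using lin_span.step[OF _ lin_span.zero, of f S 1] by simp

lemma lin_span_add: "f \<in> lin_span S \<Longrightarrow> g \<in> lin_span S \<Longrightarrow> (\<lambda>x. f x + g x) \<in> lin_span S"
proof (induction rule: lin_span.induct)
  case (step f h c)
  then show ?case using lin_span.step[OF step(1) step(3)[OF step(4)], of c] by (simp add: add.assoc)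
qed simp

lemma lin_span_scale: "f \<in> lin_span S \<Longrightarrow> (\<lambda>x. c * f x) \<in> lin_span S"
proof (induction rule: lin_span.induct)
  case (step f h b)
  then show ?case using lin_span.step[OF step(1) step(3), of "c * b"] by (simp add: ring_distribs mult.assoc)
qed (auto intro: lin_span.zero)

lemma lin_span_mult:
  assumes "f \<in> lin_span S" and "\<And>f. f \<in> S \<Longrightarrow> (\<lambda>x. h x * f x) \<in> lin_span T"
  shows "(\<lambda>x. h x * f x) \<in> lin_span T"
  using assms(1)
proof (induction rule: lin_span.induct)
  case (step f g c)
  then show ?case using lin_span_add[OF lin_span_scale[OF assms(2)[OF step(1)], of c] step(3)]
    by (simp add: ring_distribs mult.left_commute)
qed (auto intro: lin_span.zero)

lemma lin_span_subset:
  assumes "f \<in> lin_span S" and "\<And>f. f \<in> S \<Longrightarrow> f \<in> lin_span T"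
  shows "f \<in> lin_span T"
  using lin_span_mult[of f S "\<lambda>_. 1" T] assms by simp

lemma lin_span_mono: "f \<in> lin_span S \<Longrightarrow> S \<subseteq> T \<Longrightarrow> f \<in> lin_span T"
  using lin_span_subset[of f S T] by (auto intro: lin_span_base)

lemma lin_span_finite:
  assumes "f \<in> lin_span (F ` I)"
  shows "\<exists>P c. finite P \<and> P \<subseteq> I \<and> f = (\<lambda>x. \<Sum>p\<in>P. c p * F p x)"
  using assms
proof (induction rule: lin_span.induct)
  case zero
  then show ?case by (intro exI[of _ "{}"]) auto
next
  case (step f g b)
  then obtain i P c where i: "i \<in> I" "f = F i" and P: "finite P" "P \<subseteq> I" "g = (\<lambda>x. \<Sum>p\<in>P. c p * F p x)"
    by blast
  \<comment> \<open>If \<open>i\<close> already occurs in \<open>P\<close>, its coefficient is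
    increased; the sum runs over a set and cannot contain a second summand for the same
    index.\<close>
  define c' where "c' = c(i := b + (if i \<in> P then c i else 0))"
  have "b * f x + g x = (\<Sum>p\<in>insert i P. c' p * F p x)" for x
  proof -
    have "(\<Sum>p\<in>insert i P. c' p * F p x) = c' i * F i x + (\<Sum>p\<in>P - {i}. c' p * F p x)"
      using P(1) by (rule sum.insert_remove)
    also have "(\<Sum>p\<in>P - {i}. c' p * F p x) = (\<Sum>p\<in>P - {i}. c p * F p x)"
      by (rule sum.cong) (auto simp: c'_def)
    also have "c' i * F i x + \<dots> = b * f x + g x"
    proof (cases "i \<in> P")
      case True
      then show ?thesis using sum.remove[OF P(1) True, of "\<lambda>p. c p * F p x"]
        by (simp add: c'_def i P(3) algebra_simps)
    qed (simp add: c'_def i P(3))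
    finally show ?thesis by simp
  qed
  then show ?case using i P by (intro exI[of _ "insert i P"] exI[of _ c']) auto
qed

text \<open>The building blocks |x|^(2i) Y of the decomposition of homogeneous polynomials of degree
  \<open>D\<close> into harmonics Y times powers of the squared norm.\<close>

definition solid_gens :: "nat \<Rightarrow> nat \<Rightarrow> (real vec \<Rightarrow> complex) set" where
  "solid_gens m D = {f. \<exists>i \<kappa>. admissible m \<kappa> \<and> 2 * i + nat \<bar>\<kappa> m\<bar> = D \<and>
     f = (\<lambda>x. of_real (sq_upto (Suc m) x) ^ i * solid \<kappa> m x)}"

text \<open>The blocks of the next level whose lower-level harmonic has degree at most
  \<open>K\<close>. At the top level that lower degree is the modulus of the first tail index, so
  spans of these sets transport the bound K of steerability.\<close>

definition solid_gens_upto :: "nat \<Rightarrow> nat \<Rightarrow> nat \<Rightarrow> (real vec \<Rightarrow> complex) set" where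
  "solid_gens_upto m K D = {f. \<exists>i \<kappa>. admissible (Suc m) \<kappa> \<and> nat \<bar>\<kappa> m\<bar> \<le> K \<and> 2 * i + nat \<bar>\<kappa> (Suc m)\<bar> = D \<and>
     f = (\<lambda>x. of_real (sq_upto (Suc (Suc m)) x) ^ i * solid \<kappa> (Suc m) x)}"

lemma solid_gens_upto_subset: "solid_gens_upto m K D \<subseteq> solid_gens (Suc m) D"
  by (auto simp: solid_gens_def solid_gens_upto_def)

lemma solid_gens_upto_mult_sq:
  assumes "f \<in> solid_gens_upto m K D"
  shows "(\<lambda>x. of_real (sq_upto (Suc (Suc m)) x) * f x) \<in> solid_gens_upto m K (D + 2)"
proof -
  obtain i \<kappa> where h: "admissible (Suc m) \<kappa>" "nat \<bar>\<kappa> m\<bar> \<le> K" "2 * i + nat \<bar>\<kappa> (Suc m)\<bar> = D"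
    "f = (\<lambda>x. of_real (sq_upto (Suc (Suc m)) x) ^ i * solid \<kappa> (Suc m) x)"
    using assms unfolding solid_gens_upto_def by blast
  show ?thesis unfolding solid_gens_upto_def mem_Collect_eq
    by (rule exI[of _ "Suc i"], rule exI[of _ \<kappa>]) (use h in \<open>auto simp del: solid.simps\<close>)
qed

text \<open>The Gegenbauer recurrence read as a formula for z C_n: the degree rises by one, or it
  drops by one and a squared norm appears. The degrees up to level \<open>m\<close> do not change,
  hence \<open>K\<close> is preserved.\<close>

lemma solid_gens_upto_mult_coord:
  assumes "f \<in> solid_gens_upto m K D"
  shows "(\<lambda>x. of_real (x $ Suc (Suc m)) * f x) \<in> lin_span (solid_gens_upto m K (Suc D))"
proof -
  obtain i \<kappa> where h: "admissible (Suc m) \<kappa>" "nat \<bar>\<kappa> m\<bar> \<le> K" "2 * i + nat \<bar>\<kappa> (Suc m)\<bar> = D"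
    "f = (\<lambda>x. of_real (sq_upto (Suc (Suc m)) x) ^ i * solid \<kappa> (Suc m) x)"
    using assms unfolding solid_gens_upto_def by blast
  have adm: "admissible m \<kappa>" "\<bar>\<kappa> m\<bar> \<le> \<kappa> (Suc m)" using h(1) by (auto simp: admissible_Suc)
  define n where "n = nat (\<kappa> (Suc m) - \<bar>\<kappa> m\<bar>)"
  define a where "a = of_int \<bar>\<kappa> m\<bar> + (real m + 1) / 2"
  have a: "a > 0" unfolding a_def by (intro add_nonneg_pos) auto
  define \<rho> where "\<rho> x = sq_upto (Suc (Suc m)) x" for x :: "real vec"
  define z where "z x = x $ Suc (Suc m)" for x :: "real vec"
  define Y where "Y k x = complex_of_real (hgeg a k (z x) (\<rho> x)) * solid \<kappa> m x" for k x
  have gen: "(\<lambda>x. of_real (\<rho> x) ^ j * Y k x) \<in> solid_gens_upto m K (Suc D)"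
    if "2 * j + k + nat \<bar>\<kappa> m\<bar> = Suc D" for j k
  proof -
    define \<kappa>' where "\<kappa>' = \<kappa>(Suc m := \<bar>\<kappa> m\<bar> + int k)"
    have s: "solid \<kappa>' m = solid \<kappa> m" by (rule solid_cong) (simp add: \<kappa>'_def)
    have e: "solid \<kappa>' (Suc m) = Y k"
      by (rule ext) (simp add: s Y_def a_def z_def \<rho>_def, simp add: \<kappa>'_def)
    have "admissible m \<kappa>'" using adm(1) by (auto simp: \<kappa>'_def admissible_def)
    then have "admissible (Suc m) \<kappa>'" by (auto simp: admissible_Suc \<kappa>'_def)
    moreover have "2 * j + nat \<bar>\<kappa>' (Suc m)\<bar> = Suc D" using that by (auto simp: \<kappa>'_def)
    moreover have "nat \<bar>\<kappa>' m\<bar> \<le> K" using h(2) by (simp add: \<kappa>'_def)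
    ultimately show ?thesis
      unfolding solid_gens_upto_def mem_Collect_eq e[symmetric] \<rho>_def by blast
  qed
  have D: "2 * i + n + nat \<bar>\<kappa> m\<bar> = D" using h(3) adm(2) unfolding n_def by linarith
  have f: "f = (\<lambda>x. of_real (\<rho> x) ^ i * Y n x)"
    unfolding h(4) by (rule ext) (simp add: Y_def \<rho>_def z_def n_def a_def)
  show ?thesis
  proof (cases n)
    case 0
    have "(\<lambda>x. of_real (1 / (2 * a)) * (of_real (\<rho> x) ^ i * Y 1 x)) \<in> lin_span (solid_gens_upto m K (Suc D))"
      using D 0 by (intro lin_span_scale lin_span_base gen) auto
    also have "(\<lambda>x. of_real (1 / (2 * a)) * (of_real (\<rho> x) ^ i * Y 1 x)) = (\<lambda>x. of_real (x $ Suc (Suc m)) * f x)"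
      unfolding f 0 using a by (intro ext) (simp add: Y_def z_def field_simps)
    finally show ?thesis .
  next
    case (Suc p)
    have "(\<lambda>x. of_real ((real p + 2) / (2 * (real p + 1 + a))) * (of_real (\<rho> x) ^ i * Y (Suc (Suc p)) x)
        + of_real ((real p + 2 * a) / (2 * (real p + 1 + a))) * (of_real (\<rho> x) ^ Suc i * Y p x))
        \<in> lin_span (solid_gens_upto m K (Suc D))"
      using D Suc by (intro lin_span_add lin_span_scale lin_span_base gen) auto
    also have "(\<lambda>x. of_real ((real p + 2) / (2 * (real p + 1 + a))) * (of_real (\<rho> x) ^ i * Y (Suc (Suc p)) x)
        + of_real ((real p + 2 * a) / (2 * (real p + 1 + a))) * (of_real (\<rho> x) ^ Suc i * Y p x))
        = (\<lambda>x. of_real (x $ Suc (Suc m)) * f x)"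
    proof
      fix x
      define N where "N = 2 * (real p + 1 + a)"
      have N: "N \<noteq> 0" using a by (simp add: N_def)
      have "(real p + 2) / N * hgeg a (Suc (Suc p)) (z x) (\<rho> x) + (real p + 2 * a) / N * (\<rho> x * hgeg a p (z x) (\<rho> x))
          = (N * z x * hgeg a (Suc p) (z x) (\<rho> x)) / N"
      proof -
        have "A / N * h + B / N * (r * h') = (A * h + B * r * h') / N" for A B h r h' :: real
          by (simp add: add_divide_distrib)
        then show ?thesis unfolding N_def hgeg_recurrence by (simp only:)
      qed
      also have "\<dots> = z x * hgeg a (Suc p) (z x) (\<rho> x)" using N by simp
      finally have r: "complex_of_real ((real p + 2) / N * hgeg a (Suc (Suc p)) (z x) (\<rho> x) + (real p + 2 * a) / N * (\<rho> x * hgeg a p (z x) (\<rho> x)))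
          = complex_of_real (z x * hgeg a (Suc p) (z x) (\<rho> x))" by (simp only:)
      have "of_real ((real p + 2) / N) * (of_real (\<rho> x) ^ i * Y (Suc (Suc p)) x)
          + of_real ((real p + 2 * a) / N) * (of_real (\<rho> x) ^ Suc i * Y p x)
          = complex_of_real ((real p + 2) / N * hgeg a (Suc (Suc p)) (z x) (\<rho> x) + (real p + 2 * a) / N * (\<rho> x * hgeg a p (z x) (\<rho> x)))
            * (of_real (\<rho> x) ^ i * solid \<kappa> m x)"
        by (simp only: Y_def of_real_add of_real_mult power_Suc distrib_right distrib_left mult_ac)
      also have "\<dots> = of_real (x $ Suc (Suc m)) * f x"
        unfolding r f Suc by (simp only: Y_def z_def of_real_mult mult_ac)
      finally show "of_real ((real p + 2) / (2 * (real p + 1 + a))) * (of_real (\<rho> x) ^ i * Y (Suc (Suc p)) x)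
        + of_real ((real p + 2 * a) / (2 * (real p + 1 + a))) * (of_real (\<rho> x) ^ Suc i * Y p x)
        = of_real (x $ Suc (Suc m)) * f x" unfolding N_def .
    qed
    finally show ?thesis .
  qed
qed

lemma coord_power_span:
  assumes "f \<in> lin_span (solid_gens_upto m K D)"
  shows "(\<lambda>x. of_real (x $ Suc (Suc m)) ^ j * f x) \<in> lin_span (solid_gens_upto m K (j + D))"
proof (induction j)
  case (Suc j)
  show ?case using lin_span_mult[OF Suc solid_gens_upto_mult_coord] by (simp add: mult.assoc)
qed (use assms in simp)

text \<open>The squared norm of the lower level is that of the upper level minus the square of the
  new coordinate, and both of these multiplications respect the bound \<open>K\<close>.\<close>

lemma sq_power_span:
  assumes "f \<in> lin_span (solid_gens_upto m K D)"
  shows "(\<lambda>x. of_real (sq_upto (Suc m) x) ^ i * f x) \<in> lin_span (solid_gens_upto m K (2 * i + D))"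
proof (induction i)
  case (Suc i)
  let ?g = "\<lambda>x. of_real (sq_upto (Suc m) x) ^ i * f x"
  have 1: "(\<lambda>x. of_real (sq_upto (Suc (Suc m)) x) * ?g x) \<in> lin_span (solid_gens_upto m K (2 + (2 * i + D)))"
    by (rule lin_span_mult[OF Suc]) (use solid_gens_upto_mult_sq in \<open>auto intro: lin_span_base simp: add.commute\<close>)
  have 2: "(\<lambda>x. - 1 * (of_real (x $ Suc (Suc m)) ^ 2 * ?g x)) \<in> lin_span (solid_gens_upto m K (2 + (2 * i + D)))"
    by (intro lin_span_scale coord_power_span Suc)
  have "of_real (sq_upto (Suc (Suc m)) x) * ?g x + - 1 * (of_real (x $ Suc (Suc m)) ^ 2 * ?g x)
      = of_real (sq_upto (Suc m) x) ^ Suc i * f x" for x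
    by (simp add: sq_upto_def algebra_simps)
  with lin_span_add[OF 1 2] show ?case by simp
qed (use assms in simp)

text \<open>A harmonic of level \<open>m\<close> is one of the next level whose new Gegenbauer
  factor has degree 0. The bound \<open>e\<close> does not involve \<open>j\<close>: the degree in
  the lower coordinates alone bounds the tail degree, however high the power of the last coordinate.
  This converts the degree bound from steerability into a bound on tails.\<close>

lemma coord_power_solid_gens:
  assumes "h \<in> lin_span (solid_gens m e)"
  shows "(\<lambda>x. of_real (x $ Suc (Suc m)) ^ j * h x) \<in> lin_span (solid_gens_upto m e (j + e))"
proof (rule lin_span_mult[OF assms])
  fix f assume "f \<in> solid_gens m e"
  then obtain i \<kappa> where h: "admissible m \<kappa>" "2 * i + nat \<bar>\<kappa> m\<bar> = e"
    "f = (\<lambda>x. of_real (sq_upto (Suc m) x) ^ i * solid \<kappa> m x)"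
    unfolding solid_gens_def by blast
  define \<kappa>' where "\<kappa>' = \<kappa>(Suc m := \<bar>\<kappa> m\<bar>)"
  have \<kappa>'_m: "\<kappa>' m = \<kappa> m" "\<kappa>' (Suc m) = \<bar>\<kappa> m\<bar>" by (simp_all add: \<kappa>'_def)
  have s: "solid \<kappa>' m = solid \<kappa> m" by (rule solid_cong) (simp add: \<kappa>'_def)
  have e: "solid \<kappa>' (Suc m) = solid \<kappa> m" by (rule ext) (simp add: s, simp add: \<kappa>'_def)
  have "admissible m \<kappa>'" using h(1) by (auto simp: \<kappa>'_def admissible_def)
  then have "admissible (Suc m) \<kappa>'" by (auto simp: admissible_Suc \<kappa>'_def)
  then have "solid \<kappa> m \<in> solid_gens_upto m e (nat \<bar>\<kappa> m\<bar>)"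
    unfolding solid_gens_upto_def mem_Collect_eq using h(2)
    by (intro exI[of _ 0] exI[of _ \<kappa>']) (auto simp: e \<kappa>'_m simp del: solid.simps)
  then have "(\<lambda>x. of_real (x $ Suc (Suc m)) ^ j * f x) \<in> lin_span (solid_gens_upto m e (j + (2 * i + nat \<bar>\<kappa> m\<bar>)))"
    unfolding h(3) by (intro coord_power_span sq_power_span lin_span_base)
  then show "(\<lambda>x. of_real (x $ Suc (Suc m)) ^ j * f x) \<in> lin_span (solid_gens_upto m e (j + e))"
    unfolding h(2) .
qed

lemma hpoly_split_last:
  assumes "hpoly {..Suc M} D f"
  shows "f \<in> lin_span {f. \<exists>j e h. j + e = D \<and> hpoly {..M} e h \<and> f = (\<lambda>x. of_real (x $ Suc M) ^ j * h x)}"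
  using assms
proof (induction rule: hpoly.induct)
  case (const c)
  show ?case by (rule lin_span_base, rule CollectI, rule exI[of _ 0], rule exI[of _ 0], rule exI[of _ "\<lambda>_. c"])
    (auto intro: hpoly.const)
next
  case (coord i D f)
  show ?case
  proof (rule lin_span_mult[OF coord(3)])
    fix f assume "f \<in> {f. \<exists>j e h. j + e = D \<and> hpoly {..M} e h \<and> f = (\<lambda>x. of_real (x $ Suc M) ^ j * h x)}"
    then obtain j e h where f: "j + e = D" "hpoly {..M} e h" "f = (\<lambda>x. of_real (x $ Suc M) ^ j * h x)" by blast
    show "(\<lambda>x. of_real (x $ i) * f x) \<in> lin_span {f. \<exists>j e h. j + e = Suc D \<and> hpoly {..M} e h \<and> f = (\<lambda>x. of_real (x $ Suc M) ^ j * h x)}"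
    proof (cases "i = Suc M")
      case True
      then show ?thesis using f
        by (intro lin_span_base CollectI exI[of _ "Suc j"] exI[of _ e] exI[of _ h]) auto
    next
      case False
      then have "hpoly {..M} (Suc e) (\<lambda>x. of_real (x $ i) * h x)" using coord(1) f by (intro hpoly.coord) auto
      then show ?thesis using f
        by (intro lin_span_base CollectI exI[of _ j] exI[of _ "Suc e"] exI[of _ "\<lambda>x. of_real (x $ i) * h x"]) auto
    qed
  qed
qed (auto intro: lin_span.zero lin_span_add)

text \<open>On the plane the variables are w, w' = x_1 + i x_0, x_1 - i x_0, and w w' is the squared
  norm; so a monomial is a pure power of one of them times powers of the squared norm. At higher
  levels the polynomial is sorted by powers of its last coordinate.\<close>

lemma hpoly_solid_gens: "hpoly {..Suc m} D f \<Longrightarrow> f \<in> lin_span (solid_gens m D)"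
proof (induction m arbitrary: D f)
  case 0
  define w where "w x = complex_of_real (x $ 1) + \<i> * of_real (x $ 0)" for x :: "real vec"
  define w' where "w' x = complex_of_real (x $ 1) - \<i> * of_real (x $ 0)" for x :: "real vec"
  define E where "E k x = (if k \<ge> 0 then w x ^ nat k else w' x ^ nat (- k))" for k x
  have ww: "w x * w' x = of_real (sq_upto (Suc 0) x)" for x
    by (simp add: w_def w'_def sq_upto_def complex_eq_iff power2_eq_square)
  have gen: "(\<lambda>x. of_real (sq_upto (Suc 0) x) ^ i * E k x) \<in> solid_gens 0 D"
    if "2 * i + nat \<bar>k\<bar> = D" for i k D
  proof -
    have "solid (\<lambda>_. k) 0 = E k" by (rule ext) (simp add: E_def w_def w'_def)
    then show ?thesis using that
      unfolding solid_gens_def mem_Collect_eq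
      by (intro exI[of _ i] exI[of _ "\<lambda>_. k"]) (auto simp: admissible_def simp del: solid.simps)
  qed
  have repr: "\<exists>i k. 2 * i + nat \<bar>k\<bar> = D \<and> f = (\<lambda>x. of_real (sq_upto (Suc 0) x) ^ i * E k x)"
    if f: "f \<in> solid_gens 0 D" for f D
  proof -
    obtain i \<kappa> where "2 * i + nat \<bar>\<kappa> 0\<bar> = D" "f = (\<lambda>x. of_real (sq_upto (Suc 0) x) ^ i * solid \<kappa> 0 x)"
      using f unfolding solid_gens_def by blast
    then show ?thesis by (intro exI[of _ i] exI[of _ "\<kappa> 0"]) (auto simp: E_def w_def w'_def)
  qed
  have mw: "(\<lambda>x. w x * f x) \<in> lin_span (solid_gens 0 (Suc D))" if "f \<in> lin_span (solid_gens 0 D)" for f D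
    using that
  proof (rule lin_span_mult)
    fix f assume "f \<in> solid_gens 0 D"
    then obtain i k where f: "2 * i + nat \<bar>k\<bar> = D" "f = (\<lambda>x. of_real (sq_upto (Suc 0) x) ^ i * E k x)" using repr by blast
    show "(\<lambda>x. w x * f x) \<in> lin_span (solid_gens 0 (Suc D))"
    proof (cases "k \<ge> 0")
      case True
      then have "(\<lambda>x. w x * f x) = (\<lambda>x. of_real (sq_upto (Suc 0) x) ^ i * E (k + 1) x)"
        unfolding f by (intro ext) (simp add: E_def nat_add_distrib)
      also have "\<dots> \<in> lin_span (solid_gens 0 (Suc D))" using True f(1) by (intro lin_span_base gen) auto
      finally show ?thesis .
    next
      case False
      have "w' x ^ nat (- k) = w' x * E (k + 1) x" for x
      proof -
        have "nat (- k) = Suc (nat (- (k + 1)))" using False by linarith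
        then show ?thesis using False by (cases "k = -1") (auto simp: E_def)
      qed
      then have "(\<lambda>x. w x * f x) = (\<lambda>x. of_real (sq_upto (Suc 0) x) ^ Suc i * E (k + 1) x)"
        unfolding f using False by (intro ext) (simp add: E_def[of k] flip: ww)
      also have "\<dots> \<in> lin_span (solid_gens 0 (Suc D))" using False f(1) by (intro lin_span_base gen) auto
      finally show ?thesis .
    qed
  qed
  have mw': "(\<lambda>x. w' x * f x) \<in> lin_span (solid_gens 0 (Suc D))" if "f \<in> lin_span (solid_gens 0 D)" for f D
    using that
  proof (rule lin_span_mult)
    fix f assume "f \<in> solid_gens 0 D"
    then obtain i k where f: "2 * i + nat \<bar>k\<bar> = D" "f = (\<lambda>x. of_real (sq_upto (Suc 0) x) ^ i * E k x)" using repr by blast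
    show "(\<lambda>x. w' x * f x) \<in> lin_span (solid_gens 0 (Suc D))"
    proof (cases "k > 0")
      case True
      have "E k x = w x * E (k - 1) x" for x
      proof -
        have "nat k = Suc (nat (k - 1))" using True by linarith
        then show ?thesis using True by (auto simp: E_def)
      qed
      then have "(\<lambda>x. w' x * f x) = (\<lambda>x. of_real (sq_upto (Suc 0) x) ^ Suc i * E (k - 1) x)"
        unfolding f by (intro ext) (simp flip: ww)
      also have "\<dots> \<in> lin_span (solid_gens 0 (Suc D))" using True f(1) by (intro lin_span_base gen) auto
      finally show ?thesis .
    next
      case False
      have "w' x * E k x = E (k - 1) x" for x
      proof -
        have "nat (- (k - 1)) = Suc (nat (- k))" using False by linarith
        then show ?thesis using False by (cases "k = 0") (auto simp: E_def)
      qed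
      then have "(\<lambda>x. w' x * f x) = (\<lambda>x. of_real (sq_upto (Suc 0) x) ^ i * E (k - 1) x)"
        unfolding f by (intro ext) (simp add: mult.left_commute)
      also have "\<dots> \<in> lin_span (solid_gens 0 (Suc D))" using False f(1) by (intro lin_span_base gen) auto
      finally show ?thesis .
    qed
  qed
  show ?case using 0
  proof (induction rule: hpoly.induct)
    case (const c)
    have "(\<lambda>x. c * (of_real (sq_upto (Suc 0) x) ^ 0 * E 0 x)) \<in> lin_span (solid_gens 0 0)"
      by (intro lin_span_scale lin_span_base gen) auto
    then show ?case by (simp add: E_def)
  next
    case (coord i D f)
    then have "i = 0 \<or> i = 1" by auto
    then show ?case
    proof
      assume "i = 1"
      have "(\<lambda>x. (1 / 2) * (w x * f x) + (1 / 2) * (w' x * f x)) \<in> lin_span (solid_gens 0 (Suc D))"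
        by (intro lin_span_add lin_span_scale mw mw' coord)
      also have "(\<lambda>x. (1 / 2) * (w x * f x) + (1 / 2) * (w' x * f x)) = (\<lambda>x. of_real (x $ i) * f x)"
        unfolding \<open>i = 1\<close> by (intro ext) (simp add: w_def w'_def algebra_simps)
      finally show ?thesis .
    next
      assume "i = 0"
      have "(\<lambda>x. (- \<i> / 2) * (w x * f x) + (\<i> / 2) * (w' x * f x)) \<in> lin_span (solid_gens 0 (Suc D))"
        by (intro lin_span_add lin_span_scale mw mw' coord)
      also have "(\<lambda>x. (- \<i> / 2) * (w x * f x) + (\<i> / 2) * (w' x * f x)) = (\<lambda>x. of_real (x $ i) * f x)"
        unfolding \<open>i = 0\<close> by (intro ext) (simp add: w_def w'_def field_simps)
      finally show ?thesis .
    qed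
  qed (auto intro: lin_span.zero lin_span_add)
next
  case (Suc m)
  show ?case
  proof (rule lin_span_subset[OF hpoly_split_last[OF Suc.prems]])
    fix f assume "f \<in> {f. \<exists>j e h. j + e = D \<and> hpoly {..Suc m} e h \<and> f = (\<lambda>x. of_real (x $ Suc (Suc m)) ^ j * h x)}"
    then obtain j e h where f: "j + e = D" "hpoly {..Suc m} e h" "f = (\<lambda>x. of_real (x $ Suc (Suc m)) ^ j * h x)" by blast
    then have "f \<in> lin_span (solid_gens_upto m e D)"
      using coord_power_solid_gens[OF Suc.IH[OF f(2)], of j] by simp
    then show "f \<in> lin_span (solid_gens (Suc m) D)"
      using solid_gens_upto_subset by (rule lin_span_mono)
  qed
qed

section \<open>The basis in spherical coordinates\<close>

text \<open>With g = s^2 - 2ts the generating function G = (1 + g)^(-a) satisfies (1 + g) G' = -a g'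
  G. Comparing coefficients yields the recurrence by which \<open>hgeg\<close> is defined, at \<rho>
  = 1.\<close>

lemma gegenbauer_eq_hgeg: "gegenbauer n a t = hgeg a n t 1"
proof -
  define g :: "real fps" where "g = fps_X\<^sup>2 - fps_const (2 * t) * fps_X"
  define G where "G = fps_compose (fps_binomial (- a)) g"
  have g0: "fps_nth g 0 = 0" by (simp add: g_def)
  have "(1 + fps_X) * fps_deriv (fps_binomial (- a)) = fps_const (- a) * fps_binomial (- a)"
  proof -
    have "fps_deriv (fps_binomial (- a)) = fps_const (- a) * fps_binomial (- a) / (1 + fps_X)"
      by (rule fps_binomial_deriv)
    moreover have "fps_nth (1 + fps_X :: real fps) 0 \<noteq> 0" by simp
    ultimately show ?thesis by (simp add: fps_divide_unit mult.commute inverse_mult_eq_1' mult.assoc)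
  qed
  then have "((1 + fps_X) * fps_deriv (fps_binomial (- a))) oo g = (fps_const (- a) * fps_binomial (- a)) oo g" by simp
  then have "(1 + g) * (fps_deriv (fps_binomial (- a)) oo g) = fps_const (- a) * G"
    using g0 by (simp add: fps_compose_mult_distrib fps_compose_add_distrib G_def)
  moreover have "fps_deriv G = (fps_deriv (fps_binomial (- a)) oo g) * fps_deriv g"
    unfolding G_def by (rule fps_compose_deriv[OF g0])
  ultimately have ode: "(1 + g) * fps_deriv G = fps_const (- a) * G * fps_deriv g"
    by (metis mult.assoc)
  have dg: "fps_deriv g = fps_const 2 * fps_X - fps_const (2 * t)"
    by (simp add: g_def fps_deriv_power' numeral_fps_const)
  have G0: "fps_nth G 0 = 1" by (simp add: G_def)
  \<comment> \<open>The coefficient of s^n in the differential equation; the conditionals stand for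
    coefficients of negative index, which natural subtraction would not turn into 0.\<close>
  have co: "fps_nth (fps_deriv G) n - 2 * t * (if n = 0 then 0 else fps_nth (fps_deriv G) (n - 1))
      + (if n < 2 then 0 else fps_nth (fps_deriv G) (n - 2))
    = 2 * a * t * fps_nth G n - 2 * a * (if n = 0 then 0 else fps_nth G (n - 1))" for n
  proof -
    have "(1 + g) * fps_deriv G = fps_deriv G + fps_X^2 * fps_deriv G - fps_const (2 * t) * (fps_X * fps_deriv G)"
      by (simp add: g_def algebra_simps)
    moreover have "fps_const (- a) * G * fps_deriv g = fps_const (2 * a * t) * G - fps_const (2 * a) * (fps_X * G)"
      unfolding dg by (simp add: algebra_simps flip: fps_const_mult fps_const_neg)
    ultimately have "fps_nth (fps_deriv G + fps_X^2 * fps_deriv G - fps_const (2 * t) * (fps_X * fps_deriv G)) n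
        = fps_nth (fps_const (2 * a * t) * G - fps_const (2 * a) * (fps_X * G)) n"
      using ode by simp
    then show ?thesis by (auto simp: fps_X_power_mult_nth split: if_splits)
  qed
  have "fps_nth G n = hgeg a n t 1"
  proof (induction n rule: less_induct)
    case (less n)
    consider "n = 0" | "n = 1" | m where "n = Suc (Suc m)"
      by (metis One_nat_def not0_implies_Suc)
    then show ?case
    proof cases
      case 1
      then show ?thesis using G0 by simp
    next
      case 2
      then show ?thesis using co[of 0] G0 by simp
    next
      case (3 m)
      have "(real m + 2) * fps_nth G (Suc (Suc m)) - 2 * t * ((real m + 1) * fps_nth G (Suc m))
          + real m * fps_nth G m = 2 * a * t * fps_nth G (Suc m) - 2 * a * fps_nth G m"
      proof (cases m)
        case 0
        then show ?thesis using co[of 1] by simp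
      next
        case (Suc k)
        then show ?thesis using co[of "Suc m"] by (simp add: numeral_2_eq_2 add_ac)
      qed
      then have "(real m + 2) * fps_nth G (Suc (Suc m))
          = 2 * (real m + 1 + a) * t * fps_nth G (Suc m) - (real m + 2 * a) * fps_nth G m"
        by (simp add: algebra_simps)
      also have "\<dots> = (real m + 2) * hgeg a (Suc (Suc m)) t 1"
        using less[of m] less[of "Suc m"] 3 hgeg_recurrence[of m a t 1] by simp
      finally show ?thesis unfolding 3 by simp
    qed
  qed
  then show ?thesis by (simp add: gegenbauer_def G_def g_def)
qed

text \<open>The last angle u is the arccosine of the last coordinate over r; the remaining
  coordinates form a point of radius r sin u in one dimension less. As sin u may vanish, the
  induction has to include radius 0.\<close>

lemma spherical_coordinates_exist:
  assumes "r \<ge> 0" "(\<Sum>m\<le>Suc M. (x m)\<^sup>2) = r\<^sup>2"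
  shows "\<exists>\<theta>. 0 \<le> \<theta> 1 \<and> \<theta> 1 < 2 * pi \<and> (\<forall>i\<in>{2..Suc M}. 0 \<le> \<theta> i \<and> \<theta> i \<le> pi) \<and>
    (\<forall>m\<le>Suc M. x m = r * (\<Prod>l\<in>{Suc m..Suc M}. sin (\<theta> l)) * (if m = 0 then 1 else cos (\<theta> m)))"
  using assms
proof (induction M arbitrary: r)
  case 0
  have "\<exists>t. 0 \<le> t \<and> t < 2 * pi \<and> x 0 = r * sin t \<and> x 1 = r * cos t"
  proof (cases "r = 0")
    case True
    then have "(x 0)\<^sup>2 + (x 1)\<^sup>2 = 0" using 0 by simp
    then show ?thesis using True by (intro exI[of _ 0]) (auto simp: sum_power2_eq_zero_iff)
  next
    case False
    then have "(x 1 / r)\<^sup>2 + (x 0 / r)\<^sup>2 = 1" using 0 by (simp add: power_divide add_divide_distrib[symmetric])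
    then obtain t where "0 \<le> t" "t < 2 * pi" "x 1 / r = cos t" "x 0 / r = sin t" by (rule sincos_total_2pi)
    then show ?thesis using False by (intro exI[of _ t]) (auto simp: field_simps)
  qed
  then obtain t where t: "0 \<le> t" "t < 2 * pi" "x 0 = r * sin t" "x 1 = r * cos t" by blast
  show ?case by (intro exI[of _ "\<lambda>_. t"]) (use t in \<open>auto simp: le_Suc_eq\<close>)
next
  case (Suc M)
  obtain u where u: "0 \<le> u" "u \<le> pi" "x (Suc (Suc M)) = r * cos u"
  proof (cases "r = 0")
    case True
    have "(x (Suc (Suc M)))\<^sup>2 \<le> (\<Sum>m\<le>Suc (Suc M). (x m)\<^sup>2)" by (rule member_le_sum) auto
    also have "\<dots> = 0" using True Suc.prems(2) by simp
    finally have "x (Suc (Suc M)) = 0" by simp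
    then show ?thesis using True by (intro that[of 0]) auto
  next
    case False
    have "(x (Suc (Suc M)))\<^sup>2 \<le> (\<Sum>m\<le>Suc (Suc M). (x m)\<^sup>2)" by (rule member_le_sum) auto
    then have "\<bar>x (Suc (Suc M))\<bar> \<le> r" using Suc.prems abs_le_square_iff[of "x (Suc (Suc M))" r] by simp
    then have "\<bar>x (Suc (Suc M)) / r\<bar> \<le> 1" using False Suc.prems by (simp add: field_simps)
    then have b: "-1 \<le> x (Suc (Suc M)) / r" "x (Suc (Suc M)) / r \<le> 1"
      using abs_le_D1[of "x (Suc (Suc M)) / r" 1] abs_le_D2[of "x (Suc (Suc M)) / r" 1] by linarith+
    show ?thesis
      by (rule that[of "arccos (x (Suc (Suc M)) / r)"]) (use b False in \<open>auto simp: arccos_lbound arccos_ubound\<close>)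
  qed
  have s: "sin u \<ge> 0" using u by (intro sin_ge_zero)
  have "(\<Sum>m\<le>Suc M. (x m)\<^sup>2) = r\<^sup>2 - (r * cos u)\<^sup>2" using Suc.prems u(3) by simp
  also have "\<dots> = (r * sin u)\<^sup>2" by (simp add: power_mult_distrib sin_squared_eq algebra_simps)
  finally obtain \<theta> where \<theta>: "0 \<le> \<theta> 1" "\<theta> 1 < 2 * pi" "\<And>i. i \<in> {2..Suc M} \<Longrightarrow> 0 \<le> \<theta> i \<and> \<theta> i \<le> pi"
    "\<And>m. m \<le> Suc M \<Longrightarrow> x m = r * sin u * (\<Prod>l\<in>{Suc m..Suc M}. sin (\<theta> l)) * (if m = 0 then 1 else cos (\<theta> m))"
    using Suc.IH[of "r * sin u"] s Suc.prems(1) by auto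
  define \<theta>' where "\<theta>' = \<theta>(Suc (Suc M) := u)"
  have p: "(\<Prod>l\<in>{Suc m..Suc (Suc M)}. sin (\<theta>' l)) = sin u * (\<Prod>l\<in>{Suc m..Suc M}. sin (\<theta> l))" if "m \<le> Suc M" for m
  proof -
    have "{Suc m..Suc (Suc M)} = insert (Suc (Suc M)) {Suc m..Suc M}" using that by auto
    then have "(\<Prod>l\<in>{Suc m..Suc (Suc M)}. sin (\<theta>' l)) = sin u * (\<Prod>l\<in>{Suc m..Suc M}. sin (\<theta>' l))"
      by (simp add: \<theta>'_def)
    also have "(\<Prod>l\<in>{Suc m..Suc M}. sin (\<theta>' l)) = (\<Prod>l\<in>{Suc m..Suc M}. sin (\<theta> l))"
      by (rule prod.cong) (auto simp: \<theta>'_def)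
    finally show ?thesis .
  qed
  show ?case
  proof (intro exI[of _ \<theta>'] conjI ballI allI impI)
    show "0 \<le> \<theta>' 1" "\<theta>' 1 < 2 * pi" using \<theta>(1,2) by (auto simp: \<theta>'_def)
    fix i assume "i \<in> {2..Suc (Suc M)}"
    then show "0 \<le> \<theta>' i" "\<theta>' i \<le> pi" using \<theta>(3)[of i] u by (auto simp: \<theta>'_def)
  next
    fix m assume m: "m \<le> Suc (Suc M)"
    show "x m = r * (\<Prod>l\<in>{Suc m..Suc (Suc M)}. sin (\<theta>' l)) * (if m = 0 then 1 else cos (\<theta>' m))"
    proof (cases "m = Suc (Suc M)")
      case True
      then show ?thesis using u(3) by (simp add: \<theta>'_def)
    next
      case False
      then show ?thesis using m \<theta>(4)[of m] p[of m] by (simp add: \<theta>'_def mult.assoc)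
    qed
  qed
qed

lemma angles_sphere:
  assumes d: "d \<ge> 2" and x: "x \<in> sphere_vec d"
  shows "spherical_point d (angles d x) = x"
proof -
  obtain M where M: "d = Suc (Suc M)" using d by (metis add_2_eq_Suc le_Suc_ex)
  have "(\<Sum>m\<le>Suc M. (x $ m)\<^sup>2) = 1\<^sup>2" using x by (simp add: sphere_vec_iff M lessThan_Suc_atMost)
  from spherical_coordinates_exist[OF _ this] obtain \<theta> where \<theta>: "0 \<le> \<theta> 1" "\<theta> 1 < 2 * pi"
    "\<And>i. i \<in> {2..Suc M} \<Longrightarrow> 0 \<le> \<theta> i \<and> \<theta> i \<le> pi"
    "\<And>m. m \<le> Suc M \<Longrightarrow> x $ m = 1 * (\<Prod>l\<in>{Suc m..Suc M}. sin (\<theta> l)) * (if m = 0 then 1 else cos (\<theta> m))"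
    by auto
  have "spherical_point d \<theta> = x"
    by (rule eq_vecI) (use \<theta>(4) x in \<open>auto simp: spherical_point_def M sphere_vec_def\<close>)
  moreover have "\<theta> \<in> angle_range d" using \<theta> by (auto simp: angle_range_def M)
  ultimately show ?thesis unfolding angles_def
    using someI[of "\<lambda>\<theta>. \<theta> \<in> angle_range d \<and> spherical_point d \<theta> = x" \<theta>] by simp
qed

text \<open>\<open>r (Suc m)\<close> is, up to sign, the norm of the coordinates up to x_(m+1). By
  homogeneity each Gegenbauer factor splits off a power of its radius and leaves its value at a
  cosine; the passage to the next radius supplies the powers of the sine. The angles are arbitrary
  here, so the radii may be negative.\<close>

lemma solid_spherical:
  fixes \<theta> :: "nat \<Rightarrow> real" and d :: nat
  defines "r \<equiv> \<lambda>m. \<Prod>l\<in>{Suc m..d - 1}. sin (\<theta> l)"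
  assumes d: "d \<ge> 3" and x: "spherical_point d \<theta> = x" and m: "Suc m < d"
  shows "sq_upto (Suc m) x = (r (Suc m))\<^sup>2"
    and "admissible m \<kappa> \<Longrightarrow> solid \<kappa> m x = of_real (r (Suc m) ^ nat \<bar>\<kappa> m\<bar> *
      (\<Prod>j<m. hgeg (of_int \<bar>\<kappa> j\<bar> + (real j + 1) / 2) (nat (\<kappa> (Suc j) - \<bar>\<kappa> j\<bar>)) (cos (\<theta> (j + 2))) 1
        * sin (\<theta> (j + 2)) ^ nat \<bar>\<kappa> j\<bar>)) * exp (\<i> * of_int (\<kappa> 0) * of_real (\<theta> 1))"
proof -
  have r: "r m = sin (\<theta> (Suc m)) * r (Suc m)" if "Suc m < d" for m
  proof -
    have "{Suc m..d - 1} = insert (Suc m) {Suc (Suc m)..d - 1}" using that by auto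
    then show ?thesis unfolding r_def by simp
  qed
  have x0: "x $ 0 = r 0" using d unfolding x[symmetric] spherical_point_def r_def by simp
  have xm: "x $ Suc m = r (Suc m) * cos (\<theta> (Suc m))" if "Suc m < d" for m
    using that unfolding x[symmetric] spherical_point_def r_def by simp
  have sq: "sq_upto (Suc m) x = (r (Suc m))\<^sup>2" if "Suc m < d" for m
    using that
  proof (induction m)
    case 0
    have "sq_upto (Suc 0) x = (sin (\<theta> (Suc 0)) * r (Suc 0))\<^sup>2 + (r (Suc 0) * cos (\<theta> (Suc 0)))\<^sup>2"
      using x0 xm[of 0] r[of 0] 0 by (simp add: sq_upto_def)
    also have "\<dots> = (r (Suc 0))\<^sup>2 * ((sin (\<theta> (Suc 0)))\<^sup>2 + (cos (\<theta> (Suc 0)))\<^sup>2)" by (simp only: power_mult_distrib distrib_left mult_ac)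
    finally show ?case by (simp only: sin_cos_squared_add mult_1_right)
  next
    case (Suc m)
    have "sq_upto (Suc (Suc m)) x = sq_upto (Suc m) x + (x $ Suc (Suc m))\<^sup>2" by (simp add: sq_upto_def)
    also have "\<dots> = (sin (\<theta> (Suc (Suc m))) * r (Suc (Suc m)))\<^sup>2 + (r (Suc (Suc m)) * cos (\<theta> (Suc (Suc m))))\<^sup>2"
      using Suc xm[of "Suc m"] r[of "Suc m"] by simp
    also have "\<dots> = (r (Suc (Suc m)))\<^sup>2 * ((sin (\<theta> (Suc (Suc m))))\<^sup>2 + (cos (\<theta> (Suc (Suc m))))\<^sup>2)"
      by (simp only: power_mult_distrib distrib_left mult_ac)
    finally show ?case by (simp only: sin_cos_squared_add mult_1_right)
  qed
  from sq[OF m] show "sq_upto (Suc m) x = (r (Suc m))\<^sup>2" .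
  show "solid \<kappa> m x = of_real (r (Suc m) ^ nat \<bar>\<kappa> m\<bar> *
      (\<Prod>j<m. hgeg (of_int \<bar>\<kappa> j\<bar> + (real j + 1) / 2) (nat (\<kappa> (Suc j) - \<bar>\<kappa> j\<bar>)) (cos (\<theta> (j + 2))) 1
        * sin (\<theta> (j + 2)) ^ nat \<bar>\<kappa> j\<bar>)) * exp (\<i> * of_int (\<kappa> 0) * of_real (\<theta> 1))" if "admissible m \<kappa>"
    using that m
  proof (induction m)
    case 0
    have w: "of_real (x $ 1) + \<i> * of_real (x $ 0) = of_real (r (Suc 0)) * exp (\<i> * of_real (\<theta> 1))"
      using x0 xm[of 0] r[of 0] d by (simp add: exp_Euler algebra_simps flip: cos_of_real sin_of_real)
    have w': "of_real (x $ 1) - \<i> * of_real (x $ 0) = of_real (r (Suc 0)) * exp (- (\<i> * of_real (\<theta> 1)))"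
    proof -
      have "cnj (of_real (x $ 1) + \<i> * of_real (x $ 0)) = cnj (of_real (r (Suc 0)) * exp (\<i> * of_real (\<theta> 1)))"
        unfolding w ..
      then show ?thesis by (simp add: exp_cnj)
    qed
    show ?case
    proof (cases "\<kappa> 0 \<ge> 0")
      case True
      have "exp (\<i> * of_real (\<theta> 1)) ^ nat (\<kappa> 0) = exp (\<i> * of_int (\<kappa> 0) * of_real (\<theta> 1))"
        using True by (simp add: mult_ac flip: exp_of_nat_mult)
      then show ?thesis using True by (simp only: solid.simps if_True w power_mult_distrib) simp
    next
      case False
      have "exp (- (\<i> * of_real (\<theta> 1))) ^ nat (- \<kappa> 0) = exp (\<i> * of_int (\<kappa> 0) * of_real (\<theta> 1))"
        using False by (simp add: mult_ac flip: exp_of_nat_mult)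
      then show ?thesis using False by (simp only: solid.simps if_False w' power_mult_distrib) simp
    qed
  next
    case (Suc m)
    then have adm: "admissible m \<kappa>" "\<bar>\<kappa> m\<bar> \<le> \<kappa> (Suc m)" by (auto simp: admissible_Suc)
    define R where "R = r (Suc (Suc m))"
    define n where "n = nat (\<kappa> (Suc m) - \<bar>\<kappa> m\<bar>)"
    define a where "a = of_int \<bar>\<kappa> m\<bar> + (real m + 1) / 2"
    define P where "P = (\<Prod>j<m. hgeg (of_int \<bar>\<kappa> j\<bar> + (real j + 1) / 2) (nat (\<kappa> (Suc j) - \<bar>\<kappa> j\<bar>)) (cos (\<theta> (j + 2))) 1
        * sin (\<theta> (j + 2)) ^ nat \<bar>\<kappa> j\<bar>)"
    have h: "hgeg a n (x $ Suc (Suc m)) (sq_upto (Suc (Suc m)) x) = R ^ n * hgeg a n (cos (\<theta> (m + 2))) 1"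
      using hgeg_homogeneous[of a n R "cos (\<theta> (m + 2))" 1] xm[of "Suc m"] sq[of "Suc m"] Suc.prems by (simp add: R_def)
    have e: "nat \<bar>\<kappa> (Suc m)\<bar> = n + nat \<bar>\<kappa> m\<bar>" using adm(2) by (simp add: n_def)
    have "solid \<kappa> (Suc m) x = of_real (R ^ n * hgeg a n (cos (\<theta> (m + 2))) 1) *
        (of_real (r (Suc m) ^ nat \<bar>\<kappa> m\<bar> * P) * exp (\<i> * of_int (\<kappa> 0) * of_real (\<theta> 1)))"
      using Suc.IH[OF adm(1)] Suc.prems(2) h unfolding solid.simps P_def a_def n_def by simp
    also have "r (Suc m) = sin (\<theta> (m + 2)) * R" using r[of "Suc m"] Suc.prems(2) by (simp add: R_def)
    also have "of_real (R ^ n * hgeg a n (cos (\<theta> (m + 2))) 1) *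
        (of_real ((sin (\<theta> (m + 2)) * R) ^ nat \<bar>\<kappa> m\<bar> * P) * exp (\<i> * of_int (\<kappa> 0) * of_real (\<theta> 1)))
      = of_real (R ^ nat \<bar>\<kappa> (Suc m)\<bar> * (P * (hgeg a n (cos (\<theta> (m + 2))) 1 * sin (\<theta> (m + 2)) ^ nat \<bar>\<kappa> m\<bar>)))
        * exp (\<i> * of_int (\<kappa> 0) * of_real (\<theta> 1))"
      unfolding e by (simp add: power_mult_distrib power_add mult_ac)
    finally show ?case unfolding R_def P_def a_def n_def prod.lessThan_Suc .
  qed
qed

text \<open>Reverses the index list: \<open>int n # k\<close> descends from the full degree to the
  exponent of the first angle, whereas \<open>solid\<close> starts in the plane and adds one
  coordinate per level.\<close>

definition level_deg :: "nat \<Rightarrow> nat \<Rightarrow> int list \<Rightarrow> nat \<Rightarrow> int" where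
  "level_deg d n k m = (int n # k) ! (d - 2 - m)"

lemma admissible_level_deg:
  assumes "d \<ge> 3" "k \<in> indices d n" shows "admissible (d - 2) (level_deg d n k)"
  unfolding admissible_def
proof (intro allI impI)
  fix i assume i: "i < d - 2"
  define j where "j = d - 3 - i"
  have j: "j < d - 2" "d - 2 - i = j + 1" "d - 2 - Suc i = j" using i by (auto simp: j_def)
  show "\<bar>level_deg d n k i\<bar> \<le> level_deg d n k (Suc i)"
    using assms(2) j by (simp add: level_deg_def indices_def)
qed

lemma level_deg_top [simp]: "level_deg d n k (d - 2) = int n"
  by (simp add: level_deg_def)

lemma level_deg_tail: "m < d - 2 \<Longrightarrow> level_deg d n k m = k ! (d - 3 - m)"
proof -
  assume "m < d - 2"
  then have "d - 2 - m = Suc (d - 3 - m)" by simp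
  then show ?thesis by (simp add: level_deg_def)
qed

lemma level_deg_inj:
  assumes "k \<in> indices d n" "k' \<in> indices d n'" "\<forall>m\<le>d - 2. level_deg d n k m = level_deg d n' k' m"
  shows "n = n'" "k = k'"
proof -
  show "n = n'" using assms(3)[rule_format, of "d - 2"] by simp
  have len: "length k = d - 2" "length k' = d - 2" using assms by (auto simp: indices_def)
  show "k = k'"
  proof (rule nth_equalityI)
    fix j assume "j < length k"
    then have "d - 3 - j < d - 2" "d - 3 - (d - 3 - j) = j" using len by auto
    then show "k ! j = k' ! j"
      using assms(3)[rule_format, of "d - 3 - j"] level_deg_tail[of "d - 3 - j" d] by simp
  qed (simp add: len)
qed

lemma level_deg_exists:
  assumes d: "d \<ge> 3" and adm: "admissible (d - 2) \<kappa>"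
  shows "\<exists>k\<in>indices d (nat (\<kappa> (d - 2))). \<forall>m\<le>d - 2. level_deg d (nat (\<kappa> (d - 2))) k m = \<kappa> m"
proof
  define n where "n = nat (\<kappa> (d - 2))"
  define k where "k = map (\<lambda>j. \<kappa> (d - 3 - j)) [0..<d - 2]"
  have pos: "\<kappa> (Suc i) \<ge> 0" if "i < d - 2" for i using adm that by (force simp: admissible_def)
  have "Suc (d - 3) = d - 2" using d by simp
  then have n: "int n = \<kappa> (d - 2)" using pos[of "d - 3"] d by (simp add: n_def)
  have nth: "(int n # k) ! j = \<kappa> (d - 2 - j)" if "j \<le> d - 2" for j
  proof (cases j)
    case (Suc i)
    then have "d - 3 - i = d - 2 - j" "i < d - 2" using that by auto
    then show ?thesis unfolding Suc by (simp add: k_def)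
  qed (simp add: n)
  show "\<forall>m\<le>d - 2. level_deg d n k m = \<kappa> m"
  proof (intro allI impI)
    fix m assume "m \<le> d - 2"
    then have "d - 2 - m \<le> d - 2" "d - 2 - (d - 2 - m) = m" by auto
    then show "level_deg d n k m = \<kappa> m" using nth[of "d - 2 - m"] by (simp only: level_deg_def)
  qed
  show "k \<in> indices d n"
  proof -
    have "0 \<le> (int n # k) ! j" if "j \<in> {1..d - 3}" for j
    proof -
      have "d - 2 - j = Suc (d - 3 - j)" "d - 3 - j < d - 2" using that by auto
      then show ?thesis using nth[of j] pos[of "d - 3 - j"] that by auto
    qed
    moreover have "\<bar>(int n # k) ! (j + 1)\<bar> \<le> (int n # k) ! j" if "j < d - 2" for j
    proof -
      have "d - 2 - j = Suc (d - 2 - (j + 1))" "d - 2 - (j + 1) < d - 2" using that by auto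
      then show ?thesis using nth[of j] nth[of "j + 1"] adm that by (auto simp: admissible_def)
    qed
    ultimately show ?thesis by (simp add: indices_def k_def)
  qed
qed

text \<open>On the sphere the top radius is 1, the empty product, and the product over the levels is
  that of \<open>sph_harm\<close> in reverse order. As \<open>solid\<close> depends on the point
  only, every choice of the angles gives the same value.\<close>

lemma sph_harm_solid:
  assumes d: "d \<ge> 3" and k: "k \<in> indices d n" and x: "x \<in> sphere_vec d"
  shows "sph_harm d n k x = of_real (norm_const d n k) * solid (level_deg d n k) (d - 2) x"
proof -
  define \<theta> where "\<theta> = angles d x"
  define \<kappa> where "\<kappa> = level_deg d n k"
  have \<theta>: "spherical_point d \<theta> = x" unfolding \<theta>_def using d x by (intro angles_sphere) auto
  have top: "{Suc (Suc (d - 2))..d - 1} = {}" using d by auto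
  have "solid \<kappa> (d - 2) x = of_real (\<Prod>j<d - 2. hgeg (of_int \<bar>\<kappa> j\<bar> + (real j + 1) / 2) (nat (\<kappa> (Suc j) - \<bar>\<kappa> j\<bar>)) (cos (\<theta> (j + 2))) 1
        * sin (\<theta> (j + 2)) ^ nat \<bar>\<kappa> j\<bar>) * exp (\<i> * of_int (\<kappa> 0) * of_real (\<theta> 1))"
    using solid_spherical(2)[OF d \<theta>, of "d - 2" \<kappa>] admissible_level_deg[OF d k] d top by (simp add: \<kappa>_def)
  also have "(\<Prod>j<d - 2. hgeg (of_int \<bar>\<kappa> j\<bar> + (real j + 1) / 2) (nat (\<kappa> (Suc j) - \<bar>\<kappa> j\<bar>)) (cos (\<theta> (j + 2))) 1
        * sin (\<theta> (j + 2)) ^ nat \<bar>\<kappa> j\<bar>)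
    = (\<Prod>i<d - 2. hgeg (of_int \<bar>\<kappa> (d - 2 - Suc i)\<bar> + (real (d - 2 - Suc i) + 1) / 2)
        (nat (\<kappa> (Suc (d - 2 - Suc i)) - \<bar>\<kappa> (d - 2 - Suc i)\<bar>)) (cos (\<theta> (d - 2 - Suc i + 2))) 1
        * sin (\<theta> (d - 2 - Suc i + 2)) ^ nat \<bar>\<kappa> (d - 2 - Suc i)\<bar>)"
    by (rule prod.nat_diff_reindex[symmetric])
  also have "\<dots> = (\<Prod>j\<in>{0..d - 3}. let a = (int n # k) ! j; b = \<bar>(int n # k) ! (j + 1)\<bar> in
          gegenbauer (nat (a - b)) ((real d - real j - 2) / 2 + of_int b) (cos (\<theta> (d - j - 1)))
          * sin (\<theta> (d - j - 1)) ^ nat b)"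
  proof (rule prod.cong)
    show "{..<d - 2} = {0..d - 3}" using d by auto
    fix i assume "i \<in> {0..d - 3}"
    then have i: "i < d - 2" using d by auto
    have 1: "\<kappa> (Suc (d - 2 - Suc i)) = (int n # k) ! i" "\<kappa> (d - 2 - Suc i) = (int n # k) ! (i + 1)"
    proof -
      have "d - 2 - Suc (d - 2 - Suc i) = i" "d - 2 - (d - 2 - Suc i) = i + 1" using i by auto
      then show "\<kappa> (Suc (d - 2 - Suc i)) = (int n # k) ! i" "\<kappa> (d - 2 - Suc i) = (int n # k) ! (i + 1)"
        unfolding \<kappa>_def level_deg_def by (simp_all only:)
    qed
    have 2: "d - 2 - Suc i + 2 = d - i - 1" using i by auto
    have 3: "(real (d - 2 - Suc i) + 1) / 2 = (real d - real i - 2) / 2" using i by (simp add: of_nat_diff)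
    show "hgeg (of_int \<bar>\<kappa> (d - 2 - Suc i)\<bar> + (real (d - 2 - Suc i) + 1) / 2)
        (nat (\<kappa> (Suc (d - 2 - Suc i)) - \<bar>\<kappa> (d - 2 - Suc i)\<bar>)) (cos (\<theta> (d - 2 - Suc i + 2))) 1
        * sin (\<theta> (d - 2 - Suc i + 2)) ^ nat \<bar>\<kappa> (d - 2 - Suc i)\<bar>
      = (let a = (int n # k) ! i; b = \<bar>(int n # k) ! (i + 1)\<bar> in
          gegenbauer (nat (a - b)) ((real d - real i - 2) / 2 + of_int b) (cos (\<theta> (d - i - 1)))
          * sin (\<theta> (d - i - 1)) ^ nat b)"
      unfolding 1 2 3 Let_def gegenbauer_eq_hgeg by (simp add: add.commute)
  qed
  also have "\<kappa> 0 = (int n # k) ! (d - 2)" by (simp add: \<kappa>_def level_deg_def)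
  finally show ?thesis
    unfolding sph_harm_def Let_def \<theta>_def[symmetric] \<kappa>_def[symmetric] by (simp add: mult.assoc)
qed

section \<open>Normalization and the three-term recurrence\<close>

text \<open>Index lists detached from their degree. Testing at the degree |k ! 0| imposes exactly
  the conditions that do not involve n, so by \<open>indices_iff\<close> a tail occurs in all
  degrees from \<open>tail_deg k\<close> on: these form its chain.\<close>

definition tail_indices :: "nat \<Rightarrow> int list set" where
  "tail_indices d = {k. k \<in> indices d (nat \<bar>k ! 0\<bar>)}"

definition tail_deg :: "int list \<Rightarrow> nat" where
  "tail_deg k = nat \<bar>k ! 0\<bar>"

lemma indices_iff:
  assumes "d \<ge> 3"
  shows "k \<in> indices d n \<longleftrightarrow> k \<in> tail_indices d \<and> tail_deg k \<le> n"
proof -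
  have nth: "(int n # k) ! j = (int m # k) ! j" if "j \<ge> 1" for j m using that by (cases j) auto
  have "(\<forall>j\<in>{1..d - 3}. 0 \<le> (int n # k) ! j) \<longleftrightarrow> (\<forall>j\<in>{1..d - 3}. 0 \<le> (int (tail_deg k) # k) ! j)"
    using nth[of _ "tail_deg k"] by auto
  moreover have "(\<forall>j<d - 2. \<bar>(int m # k) ! (j + 1)\<bar> \<le> (int m # k) ! j)
      \<longleftrightarrow> \<bar>k ! 0\<bar> \<le> int m \<and> (\<forall>j\<in>{1..<d - 2}. \<bar>(int n # k) ! (j + 1)\<bar> \<le> (int n # k) ! j)" for m
  proof -
    have "{..<d - 2} = insert 0 {1..<d - 2}" using assms by auto
    then have "(\<forall>j<d - 2. \<bar>(int m # k) ! (j + 1)\<bar> \<le> (int m # k) ! j)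
      \<longleftrightarrow> \<bar>k ! 0\<bar> \<le> int m \<and> (\<forall>j\<in>{1..<d - 2}. \<bar>(int m # k) ! (j + 1)\<bar> \<le> (int m # k) ! j)"
      unfolding lessThan_iff[symmetric] Ball_def[symmetric] by simp
    also have "(\<forall>j\<in>{1..<d - 2}. \<bar>(int m # k) ! (j + 1)\<bar> \<le> (int m # k) ! j)
      \<longleftrightarrow> (\<forall>j\<in>{1..<d - 2}. \<bar>(int n # k) ! (j + 1)\<bar> \<le> (int n # k) ! j)"
      by (rule ball_cong) (auto simp: nth[of _ m])
    finally show ?thesis .
  qed
  note this[of n] this[of "tail_deg k"]
  ultimately show ?thesis unfolding indices_def tail_indices_def mem_Collect_eq tail_deg_def[symmetric]
    by (auto simp: tail_deg_def)
qed

section \<open>The normalization constants along a chain\<close>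

definition norm_factor :: "nat \<Rightarrow> nat \<Rightarrow> int list \<Rightarrow> nat \<Rightarrow> real" where
  "norm_factor d n k j = (let a = (int n # k) ! j; b = \<bar>(int n # k) ! (j + 1)\<bar> in
        2 powi (2 * b - int j) * fact (nat (a - b)) * of_int (2 * a + int d - int j - 2)
        * (Gamma ((real d - real j - 2) / 2 + of_int b))\<^sup>2
        / (sqrt pi * Gamma (of_int (a + b + int d - int j - 2))))"

lemma norm_factor_pos:
  assumes d: "d \<ge> 3" and k: "k \<in> indices d n" and j: "j \<le> d - 3"
  shows "norm_factor d n k j > 0"
proof -
  define a b where "a = (int n # k) ! j" and "b = \<bar>(int n # k) ! (j + 1)\<bar>"
  have a: "a \<ge> 0"
  proof (cases "j = 0")
    case False
    then have "j \<in> {1..d - 3}" using j by simp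
    then show ?thesis using k unfolding a_def indices_def by blast
  qed (simp add: a_def)
  have b: "b \<ge> 0" by (simp add: b_def)
  have "2 * a + int d - int j - 2 > 0" "a + b + int d - int j - 2 > 0"
    using a b j d by linarith+
  then have 1: "real_of_int (2 * a + int d - int j - 2) > 0" "real_of_int (a + b + int d - int j - 2) > 0"
    by linarith+
  have "(real d - real j - 2) / 2 > 0" using j d by simp
  then have "(real d - real j - 2) / 2 + of_int b > 0" using b by (intro add_pos_nonneg) auto
  then have "(Gamma ((real d - real j - 2) / 2 + of_int b))\<^sup>2 > 0" by (intro zero_less_power Gamma_real_pos)
  moreover have "Gamma (real_of_int (a + b + int d - int j - 2)) > 0" using 1 by (intro Gamma_real_pos)
  ultimately show ?thesis using 1
    unfolding norm_factor_def Let_def a_def[symmetric] b_def[symmetric]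
    by (intro divide_pos_pos mult_pos_pos) auto
qed

definition norm_prefactor :: "nat \<Rightarrow> real" where
  "norm_prefactor d = 2 powi ((int d - 4) * (int d - 2)) / Gamma (real d / 2)"

lemma norm_const_eq: "norm_const d n k = sqrt (norm_prefactor d * (\<Prod>j\<in>{0..d - 3}. norm_factor d n k j))"
  by (simp add: norm_const_def norm_factor_def norm_prefactor_def)

lemma norm_const_radicand_pos:
  assumes d: "d \<ge> 3" and k: "k \<in> indices d n"
  shows "norm_prefactor d * (\<Prod>j\<in>{0..d - 3}. norm_factor d n k j) > 0"
proof (rule mult_pos_pos)
  have "Gamma (real d / 2) > 0" using d by (intro Gamma_real_pos) auto
  then show "norm_prefactor d > 0" by (simp add: norm_prefactor_def)
  show "(\<Prod>j\<in>{0..d - 3}. norm_factor d n k j) > 0"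
    by (intro prod_pos norm_factor_pos d k) auto
qed

lemma norm_const_sq:
  "d \<ge> 3 \<Longrightarrow> k \<in> indices d n \<Longrightarrow> (norm_const d n k)\<^sup>2 = norm_prefactor d * (\<Prod>j\<in>{0..d - 3}. norm_factor d n k j)"
  using norm_const_radicand_pos[of d k n] unfolding norm_const_eq by simp

definition geg_param :: "nat \<Rightarrow> int list \<Rightarrow> real" where
  "geg_param d k = real (tail_deg k) + (real d - 2) / 2"

lemma geg_param_pos: assumes "d \<ge> 3" shows "geg_param d k > 0"
proof -
  have "real d \<ge> 3" using assms by simp
  then have "(real d - 2) / 2 > 0" by simp
  then show ?thesis unfolding geg_param_def by (rule add_nonneg_pos[OF of_nat_0_le_iff])
qed

text \<open>Only the factor with index 0 involves the degree. Its quotient for consecutive degrees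
  comes from the factorial and from Gamma(x + 1) = x Gamma(x); the argument of the squared Gamma
  factor depends on the tail alone.\<close>

lemma norm_const_Suc:
  assumes d: "d \<ge> 3" and k: "k \<in> tail_indices d"
  defines "l \<equiv> geg_param d k" and "A \<equiv> \<lambda>q. norm_const d (tail_deg k + q) k"
  shows "(A (Suc q))\<^sup>2 * ((real q + l) * (real q + 2 * l)) = (A q)\<^sup>2 * ((real q + 1) * (real q + 1 + l))"
proof -
  define t where "t = tail_deg k"
  define C where "C = norm_prefactor d"
  note C = norm_const_sq[OF d, folded C_def]
  have ind: "k \<in> indices d (t + q)" for q using indices_iff[OF d] k by (simp add: t_def)
  define X where "X = (\<Prod>j\<in>{1..d - 3}. norm_factor d (t + q) k j)"
  have X: "(\<Prod>j\<in>{1..d - 3}. norm_factor d (t + Suc q) k j) = X"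
    unfolding X_def
  proof (rule prod.cong)
    fix j assume "j \<in> {1..d - 3}"
    then have "(int (t + Suc q) # k) ! j = (int (t + q) # k) ! j" by (cases j) auto
    then show "norm_factor d (t + Suc q) k j = norm_factor d (t + q) k j" by (simp add: norm_factor_def)
  qed simp
  have A: "(A q)\<^sup>2 = C * (norm_factor d (t + q) k 0 * (\<Prod>j\<in>{1..d - 3}. norm_factor d (t + q) k j))" for q
    unfolding A_def t_def[symmetric] C[OF ind] by (simp add: prod.atLeast_Suc_atMost)
  define p where "p = 2 powi (2 * int t) * (Gamma ((real d - 2) / 2 + real t))\<^sup>2 / sqrt pi"
  have f: "norm_factor d (t + q) k 0 = p * (fact q * (2 * (real q + l))) / Gamma (real q + 2 * l)" for q
  proof -
    have t: "int t = \<bar>k ! 0\<bar>" by (simp add: t_def tail_deg_def)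
    have e: "real_of_int (2 * int (t + q) + int d - int 0 - 2) = 2 * (real q + l)"
      "real_of_int (int (t + q) + int t + int d - int 0 - 2) = real q + 2 * l"
      by (simp_all add: l_def geg_param_def t_def[symmetric] field_simps)
    have "norm_factor d (t + q) k 0 = 2 powi (2 * int t - int 0) * fact (nat (int (t + q) - int t))
        * of_int (2 * int (t + q) + int d - int 0 - 2)
        * (Gamma ((real d - real 0 - 2) / 2 + of_int (int t)))\<^sup>2
        / (sqrt pi * Gamma (of_int (int (t + q) + int t + int d - int 0 - 2)))"
      unfolding norm_factor_def Let_def t by simp
    also have "nat (int (t + q) - int t) = q" by simp
    finally show ?thesis unfolding e by (simp add: p_def)
  qed
  have l: "l > 0" unfolding l_def by (rule geg_param_pos[OF d])
  define G where "G = Gamma (real q + 2 * l)"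
  have pos: "real q + 2 * l > 0" using l by simp
  have G: "G > 0" "Gamma (real (Suc q) + 2 * l) = (real q + 2 * l) * G"
    using pos Gamma_plus1[of "real q + 2 * l"] by (auto simp: G_def add_ac Gamma_real_pos nonpos_Ints_def)
  have f1: "norm_factor d (t + Suc q) k 0 * ((real q + l) * (real q + 2 * l))
      = norm_factor d (t + q) k 0 * ((real q + 1) * (real q + 1 + l))"
  proof -
    have gen: "p * ((s * F) * (2 * v)) / (w * G) * (u * w) = p * (F * (2 * u)) / G * (s * v)"
      if "w \<noteq> 0" for s F v w u :: real
      using that G(1) by (simp add: field_simps)
    have fs: "fact (Suc q) = (real q + 1) * fact q" "real (Suc q) + l = real q + 1 + l" by simp_all
    show ?thesis unfolding f G(2) G_def[symmetric] fs by (rule gen) (use pos in simp)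
  qed
  have "(A (Suc q))\<^sup>2 * ((real q + l) * (real q + 2 * l))
      = C * X * (norm_factor d (t + Suc q) k 0 * ((real q + l) * (real q + 2 * l)))"
    unfolding A X by (simp only: mult_ac)
  also have "\<dots> = (A q)\<^sup>2 * ((real q + 1) * (real q + 1 + l))"
    unfolding f1 A X_def by (simp only: mult_ac)
  finally show ?thesis .
qed

text \<open>Member number \<open>q\<close> of the chain of \<open>k\<close>, of degree
  \<open>tail_deg k + q\<close>. It agrees with \<open>sph_harm\<close> on the sphere but is a
  polynomial on all of space, as the integration lemmas require.\<close>

definition ysol :: "nat \<Rightarrow> int list \<Rightarrow> nat \<Rightarrow> real vec \<Rightarrow> complex" where
  "ysol d k q x = of_real (norm_const d (tail_deg k + q) k) * solid (level_deg d (tail_deg k + q) k) (d - 2) x"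

text \<open>The entry for the step from q to q + 1: the coefficient (q + 1) / (2 (q + \<lambda>)) of
  the Gegenbauer recurrence, with \<lambda> = \<open>geg_param d k\<close>, times the quotient of
  the normalization constants.\<close>

definition jacobi :: "nat \<Rightarrow> int list \<Rightarrow> nat \<Rightarrow> real" where
  "jacobi d k q = norm_const d (tail_deg k + q) k * (real q + 1)
     / (norm_const d (tail_deg k + Suc q) k * (2 * (real q + geg_param d k)))"

lemma norm_const_pos: "d \<ge> 3 \<Longrightarrow> k \<in> tail_indices d \<Longrightarrow> norm_const d (tail_deg k + q) k > 0"
  using norm_const_radicand_pos[of d k "tail_deg k + q"] indices_iff[of d k "tail_deg k + q"]
  unfolding norm_const_eq by simp

lemma jacobi_pos: "d \<ge> 3 \<Longrightarrow> k \<in> tail_indices d \<Longrightarrow> jacobi d k q > 0"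
  unfolding jacobi_def using norm_const_pos[of d k q] norm_const_pos[of d k "Suc q"] geg_param_pos[of d k]
  by (intro divide_pos_pos mult_pos_pos) auto

text \<open>The right-hand side is the coefficient of the step back from q + 1 to q. By
  \<open>norm_const_Suc\<close> the two coincide: the normalization constants make the matrix
  symmetric.\<close>

lemma jacobi_alt:
  assumes d: "d \<ge> 3" and k: "k \<in> tail_indices d"
  shows "jacobi d k q = norm_const d (tail_deg k + Suc q) k * (real q + 2 * geg_param d k)
     / (norm_const d (tail_deg k + q) k * (2 * (real q + 1 + geg_param d k)))"
proof -
  define A B l where "A = norm_const d (tail_deg k + q) k" and "B = norm_const d (tail_deg k + Suc q) k"
    and "l = geg_param d k"
  have p: "A > 0" "B > 0" "l > 0"
    using norm_const_pos[OF d k] geg_param_pos[OF d] by (simp_all only: A_def B_def l_def)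
  then have nz: "A \<noteq> 0" "B \<noteq> 0" "real q + l \<noteq> 0" "real q + 1 + l \<noteq> 0" by (auto simp: add_eq_0_iff)
  have e: "B\<^sup>2 * ((real q + l) * (real q + 2 * l)) = A\<^sup>2 * ((real q + 1) * (real q + 1 + l))"
    unfolding A_def B_def l_def by (rule norm_const_Suc[OF d k])
  have "(A * (real q + 1)) * (A * (2 * (real q + 1 + l))) = (B * (real q + 2 * l)) * (B * (2 * (real q + l)))"
    using e by (simp only: power2_eq_square mult_ac)
  then have "A * (real q + 1) / (B * (2 * (real q + l))) = B * (real q + 2 * l) / (A * (2 * (real q + 1 + l)))"
    using nz by (subst frac_eq_eq) auto
  then show ?thesis unfolding jacobi_def A_def B_def l_def .
qed

text \<open>In the product of the two expressions for the entry J the normalization constants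
  cancel, and 1 - 4 J^2 = \<lambda> (\<lambda> - 1) / (u (u + 1)) with u = q + \<lambda>. Dividing
  by 1 + 2 J, which is at least 1, leaves a bound for 1 - 2 J.\<close>

lemma jacobi_bound:
  assumes d: "d \<ge> 3" and k: "k \<in> tail_indices d"
  shows "\<bar>jacobi d k q - 1 / 2\<bar> \<le> geg_param d k * \<bar>geg_param d k - 1\<bar> / (real q + geg_param d k)\<^sup>2"
proof -
  define J l where "J = jacobi d k q" and "l = geg_param d k"
  define A B where "A = norm_const d (tail_deg k + q) k" and "B = norm_const d (tail_deg k + Suc q) k"
  have p: "A > 0" "B > 0" "l > 0" "J > 0"
    using norm_const_pos[OF d k] geg_param_pos[OF d] jacobi_pos[OF d k] by (simp_all only: A_def B_def l_def J_def)
  define u v where "u = real q + l" and "v = real q + 1 + l"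
  have uv: "u > 0" "v > 0" "u \<le> v" using p by (auto simp: u_def v_def)
  have J2: "J * J = (real q + 1) * (real q + 2 * l) / (4 * (u * v))"
  proof -
    have "J = A * (real q + 1) / (B * (2 * u))"
      unfolding J_def A_def B_def l_def u_def jacobi_def ..
    moreover have "J = B * (real q + 2 * l) / (A * (2 * v))"
      unfolding J_def A_def B_def l_def v_def by (rule jacobi_alt[OF d k])
    ultimately have "J * J = (A * (real q + 1) / (B * (2 * u))) * (B * (real q + 2 * l) / (A * (2 * v)))"
      by (rule arg_cong2)
    moreover have "A * r / (B * (2 * u)) * (B * s / (A * (2 * v))) = r * s / (4 * (u * v))" for r s
      using p uv by (simp add: field_simps)
    ultimately show ?thesis by (simp only:)
  qed
  have "1 - 4 * (J * J) = l * (l - 1) / (u * v)"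
  proof -
    have "u * v - (real q + 1) * (real q + 2 * l) = l * (l - 1)" by (simp add: u_def v_def algebra_simps)
    moreover have "1 - 4 * (J * J) = (u * v - (real q + 1) * (real q + 2 * l)) / (u * v)"
      using uv unfolding J2 by (simp add: field_simps)
    ultimately show ?thesis by simp
  qed
  then have "(1 - 2 * J) * (1 + 2 * J) = l * (l - 1) / (u * v)" by (simp add: algebra_simps)
  then have "\<bar>(1 - 2 * J) * (1 + 2 * J)\<bar> = \<bar>l * (l - 1) / (u * v)\<bar>" by (simp only:)
  then have "\<bar>1 - 2 * J\<bar> * (1 + 2 * J) = l * \<bar>l - 1\<bar> / (u * v)"
    using p uv by (simp add: abs_mult)
  moreover have "\<bar>1 - 2 * J\<bar> * 1 \<le> \<bar>1 - 2 * J\<bar> * (1 + 2 * J)" using p by (intro mult_left_mono) auto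
  moreover have "l * \<bar>l - 1\<bar> / (u * v) \<le> l * \<bar>l - 1\<bar> / (u * u)"
    using p uv by (intro divide_left_mono mult_left_mono) auto
  ultimately have "\<bar>1 - 2 * J\<bar> \<le> l * \<bar>l - 1\<bar> / u\<^sup>2" by (simp add: power2_eq_square)
  moreover have "\<bar>J - 1 / 2\<bar> \<le> \<bar>1 - 2 * J\<bar>" by (simp add: abs_if)
  ultimately show ?thesis unfolding J_def l_def u_def by linarith
qed

definition tail_solid :: "nat \<Rightarrow> int list \<Rightarrow> real vec \<Rightarrow> complex" where
  "tail_solid d k = solid (level_deg d (tail_deg k) k) (d - 3)"

text \<open>All members of a chain share the factor \<open>tail_solid d k\<close>, so that
  multiplication by the last coordinate concerns the top Gegenbauer polynomial alone. On the sphere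
  its second argument, the full squared norm, is 1.\<close>

lemma ysol_eq:
  assumes d: "d \<ge> 3" and x: "x \<in> sphere_vec d"
  shows "ysol d k q x = of_real (norm_const d (tail_deg k + q) k * hgeg (geg_param d k) q (x $ (d - 1)) 1) * tail_solid d k x"
proof -
  define m where "m = d - 3"
  have m: "d - 2 = Suc m" "d - 3 = m" "d - 1 = Suc (Suc m)" using d by (auto simp: m_def)
  have ld: "level_deg d n k m = k ! 0" for n using level_deg_tail[of m d n k] m by simp
  have s: "solid (level_deg d (tail_deg k + q) k) m = tail_solid d k"
    unfolding tail_solid_def m(2) by (rule solid_cong) (use m in \<open>simp add: level_deg_tail\<close>)
  have top: "level_deg d (tail_deg k + q) k (Suc m) = int (tail_deg k + q)" using level_deg_top[of d] m by simp
  have par: "of_int \<bar>k ! 0\<bar> + (real m + 1) / 2 = geg_param d k"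
    using m d by (simp add: geg_param_def tail_deg_def)
  have q: "nat (int (tail_deg k + q) - \<bar>k ! 0\<bar>) = q" by (simp add: tail_deg_def)
  have sq: "sq_upto (Suc (Suc m)) x = 1" using sq_upto_sphere[OF _ x] d m by simp
  show ?thesis
    unfolding ysol_def m(1) m(3) solid.simps ld s top par q sq by (simp add: mult.assoc)
qed

lemma ysol_recurrence:
  assumes d: "d \<ge> 3" and k: "k \<in> tail_indices d" and x: "x \<in> sphere_vec d"
  shows "of_real (x $ (d - 1)) * ysol d k q x = of_real (jacobi d k q) * ysol d k (Suc q) x
    + (if q = 0 then 0 else of_real (jacobi d k (q - 1)) * ysol d k (q - 1) x)"
proof -
  define A where "A q = norm_const d (tail_deg k + q) k" for q
  define l z where "l = geg_param d k" and "z = x $ (d - 1)"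
  have A: "A q > 0" for q unfolding A_def by (rule norm_const_pos[OF d k])
  have l: "l > 0" unfolding l_def by (rule geg_param_pos[OF d])
  have c: "x / (A q * y) * A q = x / y" for x y q using A[of q] by simp
  have J: "jacobi d k q * A (Suc q) = A q * (real q + 1) / (2 * (real q + l))" for q
    unfolding jacobi_def A_def[symmetric] l_def[symmetric] by (simp only: c)
  have J': "jacobi d k q * A q = A (Suc q) * (real q + 2 * l) / (2 * (real q + 1 + l))" for q
    unfolding jacobi_alt[OF d k] A_def[symmetric] l_def[symmetric] by (simp only: c)
  have "z * (A q * hgeg l q z 1) = jacobi d k q * (A (Suc q) * hgeg l (Suc q) z 1)
      + (if q = 0 then 0 else jacobi d k (q - 1) * (A (q - 1) * hgeg l (q - 1) z 1))"
  proof (cases q)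
    case 0
    have "jacobi d k q * (A (Suc q) * hgeg l (Suc q) z 1) = jacobi d k q * A (Suc q) * hgeg l (Suc q) z 1" by simp
    also have "\<dots> = z * (A q * hgeg l q z 1)" unfolding J using l by (simp add: 0)
    finally have e: "jacobi d k q * (A (Suc q) * hgeg l (Suc q) z 1) = z * (A q * hgeg l q z 1)" .
    show ?thesis unfolding e using 0 by simp
  next
    case (Suc p)
    define N where "N = 2 * (real p + 1 + l)"
    have N: "N > 0" using l by (simp add: N_def)
    have 1: "jacobi d k q * A (Suc q) = A q * (real p + 2) / N"
      unfolding J by (simp add: Suc N_def add_ac)
    have 2: "jacobi d k p * A p = A q * (real p + 2 * l) / N"
      unfolding J' by (simp add: Suc N_def)
    have "jacobi d k q * (A (Suc q) * hgeg l (Suc q) z 1) + jacobi d k p * (A p * hgeg l p z 1)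
        = (jacobi d k q * A (Suc q)) * hgeg l (Suc q) z 1 + (jacobi d k p * A p) * hgeg l p z 1" by simp
    also have "\<dots> = A q * ((real p + 2) * hgeg l (Suc (Suc p)) z 1 + (real p + 2 * l) * 1 * hgeg l p z 1) / N"
    proof -
      have "a * r / N * h + a * s / N * h' = a * (r * h + s * 1 * h') / N" for a r s h h' :: real
        by (simp add: add_divide_distrib distrib_left)
      then show ?thesis unfolding 1 2 unfolding Suc .
    qed
    also have "\<dots> = A q * (N * z * hgeg l q z 1) / N"
      unfolding hgeg_recurrence[symmetric] by (simp only: N_def Suc)
    also have "\<dots> = z * (A q * hgeg l q z 1)" using N by simp
    finally have e: "jacobi d k q * (A (Suc q) * hgeg l (Suc q) z 1) + jacobi d k p * (A p * hgeg l p z 1)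
        = z * (A q * hgeg l q z 1)" .
    have "q \<noteq> 0" "q - 1 = p" by (simp_all add: Suc)
    then show ?thesis using e by (simp only: if_False)
  qed
  then have "complex_of_real (z * (A q * hgeg l q z 1)) * tail_solid d k x
      = of_real (jacobi d k q * (A (Suc q) * hgeg l (Suc q) z 1)
      + (if q = 0 then 0 else jacobi d k (q - 1) * (A (q - 1) * hgeg l (q - 1) z 1))) * tail_solid d k x"
    by (simp only:)
  then show ?thesis
    unfolding ysol_eq[OF d x] A_def[symmetric] l_def[symmetric] z_def[symmetric]
    by (simp add: mult.assoc distrib_right)
qed

section \<open>Orthogonality relations and Parseval's identity\<close>

lemma pfun_ysol: "d \<ge> 3 \<Longrightarrow> k \<in> tail_indices d \<Longrightarrow> pfun d (ysol d k q)"
proof -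
  assume d: "d \<ge> 3" and k: "k \<in> tail_indices d"
  have "k \<in> indices d (tail_deg k + q)" using indices_iff[OF d] k by simp
  then have "pfun d (solid (level_deg d (tail_deg k + q) k) (d - 2))"
    using d by (intro pfun_solid admissible_level_deg) auto
  then have "pfun d (\<lambda>x. of_real (norm_const d (tail_deg k + q) k) * solid (level_deg d (tail_deg k + q) k) (d - 2) x)"
    by (intro pfun.mult pfun.const)
  then show ?thesis by (simp add: ysol_def[abs_def])
qed

lemma ysol_orthogonal:
  assumes d: "d \<ge> 3" and k: "k \<in> tail_indices d" "k' \<in> tail_indices d" and ne: "(k, q) \<noteq> (k', q')"
  shows "(LINT x|sphere_measure d. ysol d k q x * cnj (ysol d k' q' x)) = 0"
proof -
  have i: "k \<in> indices d (tail_deg k + q)" "k' \<in> indices d (tail_deg k' + q')" using indices_iff[OF d] k by auto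
  define \<kappa> \<kappa>' where "\<kappa> = level_deg d (tail_deg k + q) k" and "\<kappa>' = level_deg d (tail_deg k' + q') k'"
  have ex: "\<exists>m\<le>d - 2. \<kappa> m \<noteq> \<kappa>' m"
  proof (rule ccontr)
    assume "\<not> (\<exists>m\<le>d - 2. \<kappa> m \<noteq> \<kappa>' m)"
    then have "\<forall>m\<le>d - 2. level_deg d (tail_deg k + q) k m = level_deg d (tail_deg k' + q') k' m"
      by (simp add: \<kappa>_def \<kappa>'_def)
    from level_deg_inj[OF i this] show False using ne by auto
  qed
  have "(LINT x|sphere_measure d. solid \<kappa> (d - 2) x * cnj (solid \<kappa>' (d - 2) x) * 1) = 0"
    using d i ex by (intro solid_orthogonal rot_inv_const) (auto simp: \<kappa>_def \<kappa>'_def admissible_level_deg)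
  then have z: "(LINT x|sphere_measure d. solid \<kappa> (d - 2) x * cnj (solid \<kappa>' (d - 2) x)) = 0" by simp
  have "(LINT x|sphere_measure d. ysol d k q x * cnj (ysol d k' q' x))
      = (LINT x|sphere_measure d. (of_real (norm_const d (tail_deg k + q) k) * of_real (norm_const d (tail_deg k' + q') k'))
        * (solid \<kappa> (d - 2) x * cnj (solid \<kappa>' (d - 2) x)))"
    by (intro Bochner_Integration.integral_cong refl) (simp add: ysol_def \<kappa>_def \<kappa>'_def mult_ac)
  also have "\<dots> = 0" unfolding integral_mult_right_zero z by simp
  finally show ?thesis .
qed

text \<open>The weight of the chain \<open>k\<close> in Parseval's identity. It is read off at the
  lowest degree; \<open>ysol_norm\<close> carries it to the other members.\<close>

definition ynorm :: "nat \<Rightarrow> int list \<Rightarrow> real" where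
  "ynorm d k = (LINT x|sphere_measure d. (cmod (ysol d k 0 x))\<^sup>2)"

lemma ynorm_nonneg: "ynorm d k \<ge> 0"
  by (simp add: ynorm_def)

lemma integral_norm_sq:
  "(LINT x|M. f x * cnj (f x)) = complex_of_real (LINT x|M. (cmod (f x))\<^sup>2)"
proof -
  have "(LINT x|M. f x * cnj (f x)) = (LINT x|M. complex_of_real ((cmod (f x))\<^sup>2))"
    by (intro Bochner_Integration.integral_cong refl) (simp only: complex_norm_square)
  then show ?thesis by (simp only: integral_complex_of_real)
qed

text \<open>All functions with the same tail have the same norm: the multiplication by the last coordinate
  is symmetric, and in both directions the coefficient between consecutive degrees is the same.\<close>
lemma ysol_norm:
  assumes d: "d \<ge> 3" and k: "k \<in> tail_indices d"
  shows "(LINT x|sphere_measure d. ysol d k q x * cnj (ysol d k q x)) = of_real (ynorm d k)"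
proof (induction q)
  case 0
  show ?case unfolding ynorm_def by (rule integral_norm_sq)
next
  case (Suc q)
  define I where "I f = (LINT x|sphere_measure d. f x)" for f :: "real vec \<Rightarrow> complex"
  define Y where "Y = ysol d k"
  have pf: "pfun d (Y q)" for q unfolding Y_def by (rule pfun_ysol[OF d k])
  have orth: "I (\<lambda>x. Y q x * cnj (Y q' x)) = 0" if "q \<noteq> q'" for q q'
    unfolding I_def Y_def using that by (intro ysol_orthogonal d k) auto
  have int: "integrable (sphere_measure d) (\<lambda>x. c * (Y q x * cnj (Y q' x)))" for c q q'
    using d pf by (intro pfun_integrable pfun.mult pfun_cnj pfun.const) auto
  have "I (\<lambda>x. of_real (x $ (d - 1)) * Y q x * cnj (Y (Suc q) x))
      = I (\<lambda>x. of_real (jacobi d k q) * (Y (Suc q) x * cnj (Y (Suc q) x))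
        + (if q = 0 then 0 else of_real (jacobi d k (q - 1))) * (Y (q - 1) x * cnj (Y (Suc q) x)))"
    unfolding I_def Y_def
  proof (intro Bochner_Integration.integral_cong refl)
    fix x assume "x \<in> space (sphere_measure d)"
    then have x: "x \<in> sphere_vec d" by simp
    show "of_real (x $ (d - 1)) * ysol d k q x * cnj (ysol d k (Suc q) x)
      = of_real (jacobi d k q) * (ysol d k (Suc q) x * cnj (ysol d k (Suc q) x))
        + (if q = 0 then 0 else of_real (jacobi d k (q - 1))) * (ysol d k (q - 1) x * cnj (ysol d k (Suc q) x))"
      unfolding ysol_recurrence[OF d k x] by (simp add: distrib_right mult.assoc)
  qed
  also have "\<dots> = I (\<lambda>x. of_real (jacobi d k q) * (Y (Suc q) x * cnj (Y (Suc q) x)))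
      + I (\<lambda>x. (if q = 0 then 0 else of_real (jacobi d k (q - 1))) * (Y (q - 1) x * cnj (Y (Suc q) x)))"
    unfolding I_def by (intro Bochner_Integration.integral_add int)
  also have "\<dots> = of_real (jacobi d k q) * I (\<lambda>x. Y (Suc q) x * cnj (Y (Suc q) x))"
    using orth[of "q - 1" "Suc q"] unfolding I_def integral_mult_right_zero by simp
  finally have 1: "I (\<lambda>x. of_real (x $ (d - 1)) * Y q x * cnj (Y (Suc q) x))
      = of_real (jacobi d k q) * I (\<lambda>x. Y (Suc q) x * cnj (Y (Suc q) x))" .
  have c: "of_real (x $ (d - 1)) * cnj (Y (Suc q) x)
      = of_real (jacobi d k (Suc q)) * cnj (Y (Suc (Suc q)) x) + of_real (jacobi d k q) * cnj (Y q x)"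
    if "x \<in> sphere_vec d" for x
    using arg_cong[OF ysol_recurrence[OF d k that, of "Suc q"], of cnj] by (simp add: Y_def)
  have "I (\<lambda>x. of_real (x $ (d - 1)) * Y q x * cnj (Y (Suc q) x))
      = I (\<lambda>x. of_real (jacobi d k (Suc q)) * (Y q x * cnj (Y (Suc (Suc q)) x))
        + of_real (jacobi d k q) * (Y q x * cnj (Y q x)))"
    unfolding I_def
  proof (intro Bochner_Integration.integral_cong refl)
    fix x assume "x \<in> space (sphere_measure d)"
    then have x: "x \<in> sphere_vec d" by simp
    have "of_real (x $ (d - 1)) * Y q x * cnj (Y (Suc q) x) = Y q x * (of_real (x $ (d - 1)) * cnj (Y (Suc q) x))"
      by (simp only: mult_ac)
    then show "of_real (x $ (d - 1)) * Y q x * cnj (Y (Suc q) x)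
      = of_real (jacobi d k (Suc q)) * (Y q x * cnj (Y (Suc (Suc q)) x)) + of_real (jacobi d k q) * (Y q x * cnj (Y q x))"
      unfolding c[OF x] by (simp only: distrib_left mult_ac)
  qed
  also have "\<dots> = I (\<lambda>x. of_real (jacobi d k (Suc q)) * (Y q x * cnj (Y (Suc (Suc q)) x)))
        + I (\<lambda>x. of_real (jacobi d k q) * (Y q x * cnj (Y q x)))"
    unfolding I_def by (intro Bochner_Integration.integral_add int)
  also have "\<dots> = of_real (jacobi d k q) * I (\<lambda>x. Y q x * cnj (Y q x))"
    using orth[of q "Suc (Suc q)"] unfolding I_def integral_mult_right_zero by simp
  finally have 2: "I (\<lambda>x. of_real (x $ (d - 1)) * Y q x * cnj (Y (Suc q) x))
      = of_real (jacobi d k q) * I (\<lambda>x. Y q x * cnj (Y q x))" .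
  from trans[OF 1[symmetric] 2] have "I (\<lambda>x. Y (Suc q) x * cnj (Y (Suc q) x)) = I (\<lambda>x. Y q x * cnj (Y q x))"
    using jacobi_pos[OF d k, of q] by simp
  then show ?case using Suc unfolding I_def Y_def by simp
qed

lemma ysol_parseval:
  assumes d: "d \<ge> 3" and P: "finite P" "fst ` P \<subseteq> tail_indices d"
    and f: "\<And>x. x \<in> sphere_vec d \<Longrightarrow> f x = (\<Sum>(k, q)\<in>P. a (k, q) * ysol d k q x)"
    and g: "\<And>x. x \<in> sphere_vec d \<Longrightarrow> g x = (\<Sum>(k, q)\<in>P. b (k, q) * ysol d k q x)"
  shows "(LINT x|sphere_measure d. f x * cnj (g x)) = (\<Sum>(k, q)\<in>P. a (k, q) * cnj (b (k, q)) * of_real (ynorm d k))"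
proof -
  define Y where "Y p = ysol d (fst p) (snd p)" for p
  have pf: "pfun d (Y p)" if "p \<in> P" for p unfolding Y_def using P that by (intro pfun_ysol d) auto
  have "(LINT x|sphere_measure d. f x * cnj (g x))
      = (LINT x|sphere_measure d. (\<Sum>p\<in>P. \<Sum>p'\<in>P. a p * cnj (b p') * (Y p x * cnj (Y p' x))))"
  proof (intro Bochner_Integration.integral_cong refl)
    fix x assume "x \<in> space (sphere_measure d)"
    then have x: "x \<in> sphere_vec d" by simp
    have "f x = (\<Sum>p\<in>P. a p * Y p x)" "g x = (\<Sum>p\<in>P. b p * Y p x)"
      unfolding f[OF x] g[OF x] Y_def by (simp_all add: case_prod_beta)
    then show "f x * cnj (g x) = (\<Sum>p\<in>P. \<Sum>p'\<in>P. a p * cnj (b p') * (Y p x * cnj (Y p' x)))"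
      by (simp add: sum_product mult_ac)
  qed
  also have "\<dots> = (\<Sum>p\<in>P. \<Sum>p'\<in>P. LINT x|sphere_measure d. a p * cnj (b p') * (Y p x * cnj (Y p' x)))"
  proof -
    have "integrable (sphere_measure d) (\<lambda>x. a p * cnj (b p') * (Y p x * cnj (Y p' x)))" if "p \<in> P" "p' \<in> P" for p p'
      using d pf[OF that(1)] pf[OF that(2)] by (intro pfun_integrable pfun.mult pfun_cnj pfun.const) auto
    then show ?thesis
      by (subst Bochner_Integration.integral_sum) (auto intro!: sum.cong Bochner_Integration.integral_sum Bochner_Integration.integrable_sum)
  qed
  also have "\<dots> = (\<Sum>p\<in>P. \<Sum>p'\<in>P. if p' = p then a p * cnj (b p) * of_real (ynorm d (fst p)) else 0)"
  proof (intro sum.cong refl)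
    fix p p' assume p: "p \<in> P" "p' \<in> P"
    then have t: "fst p \<in> tail_indices d" "fst p' \<in> tail_indices d" using P by auto
    show "(LINT x|sphere_measure d. a p * cnj (b p') * (Y p x * cnj (Y p' x)))
        = (if p' = p then a p * cnj (b p) * of_real (ynorm d (fst p)) else 0)"
    proof (cases "p' = p")
      case True
      then show ?thesis unfolding integral_mult_right_zero Y_def using ysol_norm[OF d t(1), of "snd p"] by simp
    next
      case False
      then have "(LINT x|sphere_measure d. Y p x * cnj (Y p' x)) = 0"
        unfolding Y_def by (intro ysol_orthogonal d t) (auto simp: prod_eq_iff)
      then show ?thesis unfolding integral_mult_right_zero using False by simp
    qed
  qed
  also have "\<dots> = (\<Sum>p\<in>P. a p * cnj (b p) * of_real (ynorm d (fst p)))"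
    using P(1) by (intro sum.cong refl) simp
  finally show ?thesis by (simp add: case_prod_beta)
qed

lemma coefficient_ysol:
  assumes d: "d \<ge> 3" and k: "k \<in> tail_indices d"
  shows "coefficient d f (int (tail_deg k + q)) k = (LINT x|sphere_measure d. f x * cnj (ysol d k q x))"
proof -
  have i: "k \<in> indices d (tail_deg k + q)" using indices_iff[OF d] k by simp
  have n: "nat (int (tail_deg k + q)) = tail_deg k + q" by (rule nat_int)
  have "coefficient d f (int (tail_deg k + q)) k = inner_sphere d f (sph_harm d (tail_deg k + q) k)"
    unfolding coefficient_def n using i by simp
  also have "\<dots> = (LINT x|sphere_measure d. f x * cnj (ysol d k q x))"
    unfolding inner_sphere_def
    by (intro Bochner_Integration.integral_cong refl) (simp add: ysol_def sph_harm_solid[OF d i])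
  finally show ?thesis .
qed

section \<open>Polynomials on the sphere\<close>

lemma homogeneous_poly_hpoly:
  assumes "homogeneous_poly d n p"
  shows "\<exists>f. hpoly {..<d} n f \<and> (\<forall>x\<in>carrier_vec d. p x = f x)"
proof -
  obtain c where c: "\<forall>x \<in> carrier_vec d. p x = (\<Sum>a | a \<in> {..<d} \<rightarrow>\<^sub>E {..n} \<and> (\<Sum>i<d. a i) = n.
                 c a * of_real (\<Prod>i<d. (x $ i) ^ a i))"
    using assms unfolding homogeneous_poly_def by blast
  let ?A = "{a. a \<in> {..<d} \<rightarrow>\<^sub>E {..n} \<and> (\<Sum>i<d. a i) = n}"
  have "hpoly {..<d} n (\<lambda>x. \<Sum>a\<in>?A. c a * of_real (\<Prod>i<d. (x $ i) ^ a i))"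
  proof (rule hpoly_sum)
    fix a assume a: "a \<in> ?A"
    have "hpoly {..<d} (\<Sum>i<d. a i * 1) (\<lambda>x. \<Prod>i<d. of_real (x $ i) ^ a i)"
      by (intro hpoly_prod hpoly_power hpoly_coord) auto
    then have "hpoly {..<d} n (\<lambda>x. of_real (\<Prod>i<d. (x $ i) ^ a i))" using a by simp
    then show "hpoly {..<d} n (\<lambda>x. c a * of_real (\<Prod>i<d. (x $ i) ^ a i))" by (rule hpoly_scale)
  qed
  with c show ?thesis by (intro exI conjI)
qed

lemma harmonics_hpoly:
  assumes "Y \<in> harmonics d n"
  shows "\<exists>f. hpoly {..<d} n f \<and> (\<forall>x\<in>sphere_vec d. Y x = f x)"
proof -
  obtain p where p: "homogeneous_poly d n p" "\<forall>x\<in>sphere_vec d. Y x = p x"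
    using assms unfolding harmonics_def by blast
  obtain f where "hpoly {..<d} n f" "\<forall>x\<in>carrier_vec d. p x = f x"
    using homogeneous_poly_hpoly[OF p(1)] by blast
  then show ?thesis using p(2) sphere_vec_carrier by (intro exI[of _ f]) auto
qed

lemma sphere_polys_hpoly:
  assumes "f \<in> sphere_polys d N"
  shows "\<exists>F. (\<forall>n\<le>N. hpoly {..<d} n (F n)) \<and> (\<forall>x\<in>sphere_vec d. f x = (\<Sum>n\<le>N. F n x))"
proof -
  obtain h where h: "\<forall>n\<le>N. h n \<in> harmonics d n" "\<forall>x\<in>sphere_vec d. f x = (\<Sum>n\<le>N. h n x)"
    using assms unfolding sphere_polys_def by blast
  have "\<exists>F. hpoly {..<d} n F \<and> (\<forall>x\<in>sphere_vec d. h n x = F x)" if "n \<le> N" for n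
    using h(1) that by (intro harmonics_hpoly) simp
  then have "\<forall>n\<in>{..N}. \<exists>F. hpoly {..<d} n F \<and> (\<forall>x\<in>sphere_vec d. h n x = F x)" by simp
  from bchoice[OF this] obtain F where
    "\<forall>n\<in>{..N}. hpoly {..<d} n (F n) \<and> (\<forall>x\<in>sphere_vec d. h n x = F n x)" ..
  then show ?thesis using h(2) by (intro exI[of _ F]) simp
qed

text \<open>\<open>S\<close> records which tails and which positions in their chains occur. Equality
  is asked on the sphere only, where powers of the squared norm may be dropped.\<close>

definition expandable :: "nat \<Rightarrow> (int list \<times> nat) set \<Rightarrow> (real vec \<Rightarrow> complex) \<Rightarrow> bool" where
  "expandable d S f \<longleftrightarrow> (\<exists>g\<in>lin_span ((\<lambda>(k, q). ysol d k q) ` S). \<forall>x\<in>sphere_vec d. f x = g x)"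

lemma expandable_ysol: "(k, q) \<in> S \<Longrightarrow> expandable d S (ysol d k q)"
proof -
  assume "(k, q) \<in> S"
  then have "ysol d k q \<in> (\<lambda>(k, q). ysol d k q) ` S" by (rule image_eqI[rotated]) simp
  from lin_span_base[OF this] show ?thesis unfolding expandable_def by (rule bexI[rotated]) simp
qed

lemma expandable_mono: "expandable d S f \<Longrightarrow> S \<subseteq> T \<Longrightarrow> expandable d T f"
  unfolding expandable_def using lin_span_mono[of _ "(\<lambda>(k, q). ysol d k q) ` S" "(\<lambda>(k, q). ysol d k q) ` T"]
  by (meson image_mono)

lemma expandable_cong: "expandable d S f \<Longrightarrow> (\<And>x. x \<in> sphere_vec d \<Longrightarrow> g x = f x) \<Longrightarrow> expandable d S g"
  unfolding expandable_def by auto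

lemma expandable_zero: "expandable d S (\<lambda>x. 0)"
  unfolding expandable_def by (intro bexI[of _ "\<lambda>x. 0"] lin_span.zero) auto

lemma expandable_add:
  assumes "expandable d S f" "expandable d S g" shows "expandable d S (\<lambda>x. f x + g x)"
proof -
  obtain f' g' where f': "f' \<in> lin_span ((\<lambda>(k, q). ysol d k q) ` S)" "\<forall>x\<in>sphere_vec d. f x = f' x"
    and g': "g' \<in> lin_span ((\<lambda>(k, q). ysol d k q) ` S)" "\<forall>x\<in>sphere_vec d. g x = g' x"
    using assms unfolding expandable_def by blast
  show ?thesis unfolding expandable_def
    by (rule bexI[OF _ lin_span_add[OF f'(1) g'(1)]]) (use f'(2) g'(2) in simp)
qed

lemma expandable_scale:
  assumes "expandable d S f" shows "expandable d S (\<lambda>x. c * f x)"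
proof -
  obtain f' where f': "f' \<in> lin_span ((\<lambda>(k, q). ysol d k q) ` S)" "\<forall>x\<in>sphere_vec d. f x = f' x"
    using assms unfolding expandable_def by blast
  show ?thesis unfolding expandable_def
    by (rule bexI[OF _ lin_span_scale[OF f'(1), of c]]) (use f'(2) in simp)
qed

lemma expandable_lin_span:
  assumes "f \<in> lin_span G" "\<And>g. g \<in> G \<Longrightarrow> expandable d S g" shows "expandable d S f"
  using assms(1)
proof (induction rule: lin_span.induct)
  case (step f g c)
  show ?case by (rule expandable_add[OF expandable_scale[OF assms(2)[OF step(1)]] step(3)])
qed (rule expandable_zero)

lemma expandable_sum:
  "(\<And>a. a \<in> A \<Longrightarrow> expandable d S (f a)) \<Longrightarrow> expandable d S (\<lambda>x. \<Sum>a\<in>A. f a x)"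
  by (induction A rule: infinite_finite_induct) (auto intro: expandable_zero expandable_add)

lemma expandable_finite:
  assumes "expandable d S f"
  shows "\<exists>P a. finite P \<and> P \<subseteq> S \<and> (\<forall>x\<in>sphere_vec d. f x = (\<Sum>(k, q)\<in>P. a (k, q) * ysol d k q x))"
proof -
  obtain g where g: "g \<in> lin_span ((\<lambda>(k, q). ysol d k q) ` S)" "\<forall>x\<in>sphere_vec d. f x = g x"
    using assms unfolding expandable_def by blast
  obtain P a where P: "finite P" "P \<subseteq> S" "g = (\<lambda>x. \<Sum>p\<in>P. a p * (case p of (k, q) \<Rightarrow> ysol d k q) x)"
    using lin_span_finite[OF g(1)] by blast
  then have "\<forall>x\<in>sphere_vec d. f x = (\<Sum>(k, q)\<in>P. a (k, q) * ysol d k q x)"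
    using g(2) by (simp add: case_prod_beta)
  then show ?thesis using P by blast
qed

text \<open>On the sphere the power of the squared norm is 1, and the harmonic that remains is a
  multiple of a member of a chain with tail degree |\<kappa> m|, at most \<open>K\<close>.\<close>

lemma solid_gens_upto_expandable:
  assumes d: "d = m + 3" and f: "f \<in> solid_gens_upto m K D"
  shows "expandable d {(k, q). k \<in> tail_indices d \<and> tail_deg k \<le> K \<and> tail_deg k + q \<le> D} f"
proof -
  have d3: "d \<ge> 3" and dd: "d - 2 = Suc m" "d - 3 = m" "d - 1 = Suc (Suc m)" using d by simp_all
  obtain i \<kappa> where h: "admissible (Suc m) \<kappa>" "nat \<bar>\<kappa> m\<bar> \<le> K" "2 * i + nat \<bar>\<kappa> (Suc m)\<bar> = D"
    "f = (\<lambda>x. of_real (sq_upto (Suc (Suc m)) x) ^ i * solid \<kappa> (Suc m) x)"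
    using f unfolding solid_gens_upto_def by blast
  define n where "n = nat (\<kappa> (Suc m))"
  have "\<exists>k\<in>indices d (nat (\<kappa> (d - 2))). \<forall>j\<le>d - 2. level_deg d (nat (\<kappa> (d - 2))) k j = \<kappa> j"
    using level_deg_exists[OF d3] h(1) unfolding dd by blast
  then obtain k where k: "k \<in> indices d n" "\<And>j. j \<le> Suc m \<Longrightarrow> level_deg d n k j = \<kappa> j"
    unfolding dd n_def by blast
  have kt: "k \<in> tail_indices d" "tail_deg k \<le> n" using k(1) indices_iff[OF d3] by auto
  have "\<kappa> m = k ! 0" using k(2)[of m] level_deg_tail[of m d n k] dd by simp
  then have td: "tail_deg k = nat \<bar>\<kappa> m\<bar>" by (simp add: tail_deg_def)
  define q where "q = n - tail_deg k"
  have q: "tail_deg k + q = n" using kt by (simp add: q_def)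
  have s: "solid \<kappa> (Suc m) = solid (level_deg d n k) (Suc m)"
    by (rule solid_cong) (simp add: k(2))
  define c where "c = complex_of_real (norm_const d n k)"
  have c: "c \<noteq> 0" using norm_const_pos[OF d3 kt(1), of q] by (simp add: c_def q)
  have y: "f x = (1 / c) * ysol d k q x" if "x \<in> sphere_vec d" for x
  proof -
    have "sq_upto (Suc (Suc m)) x = 1" using sq_upto_sphere[OF _ that] d dd by simp
    then show ?thesis using c unfolding h(4) s ysol_def q c_def[symmetric] dd by simp
  qed
  have "n \<le> D" using h(3) by (simp add: n_def)
  then have "(k, q) \<in> {(k, q). k \<in> tail_indices d \<and> tail_deg k \<le> K \<and> tail_deg k + q \<le> D}" (is "_ \<in> ?S")
    using kt h(2) td q by simp
  then have "expandable d ?S (\<lambda>x. (1 / c) * ysol d k q x)" by (intro expandable_scale expandable_ysol)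
  then show ?thesis by (rule expandable_cong) (rule y)
qed

lemma hpoly_expandable:
  assumes d: "d \<ge> 3" and f: "hpoly {..<d} n f"
  shows "expandable d {(k, q). k \<in> tail_indices d \<and> tail_deg k + q \<le> n} f"
proof -
  define m where "m = d - 3"
  have m: "d = m + 3" "{..<d} = {..Suc (Suc m)}" using d by (auto simp: m_def)
  have "f \<in> lin_span {f. \<exists>j e h. j + e = n \<and> hpoly {..Suc m} e h \<and> f = (\<lambda>x. of_real (x $ Suc (Suc m)) ^ j * h x)}"
    using f unfolding m(2) by (rule hpoly_split_last)
  then show ?thesis
  proof (rule expandable_lin_span)
    fix f assume "f \<in> {f. \<exists>j e h. j + e = n \<and> hpoly {..Suc m} e h \<and> f = (\<lambda>x. of_real (x $ Suc (Suc m)) ^ j * h x)}"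
    then obtain j e h where h: "j + e = n" "hpoly {..Suc m} e h" "f = (\<lambda>x. of_real (x $ Suc (Suc m)) ^ j * h x)" by blast
    have "f \<in> lin_span (solid_gens_upto m e (j + e))"
      unfolding h(3) by (rule coord_power_solid_gens[OF hpoly_solid_gens[OF h(2)]])
    then show "expandable d {(k, q). k \<in> tail_indices d \<and> tail_deg k + q \<le> n} f"
      by (rule expandable_lin_span)
        (rule expandable_mono[OF solid_gens_upto_expandable[OF m(1)]], use h(1) in auto)
  qed
qed

section \<open>Rotations and trigonometric polynomials\<close>

lemma SO_carrier: "g \<in> SO m \<Longrightarrow> g \<in> carrier_mat m m"
  by (simp add: SO_def)

lemma rotate_vec_coord:
  assumes "g \<in> carrier_mat m m" "x \<in> carrier_vec m" "i < m"
  shows "(g\<^sup>T *\<^sub>v x) $ i = (\<Sum>j<m. g $$ (j, i) * x $ j)"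
  using assms by (auto simp: scalar_prod_def atLeast0LessThan intro!: sum.cong)

lemma rotate_sphere:
  assumes g: "g \<in> SO m" and x: "x \<in> sphere_vec m"
  shows "g\<^sup>T *\<^sub>v x \<in> sphere_vec m"
proof -
  have gc: "g \<in> carrier_mat m m" "g * g\<^sup>T = 1\<^sub>m m" using g by (auto simp: SO_def)
  have xc: "x \<in> carrier_vec m" using x by (rule sphere_vec_carrier)
  have y: "g\<^sup>T *\<^sub>v x \<in> carrier_vec m" using gc xc by auto
  have "(g\<^sup>T *\<^sub>v x) \<bullet> (g\<^sup>T *\<^sub>v x) = x \<bullet> (g *\<^sub>v (g\<^sup>T *\<^sub>v x))"
    by (rule transpose_vec_mult_scalar[OF gc(1) y xc])
  also have "g *\<^sub>v (g\<^sup>T *\<^sub>v x) = (g * g\<^sup>T) *\<^sub>v x"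
    using gc(1) xc by (intro assoc_mult_mat_vec[symmetric]) auto
  also have "\<dots> = x" using gc xc by simp
  finally show ?thesis using x y by (simp add: sphere_vec_def norm_vec_def)
qed

lemma hpoly_linear:
  assumes "hpoly I D f" and "\<And>i. i \<in> I \<Longrightarrow> hpoly J 1 (s i)"
    and R: "\<And>i x. i \<in> I \<Longrightarrow> x \<in> X \<Longrightarrow> of_real (R x $ i) = s i x"
  shows "\<exists>F. hpoly J D F \<and> (\<forall>x\<in>X. f (R x) = F x)"
  using assms(1)
proof (induction rule: hpoly.induct)
  case (coord i D f)
  then obtain F where F: "hpoly J D F" "\<And>x. x \<in> X \<Longrightarrow> f (R x) = F x" by blast
  have "hpoly J (Suc D) (\<lambda>x. s i x * F x)" using hpoly_mult[OF assms(2)[OF coord(1)] F(1)] by simp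
  then show ?case using F(2) R[OF coord(1)] by (intro exI conjI) auto
next
  case (add D f g)
  then obtain F G where h: "hpoly J D F" "\<And>x. x \<in> X \<Longrightarrow> f (R x) = F x"
    "hpoly J D G" "\<And>x. x \<in> X \<Longrightarrow> g (R x) = G x" by blast
  then show ?case by (intro exI[of _ "\<lambda>x. F x + G x"]) (auto intro: hpoly.add)
qed (auto intro: hpoly.zero hpoly.const)

text \<open>A linear substitution preserves the degree of each homogeneous part, so rotated
  polynomials expand within the same degrees. This handles the members of the frame, which are
  rotations of the given polynomials.\<close>

lemma sphere_polys_rotate_expandable:
  assumes d: "d \<ge> 3" and g: "g \<in> SO d" and f: "f \<in> sphere_polys d N"
  shows "expandable d {(k, q). k \<in> tail_indices d \<and> tail_deg k + q \<le> N} (rotate_fun g f)"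
proof -
  obtain F where F: "\<forall>n\<le>N. hpoly {..<d} n (F n)" "\<forall>x\<in>sphere_vec d. f x = (\<Sum>n\<le>N. F n x)"
    using sphere_polys_hpoly[OF f] by blast
  have E: "expandable d {(k, q). k \<in> tail_indices d \<and> tail_deg k + q \<le> N} (\<lambda>x. F n (g\<^sup>T *\<^sub>v x))" if "n \<le> N" for n
  proof -
    have "\<exists>G. hpoly {..<d} n G \<and> (\<forall>x\<in>carrier_vec d. F n (g\<^sup>T *\<^sub>v x) = G x)"
    proof (rule hpoly_linear)
      show "hpoly {..<d} n (F n)" using F(1) that by simp
      show "hpoly {..<d} 1 (\<lambda>x. \<Sum>j<d. of_real (g $$ (j, i)) * of_real (x $ j))" for i
        by (intro hpoly_sum hpoly_scale hpoly_coord) auto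
      show "of_real ((g\<^sup>T *\<^sub>v x) $ i) = (\<Sum>j<d. of_real (g $$ (j, i)) * complex_of_real (x $ j))"
        if "i \<in> {..<d}" "x \<in> carrier_vec d" for i x
        using that rotate_vec_coord[OF SO_carrier[OF g]] by simp
    qed
    then obtain G where G: "hpoly {..<d} n G" "\<And>x. x \<in> carrier_vec d \<Longrightarrow> F n (g\<^sup>T *\<^sub>v x) = G x" by blast
    have "expandable d {(k, q). k \<in> tail_indices d \<and> tail_deg k + q \<le> N} G"
      using that by (intro expandable_mono[OF hpoly_expandable[OF d G(1)]]) auto
    then show ?thesis by (rule expandable_cong) (use G(2) sphere_vec_carrier in blast)
  qed
  have "expandable d {(k, q). k \<in> tail_indices d \<and> tail_deg k + q \<le> N} (\<lambda>x. \<Sum>n\<le>N. F n (g\<^sup>T *\<^sub>v x))"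
    by (rule expandable_sum) (use E in auto)
  then show ?thesis
    by (rule expandable_cong) (use F(2) rotate_sphere[OF g] in \<open>simp add: rotate_fun_def\<close>)
qed

text \<open>The rotation by the angle \<open>\<gamma>\<close> in the plane of the unit vector \<open>u\<close> and the orthogonal
  coordinate vector \<open>e\<^sub>0\<close>.\<close>
definition circle_rot :: "nat \<Rightarrow> (nat \<Rightarrow> real) \<Rightarrow> real \<Rightarrow> real mat" where
  "circle_rot m u \<gamma> = mat m m (\<lambda>(i, j). (if i = j then 1 else 0)
     + (cos \<gamma> - 1) * (u i * u j + (if i = 0 then 1 else 0) * (if j = 0 then 1 else 0))
     + sin \<gamma> * (u i * (if j = 0 then 1 else 0) - (if i = 0 then 1 else 0) * u j))"

text \<open>The matrix is the identity plus a part of rank two, written with row vectors u, e in the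
  left factor and column vectors u, e in the right one. Orthonormality of u and e reduces the
  product to the addition theorems.\<close>

lemma circle_rot_add:
  assumes m: "m > 0" and u: "u 0 = 0" "(\<Sum>i<m. (u i)\<^sup>2) = 1"
  shows "circle_rot m u \<gamma> * circle_rot m u \<gamma>' = circle_rot m u (\<gamma> + \<gamma>')"
proof (rule eq_matI)
  define e where "e i = (if i = 0 then 1 else 0 :: real)" for i :: nat
  define \<delta> where "\<delta> i j = (if i = j then 1 else 0 :: real)" for i j :: nat
  define \<alpha> where "\<alpha> i = (cos \<gamma> - 1) * u i - sin \<gamma> * e i" for i
  define \<beta> where "\<beta> i = (cos \<gamma> - 1) * e i + sin \<gamma> * u i" for i
  define \<alpha>' where "\<alpha>' j = (cos \<gamma>' - 1) * u j + sin \<gamma>' * e j" for j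
  define \<beta>' where "\<beta>' j = (cos \<gamma>' - 1) * e j - sin \<gamma>' * u j" for j
  fix i j assume "i < dim_row (circle_rot m u (\<gamma> + \<gamma>'))" "j < dim_col (circle_rot m u (\<gamma> + \<gamma>'))"
  then have ij: "i < m" "j < m" by (auto simp: circle_rot_def)
  have c: "circle_rot m u \<gamma> $$ (i, k) = \<delta> i k + \<alpha> i * u k + \<beta> i * e k" if "k < m" for k
    using ij that by (simp add: circle_rot_def \<delta>_def \<alpha>_def \<beta>_def e_def[symmetric] algebra_simps)
  have c': "circle_rot m u \<gamma>' $$ (k, j) = \<delta> k j + u k * \<alpha>' j + e k * \<beta>' j" if "k < m" for k
    using ij that by (simp add: circle_rot_def \<delta>_def \<alpha>'_def \<beta>'_def e_def[symmetric] algebra_simps)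
  have sd: "(\<Sum>k<m. \<delta> i k * f k) = f i" "(\<Sum>k<m. f k * \<delta> k j) = f j" for f
    using ij by (simp_all add: \<delta>_def if_distrib[of "\<lambda>t. _ * t"] if_distrib[of "\<lambda>t. t * _"] cong: if_cong)
  have se: "(\<Sum>k<m. e k * e k) = 1" "(\<Sum>k<m. u k * e k) = 0" "(\<Sum>k<m. e k * u k) = 0" "(\<Sum>k<m. u k * u k) = 1"
    using m u by (simp_all add: e_def power2_eq_square if_distrib[of "\<lambda>t. _ * t"] if_distrib[of "\<lambda>t. t * _"] cong: if_cong)
  have "(circle_rot m u \<gamma> * circle_rot m u \<gamma>') $$ (i, j)
      = (\<Sum>k<m. circle_rot m u \<gamma> $$ (i, k) * circle_rot m u \<gamma>' $$ (k, j))"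
    using ij by (auto simp: circle_rot_def scalar_prod_def atLeast0LessThan intro!: sum.cong)
  also have "\<dots> = (\<Sum>k<m. (\<delta> i k + \<alpha> i * u k + \<beta> i * e k) * (\<delta> k j + u k * \<alpha>' j + e k * \<beta>' j))"
    by (rule sum.cong) (simp_all add: c c')
  also have "\<dots> = (\<Sum>k<m. \<delta> i k * \<delta> k j + (\<delta> i k * u k) * \<alpha>' j + (\<delta> i k * e k) * \<beta>' j
      + \<alpha> i * (u k * \<delta> k j) + \<alpha> i * \<alpha>' j * (u k * u k) + \<alpha> i * \<beta>' j * (u k * e k)
      + \<beta> i * (e k * \<delta> k j) + \<beta> i * \<alpha>' j * (e k * u k) + \<beta> i * \<beta>' j * (e k * e k))"
    by (rule sum.cong) (simp_all add: algebra_simps)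
  also have "\<dots> = \<delta> i j + u i * \<alpha>' j + e i * \<beta>' j + \<alpha> i * u j + \<alpha> i * \<alpha>' j + \<beta> i * e j + \<beta> i * \<beta>' j"
    unfolding sum.distrib sum_distrib_left[symmetric] sum_distrib_right[symmetric] sd se by simp
  also have "\<dots> = \<delta> i j + (cos (\<gamma> + \<gamma>') - 1) * (u i * u j + e i * e j) + sin (\<gamma> + \<gamma>') * (u i * e j - e i * u j)"
    unfolding \<alpha>_def \<beta>_def \<alpha>'_def \<beta>'_def cos_add sin_add by (simp add: algebra_simps)
  also have "\<dots> = circle_rot m u (\<gamma> + \<gamma>') $$ (i, j)"
    using ij by (simp add: circle_rot_def \<delta>_def e_def)
  finally show "(circle_rot m u \<gamma> * circle_rot m u \<gamma>') $$ (i, j) = circle_rot m u (\<gamma> + \<gamma>') $$ (i, j)" .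
qed (auto simp: circle_rot_def)

lemma circle_rot_SO:
  assumes m: "m > 0" and u: "u 0 = 0" "(\<Sum>i<m. (u i)\<^sup>2) = 1"
  shows "circle_rot m u \<gamma> \<in> SO m"
proof -
  have car: "circle_rot m u \<gamma> \<in> carrier_mat m m" for \<gamma> by (simp add: circle_rot_def)
  have one: "circle_rot m u 0 = 1\<^sub>m m" by (rule eq_matI) (auto simp: circle_rot_def)
  have tr: "(circle_rot m u \<gamma>)\<^sup>T = circle_rot m u (- \<gamma>)" for \<gamma>
    by (rule eq_matI) (auto simp: circle_rot_def algebra_simps)
  have inv: "circle_rot m u \<gamma> * (circle_rot m u \<gamma>)\<^sup>T = 1\<^sub>m m" "(circle_rot m u \<gamma>)\<^sup>T * circle_rot m u \<gamma> = 1\<^sub>m m" for \<gamma>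
    unfolding tr circle_rot_add[OF m u] using one by simp_all
  \<comment> \<open>The rotation is the square of the one by half the angle, whose transpose has the
    same determinant and is its inverse. So the determinant is that of the identity.\<close>
  have "det (circle_rot m u \<gamma>) = det (circle_rot m u (\<gamma> / 2)) * det (circle_rot m u (\<gamma> / 2))"
    using det_mult[OF car car, of "\<gamma> / 2" "\<gamma> / 2"] unfolding circle_rot_add[OF m u] by simp
  also have "\<dots> = det (circle_rot m u (\<gamma> / 2) * (circle_rot m u (\<gamma> / 2))\<^sup>T)"
    using car by (subst det_mult[of _ m]) (auto simp: det_transpose[OF car])
  also have "\<dots> = 1" unfolding inv by simp
  finally show ?thesis using car inv by (simp add: SO_def)
qed

section \<open>Matrix coefficients restricted to a circle of rotations\<close>

lemma trig_poly_exp: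
  assumes "nat \<bar>n\<bar> \<le> K"
  shows "trig_poly K (\<lambda>\<gamma>. exp (\<i> * of_int n * of_real \<gamma>))"
proof -
  have "trig_poly (nat \<bar>n\<bar> * 1) (\<lambda>\<gamma>. (of_real (cos \<gamma>) + (of_int (sgn n) * \<i>) * of_real (sin \<gamma>)) ^ nat \<bar>n\<bar>)"
    by (intro trig_poly_power trig_poly_add trig_poly_scale trig_poly_cos trig_poly_sin)
  moreover have "(of_real (cos \<gamma>) + (of_int (sgn n) * \<i>) * of_real (sin \<gamma>)) ^ nat \<bar>n\<bar> = exp (\<i> * of_int n * of_real \<gamma>)" for \<gamma>
  proof -
    have "of_real (cos \<gamma>) + (of_int (sgn n) * \<i>) * of_real (sin \<gamma>) = exp (\<i> * of_int (sgn n) * of_real \<gamma>)"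
      if "n \<noteq> 0"
      using that by (cases "n > 0") (simp_all add: exp_Euler exp_minus_Euler cos_of_real sin_of_real)
    moreover have "exp (\<i> * of_int (sgn n) * of_real \<gamma>) ^ nat \<bar>n\<bar> = exp (\<i> * of_int n * of_real \<gamma>)"
    proof -
      have "of_nat (nat \<bar>n\<bar>) * complex_of_int (sgn n) = of_int n"
        by (cases "n \<ge> 0") (auto simp: sgn_if)
      moreover have "of_nat (nat \<bar>n\<bar>) * (\<i> * of_int (sgn n) * of_real \<gamma>)
          = \<i> * (of_nat (nat \<bar>n\<bar>) * of_int (sgn n)) * of_real \<gamma>" by (simp only: mult_ac)
      ultimately have "of_nat (nat \<bar>n\<bar>) * (\<i> * of_int (sgn n) * of_real \<gamma>) = \<i> * of_int n * of_real \<gamma>"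
        by (simp only:)
      then show ?thesis by (simp only: exp_of_nat_mult[symmetric])
    qed
    ultimately show ?thesis by (cases "n = 0") auto
  qed
  ultimately have "trig_poly (nat \<bar>n\<bar>) (\<lambda>\<gamma>. exp (\<i> * of_int n * of_real \<gamma>))" by simp
  then show ?thesis using assms by (rule trig_poly_mono)
qed

lemma separated_integral:
  assumes "separated m K F" and g: "pfun m g" and m: "m > 0"
  shows "trig_poly K (\<lambda>\<gamma>. LINT x|sphere_measure m. F \<gamma> x * g x) \<and> (\<forall>\<gamma>. pfun m (F \<gamma>))"
  using assms(1)
proof (induction rule: separated.induct)
  case zero
  then show ?case by (auto intro: trig_poly_const pfun.const)
next
  case (step \<tau> h f)
  have pf: "pfun m (\<lambda>x. \<tau> \<gamma> * h x + f \<gamma> x)" for \<gamma>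
    using step by (intro pfun.add pfun.mult pfun.const) auto
  have "(LINT x|sphere_measure m. (\<tau> \<gamma> * h x + f \<gamma> x) * g x)
      = \<tau> \<gamma> * (LINT x|sphere_measure m. h x * g x) + (LINT x|sphere_measure m. f \<gamma> x * g x)" for \<gamma>
  proof -
    have "(LINT x|sphere_measure m. (\<tau> \<gamma> * h x + f \<gamma> x) * g x)
        = (LINT x|sphere_measure m. \<tau> \<gamma> * (h x * g x) + f \<gamma> x * g x)"
      by (simp only: distrib_right mult.assoc)
    also have "\<dots> = (LINT x|sphere_measure m. \<tau> \<gamma> * (h x * g x)) + (LINT x|sphere_measure m. f \<gamma> x * g x)"
      using step g by (intro Bochner_Integration.integral_add pfun_integrable[OF m] pfun.mult pfun.const) auto
    finally show ?thesis by simp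
  qed
  moreover have "trig_poly K (\<lambda>\<gamma>. \<tau> \<gamma> * (LINT x|sphere_measure m. h x * g x) + (LINT x|sphere_measure m. f \<gamma> x * g x))"
    using step trig_poly_scale[OF step(1), of "LINT x|sphere_measure m. h x * g x"]
    by (intro trig_poly_add) (simp_all add: mult.commute)
  ultimately show ?case using pf by simp
qed

text \<open>The matrix entries have degree 1 in the angle, so a rotated harmonic of degree n at most
  \<open>K\<close> has degree at most \<open>K\<close>, also after integration against a second one.
  For m = 2 the unit vector is e_1 or -e_1, and the circle is the whole group, traversed in one of
  its two directions.\<close>

lemma SO_polys_circle_rot:
  assumes m: "m \<ge> 2" and u: "u 0 = 0" "(\<Sum>i<m. (u i)\<^sup>2) = 1" and v: "v \<in> SO_polys m K"
  shows "trig_poly K (\<lambda>\<gamma>. v (circle_rot m u \<gamma>))"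
proof (cases "m = 2")
  case True
  then obtain c where c: "\<And>\<gamma>. v (rotation2 \<gamma>) = (\<Sum>n\<in>{- int K..int K}. c n * exp (\<i> * of_int n * of_real \<gamma>))"
    using v unfolding SO_polys_def by auto
  have "(\<Sum>i<m. (u i)\<^sup>2) = (u 1)\<^sup>2" using u(1) True by (simp add: numeral_2_eq_2)
  then have u1: "u 1 = 1 \<or> u 1 = -1" using u(2) by (simp add: power2_eq_1_iff)
  have "circle_rot m u \<gamma> = rotation2 (u 1 * \<gamma>)" for \<gamma>
  proof (rule eq_matI)
    fix i j assume "i < dim_row (rotation2 (u 1 * \<gamma>))" "j < dim_col (rotation2 (u 1 * \<gamma>))"
    then have "i \<in> {0, 1}" "j \<in> {0, 1}" by (auto simp: rotation2_def mat_of_rows_list_def)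
    then show "circle_rot m u \<gamma> $$ (i, j) = rotation2 (u 1 * \<gamma>) $$ (i, j)"
      using u1 u(1) True by (auto simp: circle_rot_def rotation2_def mat_of_rows_list_def)
  qed (auto simp: circle_rot_def rotation2_def mat_of_rows_list_def True)
  then have e: "v (circle_rot m u \<gamma>) = (\<Sum>n\<in>{- int K..int K}. c n * exp (\<i> * of_int n * of_real (u 1 * \<gamma>)))" for \<gamma>
    by (simp add: c)
  have "trig_poly K (\<lambda>\<gamma>. exp (\<i> * of_int n * of_real (u 1 * \<gamma>)))" if "n \<in> {- int K..int K}" for n
  proof -
    have "nat \<bar>n\<bar> \<le> K" "nat \<bar>- n\<bar> \<le> K" using that by auto
    then show ?thesis using u1 trig_poly_exp[of n K] trig_poly_exp[of "- n" K] by auto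
  qed
  then show ?thesis unfolding e by (intro trig_poly_sum trig_poly_scale)
next
  case False
  then have "\<exists>(L :: nat) c n Y Y'. (\<forall>l<L. n l \<le> K \<and> Y l \<in> harmonics m (n l) \<and> Y' l \<in> harmonics m (n l)) \<and>
      (\<forall>g \<in> SO m. v g = (\<Sum>l<L. c l * inner_sphere m (rotate_fun g (Y l)) (Y' l)))"
    using v by (simp add: SO_polys_def)
  then obtain L :: nat and c n Y Y' where
    Y: "\<forall>l<L. n l \<le> K \<and> Y l \<in> harmonics m (n l) \<and> Y' l \<in> harmonics m (n l)"
    and v: "\<forall>g\<in>SO m. v g = (\<Sum>l<L. c l * inner_sphere m (rotate_fun g (Y l)) (Y' l))"
    by blast
  have m0: "m > 0" using m by simp
  note SO = circle_rot_SO[OF m0 u]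
  have "trig_poly K (\<lambda>\<gamma>. inner_sphere m (rotate_fun (circle_rot m u \<gamma>) (Y l)) (Y' l))" if l: "l < L" for l
  proof -
    have "Y l \<in> harmonics m (n l)" "Y' l \<in> harmonics m (n l)" using Y l by auto
    from this[THEN harmonics_hpoly]
    obtain f f' where f: "hpoly {..<m} (n l) f" "\<forall>x\<in>sphere_vec m. Y l x = f x"
      and f': "hpoly {..<m} (n l) f'" "\<forall>x\<in>sphere_vec m. Y' l x = f' x" by blast
    have entry: "trig_poly 1 (\<lambda>\<gamma>. of_real (circle_rot m u \<gamma> $$ (j, i)))" if ij: "i < m" "j < m" for i j
    proof -
      define p q r where "p = (if j = i then 1 else 0 :: real)"
        and "q = u j * u i + (if j = 0 then 1 else 0) * (if i = 0 then 1 else 0)"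
        and "r = u j * (if i = 0 then 1 else 0) - (if j = 0 then 1 else 0) * u i"
      have "trig_poly 1 (\<lambda>\<gamma>. of_real (p - q) + (of_real q * of_real (cos \<gamma>) + of_real r * of_real (sin \<gamma>)))"
        by (intro trig_poly_add trig_poly_scale trig_poly_cos trig_poly_sin trig_poly_const)
      moreover have "circle_rot m u \<gamma> $$ (j, i) = (p - q) + (q * cos \<gamma> + r * sin \<gamma>)" for \<gamma>
      proof -
        have "circle_rot m u \<gamma> $$ (j, i) = p + (cos \<gamma> - 1) * q + sin \<gamma> * r"
          using ij by (simp add: circle_rot_def p_def q_def r_def)
        then show ?thesis by (simp add: algebra_simps)
      qed
      ultimately show ?thesis by simp
    qed
    have "\<exists>F. separated m (n l) F \<and> (\<forall>\<gamma>. \<forall>x\<in>carrier_vec m. f ((circle_rot m u \<gamma>)\<^sup>T *\<^sub>v x) = F \<gamma> x)"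
    proof (rule hpoly_separated[OF f(1)])
      show "separated m 1 (\<lambda>\<gamma> x. \<Sum>j<m. of_real (circle_rot m u \<gamma> $$ (j, i)) * of_real (x $ j))" if "i \<in> {..<m}" for i
        using that by (intro separated_sum separated_single entry pfun.coord) auto
      show "of_real (((circle_rot m u \<gamma>)\<^sup>T *\<^sub>v x) $ i) = (\<Sum>j<m. of_real (circle_rot m u \<gamma> $$ (j, i)) * complex_of_real (x $ j))"
        if "i \<in> {..<m}" "x \<in> carrier_vec m" for i \<gamma> x
        using that rotate_vec_coord[OF SO_carrier[OF SO]] by simp
    qed
    then obtain F where F: "separated m (n l) F" "\<And>\<gamma> x. x \<in> carrier_vec m \<Longrightarrow> f ((circle_rot m u \<gamma>)\<^sup>T *\<^sub>v x) = F \<gamma> x" by blast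
    have "pfun m f'" by (rule hpoly_imp_pfun[OF f'(1)]) simp
    from separated_integral[OF F(1) pfun_cnj[OF this] m0]
    have "trig_poly (n l) (\<lambda>\<gamma>. LINT x|sphere_measure m. F \<gamma> x * cnj (f' x))" by blast
    moreover have "(LINT x|sphere_measure m. F \<gamma> x * cnj (f' x)) = inner_sphere m (rotate_fun (circle_rot m u \<gamma>) (Y l)) (Y' l)" for \<gamma>
      unfolding inner_sphere_def
    proof (intro Bochner_Integration.integral_cong refl)
      fix x assume "x \<in> space (sphere_measure m)"
      then have x: "x \<in> sphere_vec m" by simp
      have "F \<gamma> x = f ((circle_rot m u \<gamma>)\<^sup>T *\<^sub>v x)" using F(2)[OF sphere_vec_carrier[OF x]] by simp
      also have "\<dots> = Y l ((circle_rot m u \<gamma>)\<^sup>T *\<^sub>v x)" using f(2) rotate_sphere[OF SO x] by simp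
      finally show "F \<gamma> x * cnj (f' x) = rotate_fun (circle_rot m u \<gamma>) (Y l) x * cnj (Y' l x)"
        using f'(2) x by (simp add: rotate_fun_def)
    qed
    ultimately have "trig_poly (n l) (\<lambda>\<gamma>. inner_sphere m (rotate_fun (circle_rot m u \<gamma>) (Y l)) (Y' l))" by simp
    then show ?thesis by (rule trig_poly_mono) (use Y l in blast)
  qed
  then have "trig_poly K (\<lambda>\<gamma>. \<Sum>l<L. c l * inner_sphere m (rotate_fun (circle_rot m u \<gamma>) (Y l)) (Y' l))"
    by (intro trig_poly_sum trig_poly_scale) auto
  moreover have "v (circle_rot m u \<gamma>) = (\<Sum>l<L. c l * inner_sphere m (rotate_fun (circle_rot m u \<gamma>) (Y l)) (Y' l))" for \<gamma>
    using v SO by blast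
  ultimately show ?thesis by simp
qed

section \<open>Steerable functions\<close>

text \<open>On the sphere \<open>x\<^sub>0\<^sup>2\<close> can be eliminated, so that \<open>x\<^sub>0\<close> occurs at most linearly. The index \<open>l\<close> is the
  degree in all coordinates but the last one.\<close>
definition nf_gens :: "nat \<Rightarrow> nat \<Rightarrow> (real vec \<Rightarrow> complex) set" where
  "nf_gens d l = {f. \<exists>j e l' h. e \<le> 1 \<and> l = e + l' \<and> hpoly {1..<d - 1} l' h \<and>
     f = (\<lambda>x. of_real (x $ (d - 1)) ^ j * (of_real (x $ 0) ^ e * h x))}"

definition has_nf :: "nat \<Rightarrow> (real vec \<Rightarrow> complex) \<Rightarrow> bool" where
  "has_nf d f \<longleftrightarrow> (\<exists>g\<in>lin_span (\<Union>l. nf_gens d l). \<forall>x\<in>sphere_vec d. f x = g x)"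

lemma has_nf_zero: "has_nf d (\<lambda>x. 0)"
  unfolding has_nf_def by (rule bexI[of _ "\<lambda>x. 0"]) (auto intro: lin_span.zero)

lemma has_nf_cong: "has_nf d f \<Longrightarrow> (\<And>x. x \<in> sphere_vec d \<Longrightarrow> g x = f x) \<Longrightarrow> has_nf d g"
  unfolding has_nf_def by auto

lemma has_nf_add: assumes "has_nf d f" "has_nf d g" shows "has_nf d (\<lambda>x. f x + g x)"
proof -
  obtain f' g' where f': "f' \<in> lin_span (\<Union>l. nf_gens d l)" "\<forall>x\<in>sphere_vec d. f x = f' x"
    and g': "g' \<in> lin_span (\<Union>l. nf_gens d l)" "\<forall>x\<in>sphere_vec d. g x = g' x"
    using assms unfolding has_nf_def by blast
  show ?thesis unfolding has_nf_def
    by (rule bexI[OF _ lin_span_add[OF f'(1) g'(1)]]) (use f'(2) g'(2) in simp)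
qed

lemma has_nf_scale: assumes "has_nf d f" shows "has_nf d (\<lambda>x. c * f x)"
proof -
  obtain f' where f': "f' \<in> lin_span (\<Union>l. nf_gens d l)" "\<forall>x\<in>sphere_vec d. f x = f' x"
    using assms unfolding has_nf_def by blast
  show ?thesis unfolding has_nf_def
    by (rule bexI[OF _ lin_span_scale[OF f'(1), of c]]) (use f'(2) in simp)
qed

lemma has_nf_sum: "(\<And>a. a \<in> A \<Longrightarrow> has_nf d (f a)) \<Longrightarrow> has_nf d (\<lambda>x. \<Sum>a\<in>A. f a x)"
  by (induction A rule: infinite_finite_induct) (auto intro: has_nf_zero has_nf_add)

lemma has_nf_gen:
  assumes "e \<le> 1" "hpoly {1..<d - 1} l h"
  shows "has_nf d (\<lambda>x. of_real (x $ (d - 1)) ^ j * (of_real (x $ 0) ^ e * h x))"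
proof -
  have "(\<lambda>x. of_real (x $ (d - 1)) ^ j * (of_real (x $ 0) ^ e * h x)) \<in> nf_gens d (e + l)"
    unfolding nf_gens_def mem_Collect_eq using assms
    by (intro exI[of _ j] exI[of _ e] exI[of _ l] exI[of _ h]) simp
  then have "(\<lambda>x. of_real (x $ (d - 1)) ^ j * (of_real (x $ 0) ^ e * h x)) \<in> lin_span (\<Union>l. nf_gens d l)"
    by (intro lin_span_base) blast
  then show ?thesis unfolding has_nf_def by (rule bexI[rotated]) simp
qed

lemma has_nf_coord_gen:
  assumes d: "d \<ge> 3" and f: "f \<in> nf_gens d l" and i: "i < d"
  shows "has_nf d (\<lambda>x. of_real (x $ i) * f x)"
proof -
  obtain j e l' h where h: "e \<le> 1" "hpoly {1..<d - 1} l' h"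
    "f = (\<lambda>x. of_real (x $ (d - 1)) ^ j * (of_real (x $ 0) ^ e * h x))"
    using f unfolding nf_gens_def by blast
  consider "i = d - 1" | "i \<in> {1..<d - 1}" | "i = 0" "e = 0" | "i = 0" "e = 1"
    using i h(1) by fastforce
  then show ?thesis
  proof cases
    case 1
    show ?thesis by (rule has_nf_cong[OF has_nf_gen[OF h(1,2), of "Suc j"]]) (simp add: h(3) 1)
  next
    case 2
    have "hpoly {1..<d - 1} (Suc l') (\<lambda>x. of_real (x $ i) * h x)" using 2 h(2) by (rule hpoly.coord)
    from has_nf_gen[OF h(1) this, of j] show ?thesis by (rule has_nf_cong) (simp add: h(3))
  next
    case 3
    have "has_nf d (\<lambda>x. of_real (x $ (d - 1)) ^ j * (of_real (x $ 0) ^ 1 * h x))"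
      by (rule has_nf_gen[OF _ h(2)]) simp
    then show ?thesis by (rule has_nf_cong) (simp add: h(3) 3)
  next
    \<comment> \<open>Here x_0^2 arises and is replaced by 1 minus the other squares. This mixes
      degrees in the coordinates before the last one, which is why the normal form is a span over
      all l at once.\<close>
    case 4
    define z where "z x = complex_of_real (x $ (d - 1))" for x :: "real vec"
    have g: "has_nf d (\<lambda>x. z x ^ j * (of_real (x $ 0) ^ 0 * k x))" if "hpoly {1..<d - 1} l k" for j l k
      unfolding z_def by (rule has_nf_gen[OF _ that]) simp
    have "hpoly {1..<d - 1} (Suc (Suc l')) (\<lambda>x. of_real (x $ n) * (of_real (x $ n) * h x))" if "n \<in> {1..<d - 1}" for n
      using that h(2) by (intro hpoly.coord)
    then have "has_nf d (\<lambda>x. \<Sum>n\<in>{1..<d - 1}. z x ^ j * (of_real (x $ 0) ^ 0 * (of_real (x $ n) * (of_real (x $ n) * h x))))"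
      by (intro has_nf_sum g) auto
    then have "has_nf d (\<lambda>x. z x ^ j * (of_real (x $ 0) ^ 0 * h x) + (- 1 * (z x ^ (j + 2) * (of_real (x $ 0) ^ 0 * h x))
      + - 1 * (\<Sum>n\<in>{1..<d - 1}. z x ^ j * (of_real (x $ 0) ^ 0 * (of_real (x $ n) * (of_real (x $ n) * h x))))))"
      by (intro has_nf_add has_nf_scale g[OF h(2)])
    then show ?thesis
    proof (rule has_nf_cong)
      fix x assume x: "x \<in> sphere_vec d"
      have "{..<d} = insert 0 (insert (d - 1) {1..<d - 1})" using d by auto
      then have "(x $ 0)\<^sup>2 + ((x $ (d - 1))\<^sup>2 + (\<Sum>n\<in>{1..<d - 1}. (x $ n)\<^sup>2)) = 1"
        using x d by (simp add: sphere_vec_iff)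
      then have "(x $ 0)\<^sup>2 = 1 - (x $ (d - 1))\<^sup>2 - (\<Sum>n\<in>{1..<d - 1}. (x $ n)\<^sup>2)" by simp
      then have "complex_of_real ((x $ 0)\<^sup>2) = of_real (1 - (x $ (d - 1))\<^sup>2 - (\<Sum>n\<in>{1..<d - 1}. (x $ n)\<^sup>2))"
        by (simp only:)
      then have e: "complex_of_real (x $ 0) * of_real (x $ 0) = 1 - z x ^ 2 - (\<Sum>n\<in>{1..<d - 1}. of_real (x $ n) ^ 2)"
        by (simp add: z_def power2_eq_square)
      have "of_real (x $ i) * f x = z x ^ j * (of_real (x $ 0) * of_real (x $ 0)) * h x"
        by (simp add: h(3) 4 z_def)
      also have "\<dots> = z x ^ j * h x + (- 1 * (z x ^ (j + 2) * h x)
          + - 1 * (\<Sum>n\<in>{1..<d - 1}. z x ^ j * (of_real (x $ n) * (of_real (x $ n) * h x))))"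
      proof -
        define S where "S = (\<Sum>n\<in>{1..<d - 1}. complex_of_real (x $ n) ^ 2)"
        have "(\<Sum>n\<in>{1..<d - 1}. z x ^ j * (of_real (x $ n) * (of_real (x $ n) * h x))) = z x ^ j * (S * h x)"
          unfolding S_def sum_distrib_left sum_distrib_right by (rule sum.cong) (simp_all add: power2_eq_square mult.assoc)
        then show ?thesis unfolding e S_def[symmetric] by (simp add: algebra_simps power_add power2_eq_square)
      qed
      finally show "of_real (x $ i) * f x = z x ^ j * (of_real (x $ 0) ^ 0 * h x) + (- 1 * (z x ^ (j + 2) * (of_real (x $ 0) ^ 0 * h x))
          + - 1 * (\<Sum>n\<in>{1..<d - 1}. z x ^ j * (of_real (x $ 0) ^ 0 * (of_real (x $ n) * (of_real (x $ n) * h x)))))"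
        by simp
    qed
  qed
qed

lemma has_nf_coord:
  assumes d: "d \<ge> 3" and f: "has_nf d f" and i: "i < d"
  shows "has_nf d (\<lambda>x. of_real (x $ i) * f x)"
proof -
  obtain g where g: "g \<in> lin_span (\<Union>l. nf_gens d l)" "\<forall>x\<in>sphere_vec d. f x = g x"
    using f unfolding has_nf_def by blast
  have "has_nf d (\<lambda>x. of_real (x $ i) * g x)"
    using g(1)
  proof (induction rule: lin_span.induct)
    case (step f g c)
    then obtain l where "f \<in> nf_gens d l" by blast
    from has_nf_add[OF has_nf_scale[OF has_nf_coord_gen[OF d this i], of c] step(3)]
    show ?case by (rule has_nf_cong) (simp add: algebra_simps)
  qed (simp add: has_nf_zero)
  then show ?thesis by (rule has_nf_cong) (use g(2) in simp)
qed

lemma hpoly_has_nf: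
  assumes d: "d \<ge> 3" and f: "hpoly {..<d} D f" shows "has_nf d f"
  using f
proof (induction rule: hpoly.induct)
  case (zero D)
  show ?case by (rule has_nf_zero)
next
  case (const c)
  have "has_nf d (\<lambda>x. of_real (x $ (d - 1)) ^ 0 * (of_real (x $ 0) ^ 0 * c))"
    by (rule has_nf_gen[OF _ hpoly.const]) simp
  then show ?case by simp
next
  case (coord i D f)
  then show ?case using d by (intro has_nf_coord) auto
qed (rule has_nf_add)

lemma lin_span_graded:
  assumes "f \<in> lin_span (\<Union>l::nat. S l)"
  shows "\<exists>L F. (\<forall>l. F l \<in> lin_span (S l)) \<and> (\<forall>l>L. F l = (\<lambda>x. 0)) \<and> f = (\<lambda>x. \<Sum>l\<le>L. F l x)"
  using assms
proof (induction rule: lin_span.induct)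
  case zero
  then show ?case by (intro exI[of _ 0] exI[of _ "\<lambda>_ _. 0"]) (auto intro: lin_span.zero)
next
  case (step f g c)
  then obtain m where m: "f \<in> S m" by blast
  obtain L F where F: "\<forall>l. F l \<in> lin_span (S l)" "\<forall>l>L. F l = (\<lambda>x. 0)" "g = (\<lambda>x. \<Sum>l\<le>L. F l x)"
    using step(3) by blast
  define F' where "F' = F(m := (\<lambda>x. c * f x + F m x))"
  define L' where "L' = max L m"
  have "F' l \<in> lin_span (S l)" for l
    using F(1) m lin_span.step[of f "S m" "F m" c] by (auto simp: F'_def)
  moreover have "F' l = (\<lambda>x. 0)" if "l > L'" for l using that F(2) by (auto simp: F'_def L'_def)
  moreover have "c * f x + g x = (\<Sum>l\<le>L'. F' l x)" for x
  proof -
    have "g x = (\<Sum>l\<le>L'. F l x)"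
      unfolding F(3) by (rule sum.mono_neutral_left) (use F(2) in \<open>auto simp: L'_def\<close>)
    moreover have "(\<Sum>l\<le>L'. F' l x) = (\<Sum>l\<le>L'. F l x + (if l = m then c * f x else 0))"
      by (rule sum.cong) (auto simp: F'_def)
    moreover have "(\<Sum>l\<le>L'. if l = m then c * f x else 0) = c * f x" by (simp add: L'_def)
    ultimately show ?thesis by (simp add: sum.distrib)
  qed
  ultimately show ?case by (intro exI[of _ L'] exI[of _ F']) auto
qed

text \<open>The point at height t on the parallel of radius s, with c and \<sigma> in the roles of
  cosine and sine of an angle in the plane of u and e_0. They are free parameters rather than values
  of one angle, so that an identity polynomial in c and \<sigma> can be transferred to every
  point.\<close>

definition circle_pt :: "nat \<Rightarrow> real \<Rightarrow> real \<Rightarrow> real \<Rightarrow> (nat \<Rightarrow> real) \<Rightarrow> real \<Rightarrow> real vec" where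
  "circle_pt d s c \<sigma> u t = vec d (\<lambda>i. if i = d - 1 then t else if i = 0 then s * \<sigma> else s * c * u i)"

lemma hpoly_scaled:
  "hpoly I D f \<Longrightarrow> (\<And>i. i \<in> I \<Longrightarrow> y $ i = r * x $ i) \<Longrightarrow> f y = of_real r ^ D * f x"
  by (induction rule: hpoly.induct) (auto simp: algebra_simps)

text \<open>x_0 occurs at most linearly, hence so does \<sigma>. A and B depend on u and t alone, so
  knowing them to vanish from one circle settles all s, c and \<sigma>. The condition for l = 0
  guards the truncated exponent l - 1.\<close>

lemma nf_gens_circle:
  assumes d: "d \<ge> 3" and f: "f \<in> lin_span (nf_gens d l)"
  shows "\<exists>A B. (l = 0 \<longrightarrow> A = 0) \<and> (\<forall>s c \<sigma>. f (circle_pt d s c \<sigma> u t)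
    = of_real s ^ l * (of_real c ^ l * B + of_real \<sigma> * of_real c ^ (l - 1) * A))"
  using f
proof (induction rule: lin_span.induct)
  case zero
  then show ?case by (intro exI[of _ 0]) auto
next
  case (step f g b)
  then obtain A B where AB: "l = 0 \<longrightarrow> A = 0" "\<And>s c \<sigma>. g (circle_pt d s c \<sigma> u t)
    = of_real s ^ l * (of_real c ^ l * B + of_real \<sigma> * of_real c ^ (l - 1) * A)" by blast
  obtain j e l' h where h: "e \<le> 1" "l = e + l'" "hpoly {1..<d - 1} l' h"
    "f = (\<lambda>x. of_real (x $ (d - 1)) ^ j * (of_real (x $ 0) ^ e * h x))"
    using step(1) unfolding nf_gens_def by blast
  define w0 where "w0 = h (circle_pt d 1 1 0 u t)"
  define w where "w = of_real t ^ j * w0"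
  have hs: "h (circle_pt d s c \<sigma> u t) = of_real (s * c) ^ l' * w0" for s c \<sigma>
    unfolding w0_def by (rule hpoly_scaled[OF h(3)]) (auto simp: circle_pt_def)
  have fs: "f (circle_pt d s c \<sigma> u t) = of_real (s * \<sigma>) ^ e * of_real (s * c) ^ l' * w" for s c \<sigma>
  proof -
    have "circle_pt d s c \<sigma> u t $ (d - 1) = t" "circle_pt d s c \<sigma> u t $ 0 = s * \<sigma>"
      using d by (simp_all add: circle_pt_def)
    then show ?thesis unfolding h(4) w_def by (simp only: hs mult_ac)
  qed
  have "e = 0 \<or> e = 1" using h(1) by auto
  then show ?case
  proof
    assume e: "e = 0"
    show ?thesis
    proof (intro exI conjI allI)
      show "l = 0 \<longrightarrow> A = 0" by (rule AB(1))
      fix s c \<sigma>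
      show "b * f (circle_pt d s c \<sigma> u t) + g (circle_pt d s c \<sigma> u t)
        = of_real s ^ l * (of_real c ^ l * (B + b * w) + of_real \<sigma> * of_real c ^ (l - 1) * A)"
        unfolding fs AB(2) using h(2) e by (simp add: power_mult_distrib algebra_simps)
    qed
  next
    assume e: "e = 1"
    show ?thesis
    proof (intro exI conjI allI)
      show "l = 0 \<longrightarrow> A + b * w = 0" using h(2) e by simp
      fix s c \<sigma>
      show "b * f (circle_pt d s c \<sigma> u t) + g (circle_pt d s c \<sigma> u t)
        = of_real s ^ l * (of_real c ^ l * B + of_real \<sigma> * of_real c ^ (l - 1) * (A + b * w))"
        unfolding fs AB(2) using h(2) e by (simp add: power_mult_distrib algebra_simps)
    qed
  qed
qed

section \<open>Rotations about the polar axis and their circles\<close>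

lemma SO_embed_rotate:
  assumes h: "h \<in> carrier_mat m m" and x: "x \<in> carrier_vec (Suc m)" and i: "i \<le> m"
  shows "((SO_embed h)\<^sup>T *\<^sub>v x) $ i = (if i < m then \<Sum>j<m. h $$ (j, i) * x $ j else x $ m)"
proof -
  have c: "SO_embed h \<in> carrier_mat (Suc m) (Suc m)" using h by (auto simp: SO_embed_def)
  have e: "SO_embed h $$ (j, i) = (if j < m then (if i < m then h $$ (j, i) else 0) else (if i < m then 0 else 1))"
    if "j \<le> m" for j
    using h i that unfolding SO_embed_def by (auto simp: index_mat_four_block)
  have "((SO_embed h)\<^sup>T *\<^sub>v x) $ i = (\<Sum>j<Suc m. SO_embed h $$ (j, i) * x $ j)"
    using rotate_vec_coord[OF c x] i by simp
  also have "\<dots> = (\<Sum>j<m. SO_embed h $$ (j, i) * x $ j) + SO_embed h $$ (m, i) * x $ m" by simp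
  also have "(\<Sum>j<m. SO_embed h $$ (j, i) * x $ j) = (\<Sum>j<m. (if i < m then h $$ (j, i) else 0) * x $ j)"
    by (rule sum.cong) (auto simp: e)
  finally show ?thesis using i by (simp add: e)
qed

lemma circle_rot_pt:
  assumes d: "d \<ge> 3" and u: "u 0 = 0" "(\<Sum>i<d - 1. (u i)\<^sup>2) = 1"
  shows "(SO_embed (circle_rot (d - 1) u \<gamma>))\<^sup>T *\<^sub>v circle_pt d s 1 0 u t = circle_pt d s (cos \<gamma>) (sin \<gamma>) u t"
proof (rule eq_vecI)
  define m where "m = d - 1"
  have m: "d = Suc m" "m \<ge> 2" using d by (auto simp: m_def)
  have dm: "d - 1 = m" by (simp add: m_def)
  have h: "circle_rot m u \<gamma> \<in> carrier_mat m m" by (simp add: circle_rot_def)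
  have x: "circle_pt d s 1 0 u t \<in> carrier_vec (Suc m)" by (simp add: circle_pt_def m)
  have um: "(\<Sum>i<m. u i * u i) = 1" using u(2) by (simp add: m_def power2_eq_square)
  fix i assume "i < dim_vec (circle_pt d s (cos \<gamma>) (sin \<gamma>) u t)"
  then have i: "i \<le> m" by (simp add: circle_pt_def m)
  show "((SO_embed (circle_rot (d - 1) u \<gamma>))\<^sup>T *\<^sub>v circle_pt d s 1 0 u t) $ i = circle_pt d s (cos \<gamma>) (sin \<gamma>) u t $ i"
  proof (cases "i < m")
    case False
    then show ?thesis using SO_embed_rotate[OF h x i] i by (simp add: m_def[symmetric] circle_pt_def m)
  next
    case True
    define e where "e i = (if i = 0 then 1 else 0 :: real)" for i :: nat
    define \<delta> where "\<delta> j = (if j = i then 1 else 0 :: real)" for j :: nat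
    have se: "(\<Sum>j<m. e j * u j) = 0" "(\<Sum>j<m. \<delta> j * u j) = u i"
      using u(1) m True by (simp_all add: e_def \<delta>_def if_distrib[of "\<lambda>t. t * _"] cong: if_cong)
    have "((SO_embed (circle_rot m u \<gamma>))\<^sup>T *\<^sub>v circle_pt d s 1 0 u t) $ i
        = (\<Sum>j<m. circle_rot m u \<gamma> $$ (j, i) * circle_pt d s 1 0 u t $ j)"
      using SO_embed_rotate[OF h x i] True by simp
    also have "\<dots> = (\<Sum>j<m. s * (\<delta> j * u j) + s * (cos \<gamma> - 1) * u i * (u j * u j) + s * (cos \<gamma> - 1) * e i * (e j * u j)
        + s * sin \<gamma> * e i * (u j * u j) - s * sin \<gamma> * u i * (e j * u j))"
    proof (rule sum.cong[OF refl])
      fix j assume j: "j \<in> {..<m}"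
      have 1: "circle_pt d s 1 0 u t $ j = s * u j" using j u(1) by (simp add: circle_pt_def m)
      have 2: "circle_rot m u \<gamma> $$ (j, i) = \<delta> j + (cos \<gamma> - 1) * (u j * u i + e j * e i) + sin \<gamma> * (u j * e i - e j * u i)"
        using j True by (simp add: circle_rot_def \<delta>_def e_def)
      show "circle_rot m u \<gamma> $$ (j, i) * circle_pt d s 1 0 u t $ j
        = s * (\<delta> j * u j) + s * (cos \<gamma> - 1) * u i * (u j * u j) + s * (cos \<gamma> - 1) * e i * (e j * u j)
        + s * sin \<gamma> * e i * (u j * u j) - s * sin \<gamma> * u i * (e j * u j)"
        unfolding 1 2 by (simp add: algebra_simps)
    qed
    also have "\<dots> = s * u i + s * (cos \<gamma> - 1) * u i + s * sin \<gamma> * e i"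
      unfolding sum.distrib sum_subtractf sum_distrib_left[symmetric] se um by simp
    also have "\<dots> = circle_pt d s (cos \<gamma>) (sin \<gamma>) u t $ i"
      using True u(1) by (simp add: circle_pt_def m e_def algebra_simps)
    finally show ?thesis unfolding m_def .
  qed
qed (simp add: circle_pt_def SO_embed_def circle_rot_def, use d in simp)

lemma circle_pt_sphere:
  assumes d: "d \<ge> 3" and u: "u 0 = 0" "(\<Sum>i<d - 1. (u i)\<^sup>2) = 1" and st: "s\<^sup>2 + t\<^sup>2 = 1"
  shows "circle_pt d s 1 0 u t \<in> sphere_vec d"
proof -
  have D: "{..<d} = insert (d - 1) {..<d - 1}" using d by auto
  have "(\<Sum>i<d - 1. (circle_pt d s 1 0 u t $ i)\<^sup>2) = (\<Sum>i<d - 1. s\<^sup>2 * (u i)\<^sup>2)"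
    by (rule sum.cong) (use u(1) in \<open>auto simp: circle_pt_def power_mult_distrib\<close>)
  also have "\<dots> = s\<^sup>2" unfolding sum_distrib_left[symmetric] u(2) by simp
  finally have "(\<Sum>i<d. (circle_pt d s 1 0 u t $ i)\<^sup>2) = t\<^sup>2 + s\<^sup>2"
    unfolding D using d by (simp add: circle_pt_def)
  then show ?thesis using st by (simp add: sphere_vec_iff circle_pt_def)
qed

lemma sphere_circle_pt:
  assumes d: "d \<ge> 3" and x: "x \<in> sphere_vec d"
  obtains s c \<sigma> u where "s \<ge> 0" "s\<^sup>2 + (x $ (d - 1))\<^sup>2 = 1" "u 0 = 0" "(\<Sum>i<d - 1. (u i)\<^sup>2) = 1"
    "x = circle_pt d s c \<sigma> u (x $ (d - 1))"
proof -
  have D: "{..<d} = insert (d - 1) {..<d - 1}" "{..<d - 1} = insert 0 {1..<d - 1}" using d by auto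
  have xc: "x \<in> carrier_vec d" using x by (rule sphere_vec_carrier)
  define r where "r = sqrt (\<Sum>i\<in>{1..<d - 1}. (x $ i)\<^sup>2)"
  define s where "s = sqrt (\<Sum>i<d - 1. (x $ i)\<^sup>2)"
  have r2: "r\<^sup>2 = (\<Sum>i\<in>{1..<d - 1}. (x $ i)\<^sup>2)" unfolding r_def by (simp add: sum_nonneg)
  have s2: "s\<^sup>2 = (\<Sum>i<d - 1. (x $ i)\<^sup>2)" unfolding s_def by (simp add: sum_nonneg)
  have s0: "s \<ge> 0" "r \<ge> 0" by (simp_all add: s_def r_def sum_nonneg)
  have st: "s\<^sup>2 + (x $ (d - 1))\<^sup>2 = 1" using x unfolding sphere_vec_iff D(1) s2 by simp
  have sr: "s\<^sup>2 = (x $ 0)\<^sup>2 + r\<^sup>2" unfolding s2 r2 D(2) by simp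
  define e1 where "e1 i = (if i = 1 then 1 else 0 :: real)" for i :: nat
  have e1: "e1 0 = 0" "(\<Sum>i<d - 1. (e1 i)\<^sup>2) = 1"
    using d by (simp_all add: e1_def if_distrib[of "\<lambda>t. t\<^sup>2"] cong: if_cong)
  show ?thesis
  proof (cases "r = 0")
    \<comment> \<open>The point lies in the plane of e_0 and the pole and determines no direction;
      any unit vector orthogonal to e_0 serves, here e_1, with c = 0.\<close>
    case True
    have z: "x $ i = 0" if "i \<in> {1..<d - 1}" for i
    proof -
      have "(\<Sum>i\<in>{1..<d - 1}. (x $ i)\<^sup>2) = 0" using True r2 by simp
      then show ?thesis using that by (simp add: sum_nonneg_eq_0_iff)
    qed
    have "s = 0 \<Longrightarrow> x $ 0 = 0" using sr True by simp
    then have "s * (x $ 0 / s) = x $ 0" by (cases "s = 0") auto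
    then have "x = circle_pt d s 0 (x $ 0 / s) e1 (x $ (d - 1))"
      by (intro eq_vecI) (use xc z in \<open>auto simp: circle_pt_def\<close>)
    from that[OF s0(1) st e1 this] show ?thesis .
  next
    case False
    then have "r\<^sup>2 > 0" by simp
    then have "s\<^sup>2 > 0" unfolding sr by (intro add_nonneg_pos) auto
    then have s: "s \<noteq> 0" by auto
    define u where "u i = (if i = 0 then 0 else x $ i / r)" for i
    have "(\<Sum>i<d - 1. (u i)\<^sup>2) = (\<Sum>i\<in>{1..<d - 1}. (x $ i)\<^sup>2) / r\<^sup>2"
      unfolding D(2) by (simp add: u_def power_divide sum_divide_distrib)
    also have "\<dots> = 1" unfolding r2[symmetric] using False by simp
    finally have u: "u 0 = 0" "(\<Sum>i<d - 1. (u i)\<^sup>2) = 1" by (simp_all add: u_def)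
    have "x = circle_pt d s (r / s) (x $ 0 / s) u (x $ (d - 1))"
      by (intro eq_vecI) (use xc s False in \<open>auto simp: circle_pt_def u_def\<close>)
    from that[OF s0(1) st u this] show ?thesis .
  qed
qed

lemma coeff_sum_monom: "coeff (\<Sum>l\<in>A. monom (a l) l) n = (if n \<in> A \<and> finite A then a n else 0)"
proof (cases "finite A")
  case True
  then show ?thesis by (simp add: coeff_sum coeff_monom)
qed simp

text \<open>Along a circle about the axis the function is a trigonometric polynomial of degree at
  most \<open>K\<close> by steerability, and the sum of s^l (cos^l B_l + sin cos^(l-1) A_l) by the
  normal form. Uniqueness forces A_l = B_l = 0 for l > K, so those parts vanish on the sphere; the
  other parts have tail degree at most K by \<open>coord_power_solid_gens\<close>.\<close>

lemma steerable_expandable: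
  assumes d: "d \<ge> 3" and \<Psi>: "\<Psi> \<in> sphere_polys d N"
    and hv: "\<And>p. p \<in> {1..M} \<Longrightarrow> v p \<in> SO_polys (d - 1) K"
    and steer: "\<And>h x. h \<in> SO (d - 1) \<Longrightarrow> x \<in> sphere_vec d \<Longrightarrow>
      rotate_fun (SO_embed h) \<Psi> x = (\<Sum>p = 1..M. v p h * rotate_fun (SO_embed (hs p)) \<Psi> x)"
  shows "expandable d {(k, q). k \<in> tail_indices d \<and> tail_deg k \<le> K} \<Psi>"
proof -
  obtain P where P: "\<forall>n\<le>N. hpoly {..<d} n (P n)" "\<forall>x\<in>sphere_vec d. \<Psi> x = (\<Sum>n\<le>N. P n x)"
    using sphere_polys_hpoly[OF \<Psi>] by blast
  have "has_nf d (\<lambda>x. \<Sum>n\<le>N. P n x)" using P(1) by (intro has_nf_sum hpoly_has_nf[OF d]) auto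
  then obtain g where g: "g \<in> lin_span (\<Union>l. nf_gens d l)" "\<forall>x\<in>sphere_vec d. (\<Sum>n\<le>N. P n x) = g x"
    unfolding has_nf_def by blast
  obtain L F where F: "\<forall>l. F l \<in> lin_span (nf_gens d l)" "g = (\<lambda>x. \<Sum>l\<le>L. F l x)"
    using lin_span_graded[OF g(1)] by blast
  have \<Psi>F: "\<Psi> x = (\<Sum>l\<le>L. F l x)" if "x \<in> sphere_vec d" for x using P(2) g(2) F(2) that by simp
  \<comment> \<open>A genuine circle on the sphere, with radius s > 0, is needed to apply
    steerability. The coefficients found to be zero do not depend on s, whence the conclusion for
    all s', c and \<sigma>.\<close>
  have vanish: "F l (circle_pt d s' c \<sigma> u t) = 0"
    if l: "l > K" "l \<le> L" and u: "u 0 = 0" "(\<Sum>i<d - 1. (u i)\<^sup>2) = 1" and s: "s > 0" "s\<^sup>2 + t\<^sup>2 = 1" for l s s' c \<sigma> u t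
  proof -
    have "\<forall>l. \<exists>AB. (l = 0 \<longrightarrow> fst AB = 0) \<and> (\<forall>s c \<sigma>. F l (circle_pt d s c \<sigma> u t)
        = of_real s ^ l * (of_real c ^ l * snd AB + of_real \<sigma> * of_real c ^ (l - 1) * fst AB))"
    proof
      fix l
      obtain A B where "(l = 0 \<longrightarrow> A = 0) \<and> (\<forall>s c \<sigma>. F l (circle_pt d s c \<sigma> u t)
        = of_real s ^ l * (of_real c ^ l * B + of_real \<sigma> * of_real c ^ (l - 1) * A))"
        using nf_gens_circle[OF d F(1)[rule_format], of l u t] by (elim exE)
      then show "\<exists>AB. (l = 0 \<longrightarrow> fst AB = 0) \<and> (\<forall>s c \<sigma>. F l (circle_pt d s c \<sigma> u t)
        = of_real s ^ l * (of_real c ^ l * snd AB + of_real \<sigma> * of_real c ^ (l - 1) * fst AB))"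
        by (intro exI[of _ "(A, B)"]) simp
    qed
    from choice[OF this] obtain AB where AB: "\<forall>l. (l = 0 \<longrightarrow> fst (AB l) = 0) \<and> (\<forall>s c \<sigma>. F l (circle_pt d s c \<sigma> u t)
        = of_real s ^ l * (of_real c ^ l * snd (AB l) + of_real \<sigma> * of_real c ^ (l - 1) * fst (AB l)))" ..
    define A B where "A l = fst (AB l)" and "B l = snd (AB l)" for l
    have A0: "A 0 = 0" using AB by (simp add: A_def)
    have FAB: "F l (circle_pt d s c \<sigma> u t) = of_real s ^ l * (of_real c ^ l * B l + of_real \<sigma> * of_real c ^ (l - 1) * A l)"
      for l s c \<sigma> using AB by (simp add: A_def B_def)
    have x0: "circle_pt d s 1 0 u t \<in> sphere_vec d" by (rule circle_pt_sphere[OF d u s(2)])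
    have m: "d - 1 \<ge> 2" "d - 1 > 0" using d by auto
    have SO: "circle_rot (d - 1) u \<gamma> \<in> SO (d - 1)" for \<gamma> by (rule circle_rot_SO[OF m(2) u])
    have "trig_poly K (\<lambda>\<gamma>. \<Sum>p = 1..M. rotate_fun (SO_embed (hs p)) \<Psi> (circle_pt d s 1 0 u t) * v p (circle_rot (d - 1) u \<gamma>))"
      using hv by (intro trig_poly_sum trig_poly_scale SO_polys_circle_rot[OF m(1) u]) auto
    moreover have "(\<Sum>p = 1..M. rotate_fun (SO_embed (hs p)) \<Psi> (circle_pt d s 1 0 u t) * v p (circle_rot (d - 1) u \<gamma>))
        = (\<Sum>l\<le>L. of_real s ^ l * (of_real (cos \<gamma>) ^ l * B l + of_real (sin \<gamma>) * of_real (cos \<gamma>) ^ (l - 1) * A l))" for \<gamma>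
    proof -
      have "(\<Sum>p = 1..M. rotate_fun (SO_embed (hs p)) \<Psi> (circle_pt d s 1 0 u t) * v p (circle_rot (d - 1) u \<gamma>))
          = rotate_fun (SO_embed (circle_rot (d - 1) u \<gamma>)) \<Psi> (circle_pt d s 1 0 u t)"
        unfolding steer[OF SO x0] by (simp only: mult.commute)
      also have "\<dots> = \<Psi> (circle_pt d s (cos \<gamma>) (sin \<gamma>) u t)"
        unfolding rotate_fun_def circle_rot_pt[OF d u] ..
      also have "circle_pt d s (cos \<gamma>) (sin \<gamma>) u t \<in> sphere_vec d"
      proof -
        have "(\<Sum>i<d. (circle_pt d s (cos \<gamma>) (sin \<gamma>) u t $ i)\<^sup>2) = 1"
        proof -
          have D: "{..<d} = insert (d - 1) (insert 0 {1..<d - 1})" "{..<d - 1} = insert 0 {1..<d - 1}" using d by auto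
          have "(\<Sum>i\<in>{1..<d - 1}. (circle_pt d s (cos \<gamma>) (sin \<gamma>) u t $ i)\<^sup>2) = (\<Sum>i\<in>{1..<d - 1}. (s * cos \<gamma>)\<^sup>2 * (u i)\<^sup>2)"
            by (rule sum.cong) (auto simp: circle_pt_def power_mult_distrib)
          also have "\<dots> = (s * cos \<gamma>)\<^sup>2 * 1" using u unfolding sum_distrib_left[symmetric] D(2) by simp
          finally have "(\<Sum>i<d. (circle_pt d s (cos \<gamma>) (sin \<gamma>) u t $ i)\<^sup>2) = t\<^sup>2 + ((s * sin \<gamma>)\<^sup>2 + (s * cos \<gamma>)\<^sup>2 * 1)"
            unfolding D(1) using d by (simp add: circle_pt_def)
          also have "\<dots> = t\<^sup>2 + s\<^sup>2 * ((sin \<gamma>)\<^sup>2 + (cos \<gamma>)\<^sup>2)" by (simp only: power_mult_distrib distrib_left mult_1_right)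
          also have "\<dots> = 1" using s(2) by simp
          finally show ?thesis .
        qed
        then show ?thesis by (simp add: sphere_vec_iff circle_pt_def)
      qed
      then have "\<Psi> (circle_pt d s (cos \<gamma>) (sin \<gamma>) u t) = (\<Sum>l\<le>L. F l (circle_pt d s (cos \<gamma>) (sin \<gamma>) u t))"
        by (rule \<Psi>F)
      finally show ?thesis unfolding FAB .
    qed
    ultimately have "trig_poly K (\<lambda>\<gamma>. \<Sum>l\<le>L. of_real s ^ l * (of_real (cos \<gamma>) ^ l * B l + of_real (sin \<gamma>) * of_real (cos \<gamma>) ^ (l - 1) * A l))"
      by (simp only:)
    then obtain p q where pq: "degree p \<le> K" "q = 0 \<or> degree q < K"
      "\<And>\<gamma>. (\<Sum>l\<le>L. of_real s ^ l * (of_real (cos \<gamma>) ^ l * B l + of_real (sin \<gamma>) * of_real (cos \<gamma>) ^ (l - 1) * A l))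
        = poly p (of_real (cos \<gamma>)) + of_real (sin \<gamma>) * poly q (of_real (cos \<gamma>))"
      unfolding trig_poly_def by blast
    define p' where "p' = (\<Sum>l\<in>{..L}. monom (of_real s ^ l * B l) l)"
    \<comment> \<open>Indexed by the exponent l - 1 of the cosine; the term with l = 0 drops out
      because A vanishes there.\<close>
    define q' where "q' = (\<Sum>l\<in>{..<L}. monom (of_real s ^ Suc l * A (Suc l)) l)"
    have "poly (p' - p) (of_real (cos \<gamma>)) + of_real (sin \<gamma>) * poly (q' - q) (of_real (cos \<gamma>)) = 0" for \<gamma>
    proof -
      have "(\<Sum>l\<le>L. of_real s ^ l * (of_real (sin \<gamma>) * of_real (cos \<gamma>) ^ (l - 1) * A l))
          = (\<Sum>l<L. of_real s ^ Suc l * (of_real (sin \<gamma>) * of_real (cos \<gamma>) ^ l * A (Suc l)))"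
        by (simp add: sum.atMost_shift A0)
      also have "\<dots> = of_real (sin \<gamma>) * poly q' (of_real (cos \<gamma>))"
        unfolding q'_def poly_sum poly_monom sum_distrib_left by (rule sum.cong) (simp_all add: mult_ac)
      finally have Q: "(\<Sum>l\<le>L. of_real s ^ l * (of_real (sin \<gamma>) * of_real (cos \<gamma>) ^ (l - 1) * A l))
          = of_real (sin \<gamma>) * poly q' (of_real (cos \<gamma>))" .
      have "(\<Sum>l\<le>L. of_real s ^ l * (of_real (cos \<gamma>) ^ l * B l)) = poly p' (of_real (cos \<gamma>))"
        unfolding p'_def poly_sum poly_monom by (rule sum.cong) (simp_all add: mult_ac)
      then have "poly p' (of_real (cos \<gamma>)) + of_real (sin \<gamma>) * poly q' (of_real (cos \<gamma>))
          = poly p (of_real (cos \<gamma>)) + of_real (sin \<gamma>) * poly q (of_real (cos \<gamma>))"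
        unfolding pq(3)[symmetric] distrib_left sum.distrib Q by simp
      then show ?thesis by (simp add: algebra_simps)
    qed
    then have eq: "p' - p = 0" "q' - q = 0" using trig_poly_unique[of "p' - p" "q' - q"] by blast+
    have "coeff p' l = 0" using eq(1) pq(1) l(1) coeff_eq_0[of p l] by simp
    then have "of_real s ^ l * B l = 0" using l(2) unfolding p'_def coeff_sum_monom by simp
    then have B: "B l = 0" using s(1) by simp
    obtain k where k: "l = Suc k" using l(1) by (cases l) auto
    have "coeff q k = 0" using pq(2) l(1) k by (auto intro: coeff_eq_0)
    then have "coeff q' k = 0" using eq(2) by simp
    then have "of_real s ^ Suc k * A (Suc k) = 0" using l(2) k unfolding q'_def coeff_sum_monom by simp
    then have A: "A l = 0" using s(1) k by simp
    show ?thesis unfolding FAB A B by simp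
  qed
  have zero: "F l x = 0" if l: "l > K" "l \<le> L" and x: "x \<in> sphere_vec d" for l x
  proof -
    obtain s c \<sigma> u where s: "s \<ge> 0" "s\<^sup>2 + (x $ (d - 1))\<^sup>2 = 1" "u 0 = 0" "(\<Sum>i<d - 1. (u i)\<^sup>2) = 1"
      "x = circle_pt d s c \<sigma> u (x $ (d - 1))" by (rule sphere_circle_pt[OF d x])
    show ?thesis
    proof (cases "s = 0")
      \<comment> \<open>At the poles there is no circle, but the factor s^l is 0 because l > K
        excludes l = 0.\<close>
      case True
      obtain A B where "(l = 0 \<longrightarrow> A = 0) \<and> (\<forall>s c \<sigma>. F l (circle_pt d s c \<sigma> u (x $ (d - 1)))
        = of_real s ^ l * (of_real c ^ l * B + of_real \<sigma> * of_real c ^ (l - 1) * A))"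
        using nf_gens_circle[OF d F(1)[rule_format], of l u "x $ (d - 1)"] by (elim exE)
      then have "F l (circle_pt d s c \<sigma> u (x $ (d - 1))) = 0" using True l(1) by simp
      then show ?thesis using s(5) by simp
    next
      case False
      then have "F l (circle_pt d s c \<sigma> u (x $ (d - 1))) = 0" using s l by (intro vanish[of l u s]) auto
      then show ?thesis using s(5) by simp
    qed
  qed
  have "expandable d {(k, q). k \<in> tail_indices d \<and> tail_deg k \<le> K} (F l)" if l: "l \<le> K" for l
  proof (rule expandable_lin_span)
    show "F l \<in> lin_span (nf_gens d l)" using F(1) by simp
    fix f assume "f \<in> nf_gens d l"
    then obtain j e l' h where h: "e \<le> 1" "l = e + l'" "hpoly {1..<d - 1} l' h"
      "f = (\<lambda>x. of_real (x $ (d - 1)) ^ j * (of_real (x $ 0) ^ e * h x))"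
      unfolding nf_gens_def by blast
    define m where "m = d - 3"
    have m: "d = m + 3" "d - 1 = Suc (Suc m)" using d by (auto simp: m_def)
    have "hpoly {..Suc m} (e * 1 + l') (\<lambda>x. of_real (x $ 0) ^ e * h x)"
      by (intro hpoly_mult hpoly_power hpoly_coord hpoly_mono[OF h(3)]) (auto simp: m)
    then have "hpoly {..Suc m} l (\<lambda>x. of_real (x $ 0) ^ e * h x)" using h(2) by simp
    from coord_power_solid_gens[OF hpoly_solid_gens[OF this], of j]
    have "f \<in> lin_span (solid_gens_upto m l (j + l))" unfolding h(4) m(2) .
    then show "expandable d {(k, q). k \<in> tail_indices d \<and> tail_deg k \<le> K} f"
    proof (rule expandable_lin_span)
      fix g assume "g \<in> solid_gens_upto m l (j + l)"
      from solid_gens_upto_expandable[OF m(1) this]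
      show "expandable d {(k, q). k \<in> tail_indices d \<and> tail_deg k \<le> K} g"
        by (rule expandable_mono) (use l in auto)
    qed
  qed
  then have "expandable d {(k, q). k \<in> tail_indices d \<and> tail_deg k \<le> K} (\<lambda>x. \<Sum>l\<in>{l. l \<le> L \<and> l \<le> K}. F l x)"
    by (intro expandable_sum) auto
  then show ?thesis
  proof (rule expandable_cong)
    fix x assume x: "x \<in> sphere_vec d"
    show "\<Psi> x = (\<Sum>l\<in>{l. l \<le> L \<and> l \<le> K}. F l x)"
      unfolding \<Psi>F[OF x] by (rule sum.mono_neutral_right) (auto simp: not_le intro: zero[OF _ _ x])
  qed
qed

section \<open>The degrees of a frame are unbounded\<close>

lemma solid_const: "(\<And>i. i \<le> m \<Longrightarrow> \<kappa> i = 0) \<Longrightarrow> solid \<kappa> m x = 1"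
  by (induction m) auto

text \<open>The zonal chain, with a member in every degree. Its first member is a positive constant,
  so its weight is visibly positive; by \<open>ysol_norm\<close> its members of all degrees have
  this same norm.\<close>

lemma zero_tail:
  assumes d: "d \<ge> 3"
  shows "replicate (d - 2) 0 \<in> tail_indices d" "tail_deg (replicate (d - 2) 0) = 0"
    "ynorm d (replicate (d - 2) 0) > 0"
proof -
  define k where "k = replicate (d - 2) (0 :: int)"
  have k0: "k ! 0 = 0" using d by (simp add: k_def)
  then show td: "tail_deg (replicate (d - 2) 0) = 0" by (simp add: tail_deg_def k_def)
  have nth: "(int 0 # k) ! j = 0" if "j \<le> d - 2" for j
    using that by (cases j) (auto simp: k_def)
  have "k \<in> indices d 0" unfolding indices_def mem_Collect_eq using nth by (auto simp: k_def)
  then show kt: "replicate (d - 2) 0 \<in> tail_indices d" using k0 by (simp add: tail_indices_def k_def)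
  define A where "A = norm_const d 0 k"
  have A: "A > 0" using norm_const_pos[OF d kt, of 0] td by (simp add: A_def k_def)
  have "ysol d k 0 x = of_real A" if "x \<in> sphere_vec d" for x
  proof -
    have "tail_solid d k x = 1"
      unfolding tail_solid_def
    proof (rule solid_const)
      fix i
      have "tail_deg k = 0" using td by (simp add: k_def)
      then show "level_deg d (tail_deg k) k i = 0" unfolding level_deg_def by (simp only: nth diff_le_self)
    qed
    then show ?thesis unfolding ysol_eq[OF d that] using td by (simp add: A_def k_def)
  qed
  then have "ynorm d k = (LINT x|sphere_measure d. A\<^sup>2)"
    unfolding ynorm_def by (intro Bochner_Integration.integral_cong) auto
  also have "\<dots> = measure (sphere_measure d) (sphere_vec d) * A\<^sup>2" by simp
  also have "\<dots> > 0" using sphere_measure_pos[of d] d A by simp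
  finally show "ynorm d (replicate (d - 2) 0) > 0" by (simp add: k_def)
qed

lemma ysol_coefficient:
  assumes d: "d \<ge> 3" and P: "finite P" "fst ` P \<subseteq> tail_indices d" and k: "k \<in> tail_indices d"
    and f: "\<And>x. x \<in> sphere_vec d \<Longrightarrow> f x = (\<Sum>(k, q)\<in>P. a (k, q) * ysol d k q x)"
  shows "(LINT x|sphere_measure d. f x * cnj (ysol d k q x)) = (if (k, q) \<in> P then a (k, q) * of_real (ynorm d k) else 0)"
proof -
  define P' where "P' = insert (k, q) P"
  define a' where "a' p = (if p \<in> P then a p else 0)" for p
  define b where "b p = (if p = (k, q) then 1 else 0 :: complex)" for p
  have P': "finite P'" "fst ` P' \<subseteq> tail_indices d" using P k by (auto simp: P'_def)
  have f': "f x = (\<Sum>(k, q)\<in>P'. a' (k, q) * ysol d k q x)" if "x \<in> sphere_vec d" for x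
    unfolding f[OF that] by (rule sum.mono_neutral_cong_left[OF P'(1)]) (auto simp: P'_def a'_def)
  have "ysol d k q x = (\<Sum>p\<in>P'. b p * ysol d (fst p) (snd p) x)" for x
  proof -
    have "(\<Sum>p\<in>P'. b p * ysol d (fst p) (snd p) x) = (\<Sum>p\<in>P'. if p = (k, q) then ysol d k q x else 0)"
      by (rule sum.cong) (auto simp: b_def)
    then show ?thesis using P'(1) by (simp add: P'_def)
  qed
  then have g': "ysol d k q x = (\<Sum>(k, q)\<in>P'. b (k, q) * ysol d k q x)" for x
    by (simp add: case_prod_beta)
  have "(LINT x|sphere_measure d. f x * cnj (ysol d k q x)) = (\<Sum>(k, q)\<in>P'. a' (k, q) * cnj (b (k, q)) * of_real (ynorm d k))"
    by (rule ysol_parseval[OF d P' f' g'])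
  also have "\<dots> = (\<Sum>p\<in>P'. if p = (k, q) then a' (k, q) * of_real (ynorm d k) else 0)"
    by (rule sum.cong) (auto simp: b_def split: if_splits)
  also have "\<dots> = a' (k, q) * of_real (ynorm d k)" using P'(1) by (simp add: P'_def)
  finally show ?thesis by (simp add: a'_def)
qed

lemma ysol_L2: 
  assumes d: "d \<ge> 3" and k: "k \<in> tail_indices d"
  shows "ysol d k q \<in> L2_sphere d" "(norm_sphere d (ysol d k q))\<^sup>2 = ynorm d k"
proof -
  have pf: "pfun d (ysol d k q)" by (rule pfun_ysol[OF d k])
  have "integrable (sphere_measure d) (\<lambda>x. ysol d k q x * cnj (ysol d k q x))"
    using d pf by (intro pfun_integrable pfun.mult pfun_cnj) auto
  then have "integrable (sphere_measure d) (\<lambda>x. Re (ysol d k q x * cnj (ysol d k q x)))" by (rule integrable_Re)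
  then have "integrable (sphere_measure d) (\<lambda>x. (cmod (ysol d k q x))\<^sup>2)"
    by (simp only: complex_norm_square[symmetric] Re_complex_of_real)
  then show "ysol d k q \<in> L2_sphere d"
    unfolding L2_sphere_def using sphere_measure_measurable[OF pfun_measurable[OF pf]] by simp
  have "complex_of_real (LINT x|sphere_measure d. (cmod (ysol d k q x))\<^sup>2) = of_real (ynorm d k)"
    using ysol_norm[OF d k, of q] unfolding integral_norm_sq .
  then have "(LINT x|sphere_measure d. (cmod (ysol d k q x))\<^sup>2) = ynorm d k" by (simp only: of_real_eq_iff)
  then show "(norm_sphere d (ysol d k q))\<^sup>2 = ynorm d k"
    using ynorm_nonneg[of d k] by (simp add: norm_sphere_def)
qed

text \<open>If all degrees were at most B, the zonal function of degree B + 1 would be orthogonal to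
  every member of the frame although its norm is positive, against the lower frame bound.\<close>

lemma frame_degrees_unbounded:
  assumes d: "d \<ge> 3" and g: "\<And>j r. r \<in> {1..R j} \<Longrightarrow> g j r \<in> SO d"
    and fr: "frame_generating d N R g w \<Psi>"
  shows "\<exists>j. N j > B"
proof (rule ccontr)
  assume "\<not> (\<exists>j. N j > B)"
  then have NB: "N j \<le> B" for j by (simp add: not_less)
  define k where "k = replicate (d - 2) (0 :: int)"
  have k: "k \<in> tail_indices d" "tail_deg k = 0" "ynorm d k > 0" unfolding k_def by (rule zero_tail[OF d])+
  define f where "f = ysol d k (Suc B)"
  define \<phi> where "\<phi> = (\<lambda>(j, r) x. of_real (sqrt (w j r)) * rotate_fun (g j r) (\<Psi> j) x)"
  have \<Psi>: "\<Psi> j \<in> sphere_polys d (N j)" for j using fr by (simp add: frame_generating_def)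
  have frame: "is_frame d (SIGMA j:UNIV. {1..R j}) \<phi>" using fr by (simp add: frame_generating_def \<phi>_def)
  have zero: "inner_sphere d f (\<phi> p) = 0" if p: "p \<in> (SIGMA j:UNIV. {1..R j})" for p
  proof -
    obtain j r where jr: "p = (j, r)" "r \<in> {1..R j}" using p by auto
    define S where "S = {(k, q). k \<in> tail_indices d \<and> tail_deg k + q \<le> N j}"
    have "expandable d S (rotate_fun (g j r) (\<Psi> j))"
      unfolding S_def by (rule sphere_polys_rotate_expandable[OF d g[OF jr(2)] \<Psi>])
    from expandable_finite[OF this] obtain P a where
      "finite P \<and> P \<subseteq> S \<and> (\<forall>x\<in>sphere_vec d. rotate_fun (g j r) (\<Psi> j) x = (\<Sum>(k, q)\<in>P. a (k, q) * ysol d k q x))"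
      by (elim exE)
    then have P: "finite P" "P \<subseteq> S" "\<forall>x\<in>sphere_vec d. rotate_fun (g j r) (\<Psi> j) x = (\<Sum>(k, q)\<in>P. a (k, q) * ysol d k q x)"
      by (rule conjunct1, rule conjunct2[THEN conjunct1], rule conjunct2[THEN conjunct2])
    have t: "fst ` P \<subseteq> tail_indices d" using P(2) by (auto simp: S_def)
    have nP: "(k, Suc B) \<notin> P" using P(2) NB[of j] by (auto simp: S_def)
    have "(LINT x|sphere_measure d. rotate_fun (g j r) (\<Psi> j) x * cnj (f x)) = 0"
      unfolding f_def using ysol_coefficient[OF d P(1) t k(1), of "rotate_fun (g j r) (\<Psi> j)" a "Suc B"] P(3) nP by simp
    then have "(LINT x|sphere_measure d. of_real (sqrt (w j r)) * (rotate_fun (g j r) (\<Psi> j) x * cnj (f x))) = 0"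
      by (subst integral_mult_right_zero) simp
    then have "(LINT x|sphere_measure d. cnj (of_real (sqrt (w j r)) * (rotate_fun (g j r) (\<Psi> j) x * cnj (f x)))) = 0"
      by (subst Bochner_Integration.integral_cnj) simp
    moreover have "cnj (of_real (sqrt (w j r)) * (rotate_fun (g j r) (\<Psi> j) x * cnj (f x))) = f x * cnj (\<phi> p x)" for x
      by (simp add: \<phi>_def jr(1) mult_ac)
    ultimately show ?thesis by (simp only: inner_sphere_def)
  qed
  obtain A where "0 < A" and A': "\<forall>f\<in>L2_sphere d. A * (norm_sphere d f)\<^sup>2 \<le> (\<Sum>\<^sub>\<infinity>i\<in>(SIGMA j:UNIV. {1..R j}). (cmod (inner_sphere d f (\<phi> i)))\<^sup>2)"
    using frame unfolding is_frame_def by fast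
  then have A: "A > 0" "\<And>f. f \<in> L2_sphere d \<Longrightarrow>
      A * (norm_sphere d f)\<^sup>2 \<le> (\<Sum>\<^sub>\<infinity>i\<in>(SIGMA j:UNIV. {1..R j}). (cmod (inner_sphere d f (\<phi> i)))\<^sup>2)"
    by simp_all
  have "(\<Sum>\<^sub>\<infinity>i\<in>(SIGMA j:UNIV. {1..R j}). (cmod (inner_sphere d f (\<phi> i)))\<^sup>2) = 0"
    by (rule infsum_0) (simp add: zero)
  then have "A * ynorm d k \<le> 0" using A(2)[of f] ysol_L2[OF d k(1), of "Suc B"] by (simp add: f_def)
  then show False using A(1) k(3) by (simp add: mult_le_0_iff)
qed

section \<open>The main estimate\<close>

lemma amgm: "x * y \<le> (x\<^sup>2 + y\<^sup>2) / (2 :: real)"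
  using sum_squares_ge_zero[of "x - y" 0] by (simp add: power2_eq_square algebra_simps)

text \<open>One chain of weight \<open>w\<close>: \<open>c\<close> are the expansion coefficients,
  so that w c are those of (C3), and \<open>\<alpha>\<close> are the Jacobi entries. The defect w (c
  - J c) consists of the negative second difference and of the deviations of \<open>\<alpha>\<close>
  from 1/2. The former is paired with c by the inequality of the means with free weight
  \<open>\<eta>\<close>; the latter cost \<open>\<epsilon>\<close> times products of neighbours, in
  total at most 2 \<epsilon> w times the sum of the |c|^2.\<close>

lemma tail_estimate:
  fixes c :: "nat \<Rightarrow> complex" and \<alpha> :: "nat \<Rightarrow> real"
  assumes w: "w > 0" and \<eta>: "\<eta> > 0" and E: "E \<ge> 0" and \<epsilon>: "\<epsilon> \<ge> 0" and fin: "\<And>q. q \<ge> L \<Longrightarrow> c q = 0"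
    and supp: "\<And>q. c q \<noteq> 0 \<Longrightarrow> q \<le> N"
    and \<alpha>: "\<And>q. c q \<noteq> 0 \<Longrightarrow> \<bar>\<alpha> q - 1 / 2\<bar> \<le> \<epsilon>" "\<And>q. c (Suc q) \<noteq> 0 \<Longrightarrow> \<bar>\<alpha> q - 1 / 2\<bar> \<le> \<epsilon>"
    and diff: "\<And>q. c q \<noteq> 0 \<Longrightarrow> cmod (of_real w * ((c (Suc q) + (if q = 0 then 0 else c (q - 1))) / 2 - c q)) \<le> E"
  shows "w * (\<Sum>q\<le>L. Re ((c q - (of_real (\<alpha> q) * c (Suc q) + (if q = 0 then 0 else of_real (\<alpha> (q - 1)) * c (q - 1)))) * cnj (c q)))
    \<le> (\<eta> / (2 * w) + 2 * \<epsilon>) * (w * (\<Sum>q\<le>L. (cmod (c q))\<^sup>2)) + (real N + 1) * (E\<^sup>2 / (2 * \<eta>))"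
proof -
  define p where "p q = (if q = 0 then 0 else c (q - 1))" for q
  define G where "G = (\<Sum>q\<le>L. (cmod (c q))\<^sup>2)"
  have Gs: "(\<Sum>q\<le>L. (cmod (c (Suc q)))\<^sup>2) \<le> G"
  proof -
    have "(\<Sum>q\<le>L. (cmod (c (Suc q)))\<^sup>2) = (\<Sum>q<L. (cmod (c (Suc q)))\<^sup>2)"
      using fin[of "Suc L"] by (simp add: lessThan_Suc_atMost[symmetric])
    then show ?thesis unfolding G_def sum.atMost_shift[of _ L] by simp
  qed
  have Gp: "(\<Sum>q\<le>L. (cmod (p q))\<^sup>2) \<le> G"
  proof -
    have "(\<Sum>q\<le>L. (cmod (p q))\<^sup>2) = (\<Sum>q<L. (cmod (c q))\<^sup>2)"
      unfolding sum.atMost_shift[of _ L] by (simp add: p_def)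
    also have "\<dots> \<le> G" unfolding G_def by (rule sum_mono2) auto
    finally show ?thesis .
  qed
  have each: "w * Re ((c q - (of_real (\<alpha> q) * c (Suc q) + (if q = 0 then 0 else of_real (\<alpha> (q - 1)) * c (q - 1)))) * cnj (c q))
      \<le> \<eta> / 2 * (cmod (c q))\<^sup>2 + (if q \<le> N then E\<^sup>2 / (2 * \<eta>) else 0)
        + w * \<epsilon> * ((cmod (c q))\<^sup>2 + (cmod (c (Suc q)))\<^sup>2 / 2 + (cmod (p q))\<^sup>2 / 2)" (is "?l \<le> ?r") for q
  proof (cases "c q = 0")
    case True
    then show ?thesis using w \<epsilon> \<eta> by simp
  next
    case False
    \<comment> \<open>At q = 0 there is no lower neighbour. The default 1/2 makes its deviation
      vanish, so that both cases share one formula.\<close>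
    define \<beta> where "\<beta> = (if q = 0 then 1 / 2 else \<alpha> (q - 1))"
    have \<beta>: "\<bar>\<beta> - 1 / 2\<bar> \<le> \<epsilon>" using \<alpha>(2)[of "q - 1"] False \<epsilon> by (auto simp: \<beta>_def)
    have aq: "\<bar>\<alpha> q - 1 / 2\<bar> \<le> \<epsilon>" by (rule \<alpha>(1)[OF False])
    define \<Delta> where "\<Delta> = of_real w * ((c (Suc q) + p q) / 2 - c q)"
    have \<Delta>: "cmod \<Delta> \<le> E" using diff[OF False] by (simp add: \<Delta>_def p_def)
    define X where "X = c q - (of_real (\<alpha> q) * c (Suc q) + (if q = 0 then 0 else of_real (\<alpha> (q - 1)) * c (q - 1)))"
    have X: "of_real w * X = - \<Delta> - (of_real (w * (\<alpha> q - 1 / 2)) * c (Suc q) + of_real (w * (\<beta> - 1 / 2)) * p q)"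
      by (simp add: X_def \<Delta>_def p_def \<beta>_def algebra_simps)
    have "cmod (of_real w * X) \<le> cmod \<Delta> + (cmod (of_real (w * (\<alpha> q - 1 / 2)) * c (Suc q)) + cmod (of_real (w * (\<beta> - 1 / 2)) * p q))"
      unfolding X by (intro norm_triangle_le_diff add_mono norm_triangle_ineq) simp_all
    also have "\<dots> \<le> E + (w * \<epsilon> * cmod (c (Suc q)) + w * \<epsilon> * cmod (p q))"
    proof -
      have "cmod (of_real (w * r) * v) \<le> w * \<epsilon> * cmod v" if "\<bar>r\<bar> \<le> \<epsilon>" for r v
        unfolding norm_mult norm_of_real abs_mult using w that by (intro mult_right_mono mult_mono) auto
      then show ?thesis using \<Delta> aq \<beta> by (intro add_mono)
    qed
    finally have n: "cmod (of_real w * X) \<le> E + (w * \<epsilon> * cmod (c (Suc q)) + w * \<epsilon> * cmod (p q))" .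
    have "?l = Re (of_real w * X * cnj (c q))" by (simp add: X_def mult.assoc)
    also have "\<dots> \<le> cmod (of_real w * X * cnj (c q))" by (rule complex_Re_le_cmod)
    also have "\<dots> = cmod (of_real w * X) * cmod (c q)" by (simp add: norm_mult)
    also have "\<dots> \<le> (E + (w * \<epsilon> * cmod (c (Suc q)) + w * \<epsilon> * cmod (p q))) * cmod (c q)"
      using n by (rule mult_right_mono) simp
    also have "\<dots> = E * cmod (c q) + w * \<epsilon> * (cmod (c (Suc q)) * cmod (c q) + cmod (p q) * cmod (c q))"
      by (simp add: algebra_simps)
    also have "\<dots> \<le> (\<eta> / 2 * (cmod (c q))\<^sup>2 + E\<^sup>2 / (2 * \<eta>))
        + w * \<epsilon> * (((cmod (c (Suc q)))\<^sup>2 + (cmod (c q))\<^sup>2) / 2 + ((cmod (p q))\<^sup>2 + (cmod (c q))\<^sup>2) / 2)"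
    proof (intro add_mono mult_left_mono amgm)
      \<comment> \<open>Distributing sqrt \<eta> over the two factors gives the inequality of the
        means its weight: little on |c|^2, which is summed against the norm, and more on
        E^2.\<close>
      have s: "sqrt \<eta> > 0" "(sqrt \<eta>)\<^sup>2 = \<eta>" using \<eta> by simp_all
      have "E * cmod (c q) = (E / sqrt \<eta>) * (sqrt \<eta> * cmod (c q))" using s by simp
      also have "\<dots> \<le> ((E / sqrt \<eta>)\<^sup>2 + (sqrt \<eta> * cmod (c q))\<^sup>2) / 2" by (rule amgm)
      also have "\<dots> = \<eta> / 2 * (cmod (c q))\<^sup>2 + E\<^sup>2 / (2 * \<eta>)"
        unfolding power_divide power_mult_distrib s by (simp add: add_divide_distrib)
      finally show "E * cmod (c q) \<le> \<eta> / 2 * (cmod (c q))\<^sup>2 + E\<^sup>2 / (2 * \<eta>)" .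
      show "0 \<le> w * \<epsilon>" using w \<epsilon> by simp
    qed
    also have "\<dots> = ?r" using supp[OF False] by (simp add: algebra_simps add_divide_distrib)
    finally show ?thesis .
  qed
  have cnt: "(\<Sum>q\<le>L. if q \<le> N then E\<^sup>2 / (2 * \<eta>) else 0) \<le> (real N + 1) * (E\<^sup>2 / (2 * \<eta>))"
  proof -
    have "(\<Sum>q\<le>L. if q \<le> N then E\<^sup>2 / (2 * \<eta>) else 0) = real (card ({..L} \<inter> {..N})) * (E\<^sup>2 / (2 * \<eta>))"
      by (subst sum.If_cases) (auto simp: atMost_def)
    also have "\<dots> \<le> (real N + 1) * (E\<^sup>2 / (2 * \<eta>))"
    proof (rule mult_right_mono)
      have "card ({..L} \<inter> {..N}) \<le> card {..N}" by (rule card_mono) auto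
      then show "real (card ({..L} \<inter> {..N})) \<le> real N + 1" by simp
    qed (use \<eta> in simp)
    finally show ?thesis .
  qed
  have "w * (\<Sum>q\<le>L. Re ((c q - (of_real (\<alpha> q) * c (Suc q) + (if q = 0 then 0 else of_real (\<alpha> (q - 1)) * c (q - 1)))) * cnj (c q)))
      \<le> (\<Sum>q\<le>L. \<eta> / 2 * (cmod (c q))\<^sup>2 + (if q \<le> N then E\<^sup>2 / (2 * \<eta>) else 0)
        + w * \<epsilon> * ((cmod (c q))\<^sup>2 + (cmod (c (Suc q)))\<^sup>2 / 2 + (cmod (p q))\<^sup>2 / 2))"
    unfolding sum_distrib_left[of w] by (rule sum_mono) (rule each)
  also have "\<dots> = \<eta> / 2 * G + (\<Sum>q\<le>L. if q \<le> N then E\<^sup>2 / (2 * \<eta>) else 0)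
      + w * \<epsilon> * (G + (\<Sum>q\<le>L. (cmod (c (Suc q)))\<^sup>2) / 2 + (\<Sum>q\<le>L. (cmod (p q))\<^sup>2) / 2)"
    unfolding G_def by (simp add: sum.distrib sum_distrib_left sum_divide_distrib distrib_left)
  also have "\<dots> \<le> \<eta> / 2 * G + (real N + 1) * (E\<^sup>2 / (2 * \<eta>)) + w * \<epsilon> * (G + G / 2 + G / 2)"
    using cnt Gs Gp w \<epsilon> \<eta> by (intro add_mono mult_left_mono divide_right_mono) auto
  also have "\<dots> = (\<eta> / (2 * w) + 2 * \<epsilon>) * (w * G) + (real N + 1) * (E\<^sup>2 / (2 * \<eta>))"
    using w by (simp add: field_simps)
  finally show ?thesis unfolding G_def .
qed

text \<open>Parseval's identity turns both integrals into sums over the chains in \<open>Q\<close>,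
  to each of which \<open>tail_estimate\<close> applies; the share of a chain in the squared norm is
  at most G. A chain of weight 0 contributes nothing, and its case is separate because the estimate
  divides by the weight.\<close>

lemma sphere_expansion_estimate:
  assumes d: "d \<ge> 3" and Q: "finite Q" "Q \<subseteq> tail_indices d"
    and ex: "expandable d {(k, q). k \<in> Q} \<Psi>"
    and \<eta>: "\<eta> > 0" and E: "E \<ge> 0" and M: "M \<ge> 1"
    and C2: "\<And>k q. k \<in> Q \<Longrightarrow> tail_deg k + q \<notin> {M..N} \<Longrightarrow> coefficient d \<Psi> (int (tail_deg k + q)) k = 0"
    and C3: "\<And>k q. k \<in> Q \<Longrightarrow> tail_deg k + q \<in> {M..N} \<Longrightarrow>
      cmod ((coefficient d \<Psi> (int (tail_deg k + q) + 1) k + coefficient d \<Psi> (int (tail_deg k + q) - 1) k) / 2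
        - coefficient d \<Psi> (int (tail_deg k + q)) k) \<le> E"
  defines "G \<equiv> LINT x|sphere_measure d. (cmod (\<Psi> x))\<^sup>2"
  shows "G - (LINT x|sphere_measure d. x $ (d - 1) * (cmod (\<Psi> x))\<^sup>2)
    \<le> (\<Sum>k\<in>Q. (if ynorm d k = 0 then 0 else \<eta> / (2 * ynorm d k))
          + 8 * (geg_param d k * \<bar>geg_param d k - 1\<bar>) / (real M)\<^sup>2) * G
      + real (card Q) * ((real N + 1) * (E\<^sup>2 / (2 * \<eta>)))"
proof -
  from expandable_finite[OF ex] obtain P a where
    "finite P \<and> P \<subseteq> {(k, q). k \<in> Q} \<and> (\<forall>x\<in>sphere_vec d. \<Psi> x = (\<Sum>(k, q)\<in>P. a (k, q) * ysol d k q x))"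
    by (elim exE)
  then have P: "finite P" "P \<subseteq> {(k, q). k \<in> Q}" "\<forall>x\<in>sphere_vec d. \<Psi> x = (\<Sum>(k, q)\<in>P. a (k, q) * ysol d k q x)"
    by (rule conjunct1, rule conjunct2[THEN conjunct1], rule conjunct2[THEN conjunct2])
  have tP: "fst ` P \<subseteq> tail_indices d" using P(2) Q(2) by auto
  obtain L where L: "\<And>q. q \<in> snd ` P \<Longrightarrow> q < L"
    using P(1) finite_nat_set_iff_bounded[of "snd ` P"] by auto
  define c where "c k q = (if (k, q) \<in> P then a (k, q) else 0)" for k q
  have cL: "c k q = 0" if "q \<ge> L" for k q using L[of q] that by (force simp: c_def)
  define \<alpha> where "\<alpha> k q = jacobi d k q" for k q
  \<comment> \<open>The coefficients of the product with the last coordinate: the recurrence of the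
    functions is passed to the coefficients by summation by shifting, and symmetry of the matrix
    keeps its form.\<close>
  define e where "e k q = of_real (\<alpha> k q) * c k (Suc q) + (if q = 0 then 0 else of_real (\<alpha> k (q - 1)) * c k (q - 1))" for k q
  \<comment> \<open>All chains are cut at the same length L, from which on the coefficients vanish.
    Hence multiplication by the last coordinate stays inside this rectangle.\<close>
  define S where "S = Q \<times> {..L}"
  have S: "finite S" "fst ` S \<subseteq> tail_indices d" using Q by (auto simp: S_def)
  have sumS: "(\<Sum>(k, q)\<in>S. h k q) = (\<Sum>k\<in>Q. \<Sum>q\<le>L. h k q)" for h :: "int list \<Rightarrow> nat \<Rightarrow> complex"
    unfolding S_def by (rule sum.cartesian_product[symmetric])
  have \<Psi>c: "\<Psi> x = (\<Sum>(k, q)\<in>S. c k q * ysol d k q x)" if x: "x \<in> sphere_vec d" for x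
  proof -
    have sub: "P \<subseteq> S"
    proof
      fix p assume p: "p \<in> P"
      then have "fst p \<in> Q" "snd p < L" using P(2) L by (auto simp: image_iff)
      then show "p \<in> S" by (cases p) (auto simp: S_def)
    qed
    have "\<Psi> x = (\<Sum>(k, q)\<in>P. a (k, q) * ysol d k q x)" using P(3) x by blast
    also have "\<dots> = (\<Sum>(k, q)\<in>S. c k q * ysol d k q x)"
      by (rule sum.mono_neutral_cong_left[OF S(1) sub]) (auto simp: c_def)
    finally show ?thesis .
  qed
  have z\<Psi>: "of_real (x $ (d - 1)) * \<Psi> x = (\<Sum>(k, q)\<in>S. e k q * ysol d k q x)" if x: "x \<in> sphere_vec d" for x
  proof -
    define z where "z = complex_of_real (x $ (d - 1))"
    have "(\<Sum>q\<le>L. c k q * (z * ysol d k q x)) = (\<Sum>q\<le>L. e k q * ysol d k q x)" if k: "k \<in> Q" for k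
    proof -
      have kt: "k \<in> tail_indices d" using k Q(2) by blast
      define Y where "Y q = ysol d k q x" for q
      have "(\<Sum>q\<le>L. c k q * (z * Y q))
          = (\<Sum>q\<le>L. c k q * (of_real (\<alpha> k q) * Y (Suc q)) + c k q * (if q = 0 then 0 else of_real (\<alpha> k (q - 1)) * Y (q - 1)))"
        unfolding z_def Y_def ysol_recurrence[OF d kt x] \<alpha>_def by (simp only: distrib_left)
      also have "\<dots> = (\<Sum>q\<le>L. c k q * (of_real (\<alpha> k q) * Y (Suc q)))
          + (\<Sum>q\<le>L. c k q * (if q = 0 then 0 else of_real (\<alpha> k (q - 1)) * Y (q - 1)))" by (rule sum.distrib)
      also have "(\<Sum>q\<le>L. c k q * (of_real (\<alpha> k q) * Y (Suc q))) = (\<Sum>q<L. c k q * (of_real (\<alpha> k q) * Y (Suc q)))"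
        using cL[of L k] by (simp add: lessThan_Suc_atMost[symmetric])
      also have "\<dots> = (\<Sum>q\<le>L. (if q = 0 then 0 else of_real (\<alpha> k (q - 1)) * c k (q - 1)) * Y q)"
        unfolding sum.atMost_shift[of _ L] by (simp add: mult_ac)
      also have "(\<Sum>q\<le>L. c k q * (if q = 0 then 0 else of_real (\<alpha> k (q - 1)) * Y (q - 1)))
          = (\<Sum>q<L. of_real (\<alpha> k q) * c k (Suc q) * Y q)"
        unfolding sum.atMost_shift[of _ L] by (simp add: mult_ac)
      also have "\<dots> = (\<Sum>q\<le>L. of_real (\<alpha> k q) * c k (Suc q) * Y q)"
        using cL[of "Suc L" k] by (simp add: lessThan_Suc_atMost[symmetric])
      finally show ?thesis unfolding Y_def[symmetric] e_def by (simp add: sum.distrib[symmetric] distrib_right add.commute)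
    qed
    then have "(\<Sum>k\<in>Q. \<Sum>q\<le>L. c k q * (z * ysol d k q x)) = (\<Sum>k\<in>Q. \<Sum>q\<le>L. e k q * ysol d k q x)" by simp
    moreover have "z * \<Psi> x = (\<Sum>k\<in>Q. \<Sum>q\<le>L. c k q * (z * ysol d k q x))"
      unfolding \<Psi>c[OF x] sumS by (simp add: sum_distrib_left mult.left_commute)
    ultimately show ?thesis unfolding sumS z_def by simp
  qed
  define Z where "Z = (LINT x|sphere_measure d. x $ (d - 1) * (cmod (\<Psi> x))\<^sup>2)"
  have "complex_of_real G = (\<Sum>(k, q)\<in>S. c k q * cnj (c k q) * of_real (ynorm d k))"
    using ysol_parseval[OF d S, of \<Psi> "\<lambda>(k, q). c k q" \<Psi> "\<lambda>(k, q). c k q"] \<Psi>c unfolding G_def integral_norm_sq by simp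
  then have Gc: "complex_of_real G = (\<Sum>k\<in>Q. \<Sum>q\<le>L. c k q * cnj (c k q) * of_real (ynorm d k))" unfolding sumS .
  have "complex_of_real Z = (LINT x|sphere_measure d. of_real (x $ (d - 1)) * \<Psi> x * cnj (\<Psi> x))"
  proof -
    have "(LINT x|sphere_measure d. of_real (x $ (d - 1)) * \<Psi> x * cnj (\<Psi> x))
        = (LINT x|sphere_measure d. complex_of_real (x $ (d - 1) * (cmod (\<Psi> x))\<^sup>2))"
      by (intro Bochner_Integration.integral_cong refl) (simp only: of_real_mult complex_norm_square mult.assoc)
    then show ?thesis unfolding Z_def by (simp only: integral_complex_of_real)
  qed
  also have "\<dots> = (\<Sum>(k, q)\<in>S. e k q * cnj (c k q) * of_real (ynorm d k))"
    using ysol_parseval[OF d S, of "\<lambda>x. of_real (x $ (d - 1)) * \<Psi> x" "\<lambda>(k, q). e k q" \<Psi> "\<lambda>(k, q). c k q"] z\<Psi> \<Psi>c by simp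
  finally have Zc: "complex_of_real Z = (\<Sum>k\<in>Q. \<Sum>q\<le>L. e k q * cnj (c k q) * of_real (ynorm d k))" unfolding sumS .
  have Gk: "G = (\<Sum>k\<in>Q. ynorm d k * (\<Sum>q\<le>L. (cmod (c k q))\<^sup>2))"
  proof -
    have "complex_of_real G = of_real (\<Sum>k\<in>Q. ynorm d k * (\<Sum>q\<le>L. (cmod (c k q))\<^sup>2))"
      unfolding Gc complex_norm_square[symmetric] by (simp add: sum_distrib_left mult.commute)
    then show ?thesis by (simp only: of_real_eq_iff)
  qed
  have "complex_of_real (G - Z) = (\<Sum>k\<in>Q. \<Sum>q\<le>L. (c k q - e k q) * cnj (c k q) * of_real (ynorm d k))"
    unfolding of_real_diff Gc Zc by (simp add: sum_subtractf[symmetric] left_diff_distrib)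
  then have "Re (complex_of_real (G - Z)) = Re (\<Sum>k\<in>Q. \<Sum>q\<le>L. (c k q - e k q) * cnj (c k q) * of_real (ynorm d k))" by (simp only:)
  then have GZ: "G - Z = (\<Sum>k\<in>Q. ynorm d k * (\<Sum>q\<le>L. Re ((c k q - e k q) * cnj (c k q))))"
    by (simp add: Re_sum sum_distrib_left mult.commute)
  define \<Lambda> where "\<Lambda> k = geg_param d k * \<bar>geg_param d k - 1\<bar>" for k
  \<comment> \<open>The 4 stems from q + \<lambda> >= M/2. Entries adjacent to the support reach
    down to degree M - 1, where q + \<lambda> >= M - 1/2, and this is at least M/2 because M >=
    1.\<close>
  define \<epsilon> where "\<epsilon> k = 4 * \<Lambda> k / (real M)\<^sup>2" for k
  have \<Lambda>: "\<Lambda> k \<ge> 0" for k unfolding \<Lambda>_def using geg_param_pos[OF d, of k] by simp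
  then have \<epsilon>0: "\<epsilon> k \<ge> 0" for k by (simp add: \<epsilon>_def)
  define T where "T = (real N + 1) * (E\<^sup>2 / (2 * \<eta>))"
  have T: "T \<ge> 0" using \<eta> by (simp add: T_def)
  define U where "U k = (if ynorm d k = 0 then 0 else \<eta> / (2 * ynorm d k)) + 2 * \<epsilon> k" for k
  have U: "U k \<ge> 0" for k using \<eta> \<epsilon>0 ynorm_nonneg[of d k] by (simp add: U_def)
  have G0: "G \<ge> 0" unfolding G_def by simp
  have each: "ynorm d k * (\<Sum>q\<le>L. Re ((c k q - e k q) * cnj (c k q))) \<le> U k * G + T" if k: "k \<in> Q" for k
  proof (cases "ynorm d k = 0")
    case True
    then show ?thesis using U[of k] G0 T by simp
  next
    case False
    then have w: "ynorm d k > 0" using ynorm_nonneg[of d k] by simp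
    have kt: "k \<in> tail_indices d" using k Q(2) by blast
    have co: "coefficient d \<Psi> (int (tail_deg k + q)) k = of_real (ynorm d k) * c k q" for q
      unfolding coefficient_ysol[OF d kt] using ysol_coefficient[OF d P(1) tP kt, of \<Psi> a q] P(3) by (simp add: c_def)
    \<comment> \<open>At q = 0 the degree below lies under the start of the chain; there
      \<open>coefficient\<close> is 0 by convention, in agreement with the missing lower
      neighbour.\<close>
    have com: "coefficient d \<Psi> (int (tail_deg k + q) - 1) k = of_real (ynorm d k) * (if q = 0 then 0 else c k (q - 1))" for q
    proof (cases q)
      case 0
      have "k \<notin> indices d (nat (int (tail_deg k) - 1))" if "int (tail_deg k) - 1 \<ge> 0"
        using that indices_iff[OF d, of k "nat (int (tail_deg k) - 1)"] by auto
      then show ?thesis using 0 by (auto simp: coefficient_def)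
    next
      case (Suc p)
      then have "int (tail_deg k + q) - 1 = int (tail_deg k + p)" by simp
      then show ?thesis using co[of p] Suc by simp
    qed
    have cop: "coefficient d \<Psi> (int (tail_deg k + q) + 1) k = of_real (ynorm d k) * c k (Suc q)" for q
    proof -
      have "int (tail_deg k + q) + 1 = int (tail_deg k + Suc q)" by simp
      then show ?thesis using co[of "Suc q"] by (simp only:)
    qed
    have supp: "tail_deg k + q \<in> {M..N}" if "c k q \<noteq> 0" for q
    proof (rule ccontr)
      assume "tail_deg k + q \<notin> {M..N}"
      from C2[OF k this] show False using co[of q] w that by simp
    qed
    have half: "\<Lambda> k / (real p + geg_param d k)\<^sup>2 \<le> \<epsilon> k" if "real p + geg_param d k \<ge> real M / 2" for p
    proof -
      have "\<Lambda> k / (real p + geg_param d k)\<^sup>2 \<le> \<Lambda> k / (real M / 2)\<^sup>2"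
        using that M \<Lambda>[of k] by (intro divide_left_mono power_mono mult_pos_pos) auto
      then show ?thesis by (simp add: \<epsilon>_def power_divide mult.commute)
    qed
    have lam: "geg_param d k \<ge> real (tail_deg k) + 1 / 2" using d by (simp add: geg_param_def)
    have "ynorm d k * (\<Sum>q\<le>L. Re ((c k q - (of_real (\<alpha> k q) * c k (Suc q) + (if q = 0 then 0 else of_real (\<alpha> k (q - 1)) * c k (q - 1)))) * cnj (c k q)))
      \<le> (\<eta> / (2 * ynorm d k) + 2 * \<epsilon> k) * (ynorm d k * (\<Sum>q\<le>L. (cmod (c k q))\<^sup>2)) + (real N + 1) * (E\<^sup>2 / (2 * \<eta>))"
    proof (rule tail_estimate[OF w \<eta> E \<epsilon>0])
      show "c k q = 0" if "q \<ge> L" for q using that by (rule cL)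
      show "q \<le> N" if "c k q \<noteq> 0" for q using supp[OF that] by simp
      show "\<bar>\<alpha> k q - 1 / 2\<bar> \<le> \<epsilon> k" if "c k q \<noteq> 0" for q
      proof -
        have "real M \<le> real (tail_deg k + q)" using supp[OF that] by simp
        then have "real q + geg_param d k \<ge> real M / 2" using lam by simp
        from half[OF this] jacobi_bound[OF d kt, of q] show ?thesis unfolding \<alpha>_def \<Lambda>_def by linarith
      qed
      show "\<bar>\<alpha> k q - 1 / 2\<bar> \<le> \<epsilon> k" if "c k (Suc q) \<noteq> 0" for q
      proof -
        have "real M \<le> real (tail_deg k + Suc q)" using supp[OF that] by simp
        then have "real q + geg_param d k \<ge> real M / 2" using lam M by simp
        from half[OF this] jacobi_bound[OF d kt, of q] show ?thesis unfolding \<alpha>_def \<Lambda>_def by linarith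
      qed
      show "cmod (of_real (ynorm d k) * ((c k (Suc q) + (if q = 0 then 0 else c k (q - 1))) / 2 - c k q)) \<le> E" if "c k q \<noteq> 0" for q
      proof -
        have "of_real (ynorm d k) * ((c k (Suc q) + (if q = 0 then 0 else c k (q - 1))) / 2 - c k q)
          = (coefficient d \<Psi> (int (tail_deg k + q) + 1) k + coefficient d \<Psi> (int (tail_deg k + q) - 1) k) / 2
            - coefficient d \<Psi> (int (tail_deg k + q)) k"
          unfolding co cop com by (simp add: algebra_simps add_divide_distrib)
        then show ?thesis using C3[OF k supp[OF that]] by (simp only:)
      qed
    qed
    then have "ynorm d k * (\<Sum>q\<le>L. Re ((c k q - e k q) * cnj (c k q)))
        \<le> U k * (ynorm d k * (\<Sum>q\<le>L. (cmod (c k q))\<^sup>2)) + T"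
      using False unfolding U_def T_def e_def by simp
    moreover have "ynorm d k * (\<Sum>q\<le>L. (cmod (c k q))\<^sup>2) \<le> G"
      unfolding Gk using k Q(1) by (intro member_le_sum[of k Q]) (auto intro!: mult_nonneg_nonneg sum_nonneg ynorm_nonneg)
    then have "U k * (ynorm d k * (\<Sum>q\<le>L. (cmod (c k q))\<^sup>2)) \<le> U k * G" by (rule mult_left_mono) (rule U)
    ultimately show ?thesis by linarith
  qed
  have "G - Z \<le> (\<Sum>k\<in>Q. U k * G + T)" unfolding GZ by (rule sum_mono) (rule each)
  also have "\<dots> = (\<Sum>k\<in>Q. U k) * G + real (card Q) * T" by (simp add: sum.distrib sum_distrib_right)
  finally show ?thesis unfolding Z_def U_def \<epsilon>_def T_def \<Lambda>_def by (simp add: mult.assoc)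
qed

section \<open>Space variance\<close>

lemma finite_indices: "finite (indices d n)"
proof (rule finite_subset)
  show "indices d n \<subseteq> {k. set k \<subseteq> {- int n..int n} \<and> length k = d - 2}"
  proof
    fix k assume k: "k \<in> indices d n"
    have b: "\<bar>(int n # k) ! j\<bar> \<le> int n" if "j \<le> d - 2" for j
      using that
    proof (induction j)
      case (Suc j)
      then have "\<bar>(int n # k) ! (j + 1)\<bar> \<le> (int n # k) ! j" using k by (auto simp: indices_def)
      then show ?case using Suc by simp
    qed simp
    have "set k \<subseteq> {- int n..int n}"
    proof
      fix x assume "x \<in> set k"
      then obtain i where "i < length k" "k ! i = x" by (auto simp: in_set_conv_nth)
      then show "x \<in> {- int n..int n}" using b[of "Suc i"] k by (auto simp: indices_def)
    qed
    then show "k \<in> {k. set k \<subseteq> {- int n..int n} \<and> length k = d - 2}" using k by (auto simp: indices_def)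
  qed
  show "finite {k. set k \<subseteq> {- int n..int n} \<and> length k = d - 2}"
    by (rule finite_lists_length_eq) simp
qed

section \<open>The component along the pole and the variance\<close>

lemma xi0_pole_eq:
  assumes "d \<ge> 1"
  shows "xi0_pole d f = (LINT x|sphere_measure d. x $ (d - 1) * (cmod (f x))\<^sup>2) / (norm_sphere d f)\<^sup>2"
proof -
  have "xi0_pole d f = xi0 d f $ (d - 1)"
    unfolding xi0_pole_def north_pole_def using assms by (intro scalar_prod_right_unit) (auto simp: xi0_def)
  then show ?thesis using assms by (simp add: xi0_def)
qed

lemma xi0_pole_le_norm:
  assumes "d \<ge> 1"
  shows "(xi0_pole d f)\<^sup>2 \<le> (norm_vec (xi0 d f))\<^sup>2"
proof -
  have dim: "dim_vec (xi0 d f) = d" by (simp add: xi0_def)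
  have e: "xi0_pole d f = xi0 d f $ (d - 1)"
    unfolding xi0_pole_def north_pole_def using assms by (intro scalar_prod_right_unit) (auto simp: xi0_def)
  have s: "xi0 d f \<bullet> xi0 d f = (\<Sum>i<d. (xi0 d f $ i)\<^sup>2)"
    by (simp add: scalar_prod_def dim power2_eq_square atLeast0LessThan)
  have "(xi0 d f $ (d - 1))\<^sup>2 \<le> (\<Sum>i<d. (xi0 d f $ i)\<^sup>2)"
    using assms by (intro member_le_sum) auto
  moreover have "(norm_vec (xi0 d f))\<^sup>2 = (\<Sum>i<d. (xi0 d f $ i)\<^sup>2)"
    unfolding norm_vec_def s by (intro real_sqrt_pow2 sum_nonneg) simp
  ultimately show ?thesis by (simp add: e)
qed

text \<open>The component along the pole is at least 1/2, so the squared length of the vector, the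
  denominator, is at least 1/4. The same component gives 1 - 2t as a lower bound for the squared
  length, hence at most 2t for the numerator; the quotient is at most 8t.\<close>

lemma Var_S_le:
  assumes "d \<ge> 1" and \<xi>: "1 - xi0_pole d f \<le> t" and t: "0 \<le> t" "t \<le> 1 / 2"
  shows "Var_S d f \<le> 8 * t"
proof -
  define s where "s = (norm_vec (xi0 d f))\<^sup>2"
  have s1: "1 / 4 \<le> s" "1 - 2 * t \<le> s"
  proof -
    have le: "(xi0_pole d f)\<^sup>2 \<le> s" unfolding s_def by (rule xi0_pole_le_norm[OF assms(1)])
    have "(1 / 2)\<^sup>2 \<le> (xi0_pole d f)\<^sup>2" using \<xi> t by (intro power_mono) auto
    then show "1 / 4 \<le> s" using le by (simp add: power2_eq_square)
    have "1 - 2 * t \<le> 1 - 2 * (1 - xi0_pole d f)" using \<xi> by simp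
    also have "\<dots> \<le> (xi0_pole d f)\<^sup>2"
      using zero_le_power2[of "1 - xi0_pole d f"] by (simp add: power2_eq_square algebra_simps)
    finally show "1 - 2 * t \<le> s" using le by (rule order_trans)
  qed
  have "t * (1 / 4) \<le> t * s" using s1 t by (intro mult_left_mono) auto
  moreover have "1 - s \<le> 2 * t" using s1(2) by simp
  ultimately have "1 - s \<le> 8 * (t * s)" by simp
  then show ?thesis using s1 unfolding Var_S_def s_def[symmetric] by (simp add: pos_divide_le_eq mult.assoc)
qed

theorem proposition4p6:
  fixes d K :: nat
    and N M R :: "nat \<Rightarrow> nat"
    and \<mu> :: "real mat measure"
    and g :: "nat \<Rightarrow> nat \<Rightarrow> real mat"
    and w :: "nat \<Rightarrow> nat \<Rightarrow> real"
    and \<Psi> :: "nat \<Rightarrow> real vec \<Rightarrow> complex"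
  assumes "d \<ge> 3"
    and "incseq N"
    and "normalized_haar d \<mu>"
    and "\<And>j. quadrature d \<mu> (N j) (R j) (g j) (w j)"
    and "frame_generating d N R g w \<Psi>"
    and "steerable d K \<Psi>"
    and C1: "sim_on {j. N j \<ge> 1} (\<lambda>j. (norm_sphere d (\<Psi> j))\<^sup>2) (\<lambda>j. real (N j) ^ (d - 1))"
    and C2: "sim_on {j. N j \<ge> 1} (\<lambda>j. real (M j)) (\<lambda>j. real (N j))"
      "\<And>j n k. N j \<ge> 1 \<Longrightarrow> n \<notin> {M j..N j} \<Longrightarrow> coefficient d (\<Psi> j) (int n) k = 0"
    and C3: "\<exists>c>0. \<forall>j. N j \<ge> 1 \<longrightarrow> (\<forall>n\<in>{M j..N j}. \<forall>k \<in> indices d n.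
      cmod ((coefficient d (\<Psi> j) (int n + 1) k + coefficient d (\<Psi> j) (int n - 1) k) / 2
            - coefficient d (\<Psi> j) (int n) k)
        \<le> c * real (N j) powr ((real d - 6) / 2))"
  shows "\<exists>c>0. (\<forall>j. N j \<ge> 1 \<longrightarrow> 1 - xi0_pole d (\<Psi> j) \<le> c * real (N j) powi (- 2)) \<and>
    (\<forall>j. N j \<ge> 1 \<and> xi0 d (\<Psi> j) \<noteq> 0\<^sub>v d \<longrightarrow> Var_S d (\<Psi> j) \<le> c * real (N j) powi (- 2))"
proof -
  note d = assms(1)
  obtain c where c: "c > 0" and C3': "\<And>j n k. N j \<ge> 1 \<Longrightarrow> n \<in> {M j..N j} \<Longrightarrow> k \<in> indices d n \<Longrightarrow>
      cmod ((coefficient d (\<Psi> j) (int n + 1) k + coefficient d (\<Psi> j) (int n - 1) k) / 2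
            - coefficient d (\<Psi> j) (int n) k) \<le> c * real (N j) powr ((real d - 6) / 2)"
    using C3 by blast
  obtain a1 a where a: "0 < a1" "a1 \<le> a" "\<And>j. N j \<ge> 1 \<Longrightarrow> real (N j) ^ (d - 1) \<le> a * (norm_sphere d (\<Psi> j))\<^sup>2"
    using C1 unfolding sim_on_def by auto
  obtain b1 b where b: "0 < b1" "b1 \<le> b" "\<And>j. N j \<ge> 1 \<Longrightarrow> real (N j) \<le> b * real (M j)"
    using C2(1) unfolding sim_on_def by auto
  \<comment> \<open>The finitely many tails that steerability permits, the same for all j. The
    constants below may therefore depend on the weights and Gegenbauer parameters of these
    chains.\<close>
  define Q where "Q = {k \<in> tail_indices d. tail_deg k \<le> K}"
  have Q: "finite Q" "Q \<subseteq> tail_indices d"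
    using finite_indices[of d K] by (auto simp: Q_def indices_iff[OF d] intro: rev_finite_subset)
  have poly: "\<Psi> j \<in> sphere_polys d (N j)" for j using assms(5) by (simp add: frame_generating_def)
  have ex: "expandable d {(k, q). k \<in> Q} (\<Psi> j)" for j
  proof -
    obtain L hs v where hv: "\<And>p. p \<in> {1..L :: nat} \<Longrightarrow> v p \<in> SO_polys (d - 1) K"
      and st: "\<And>h j x. h \<in> SO (d - 1) \<Longrightarrow> x \<in> sphere_vec d \<Longrightarrow>
          rotate_fun (SO_embed h) (\<Psi> j) x = (\<Sum>p = 1..L. v p h * rotate_fun (SO_embed (hs p)) (\<Psi> j) x)"
      using assms(6) unfolding steerable_def by fast
    have "expandable d {(k, q). k \<in> tail_indices d \<and> tail_deg k \<le> K} (\<Psi> j)"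
      by (rule steerable_expandable[OF d poly hv st])
    then show ?thesis by (simp add: Q_def)
  qed
  \<comment> \<open>The sum collects the two error terms of each chain, with 1/M_j^2 replaced by
    b^2/N_j^2; the last summand accounts for the second differences, where c comes from (C3) and a
    from (C1).\<close>
  define C where "C = (\<Sum>k\<in>Q. (if ynorm d k = 0 then 0 else 1 / (2 * ynorm d k))
      + 8 * (geg_param d k * \<bar>geg_param d k - 1\<bar>) * b\<^sup>2) + real (card Q) * (c\<^sup>2 * a)"
  have \<Lambda>: "geg_param d k * \<bar>geg_param d k - 1\<bar> \<ge> 0" for k using geg_param_pos[OF d, of k] by simp
  have C: "C \<ge> 0" unfolding C_def using \<Lambda> ynorm_nonneg[of d] a(1,2)
    by (intro add_nonneg_nonneg sum_nonneg) auto
  have pole: "1 - xi0_pole d (\<Psi> j) \<le> C / (real (N j))\<^sup>2" if N: "N j \<ge> 1" for j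
  proof -
    define n where "n = real (N j)"
    have n: "n \<ge> 1" using N by (simp add: n_def)
    define G where "G = (LINT x|sphere_measure d. (cmod (\<Psi> j x))\<^sup>2)"
    define Z where "Z = (LINT x|sphere_measure d. x $ (d - 1) * (cmod (\<Psi> j x))\<^sup>2)"
    define E where "E = c * n powr ((real d - 6) / 2)"
    have G: "(norm_sphere d (\<Psi> j))\<^sup>2 = G" by (simp add: norm_sphere_def G_def)
    have nG: "n ^ (d - 1) \<le> a * G" using a(3)[OF N] by (simp add: G n_def)
    have "0 < n ^ (d - 1)" using n by simp
    then have "0 < a * G" using nG by linarith
    then have Gpos: "G > 0" using a(1,2) by (simp add: zero_less_mult_iff)
    have nM: "n \<le> b * real (M j)" using b(3)[OF N] by (simp add: n_def)
    \<comment> \<open>Comparability with N_j >= 1 excludes M_j = 0, as the bound for the Jacobi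
      entries demands.\<close>
    then have M: "M j \<ge> 1" using n by (cases "M j") auto
    \<comment> \<open>The free weight is taken as \<eta> = 1/n^2, the size of the intended bound, so
      that the terms with the squared norm G carry the factor n^-2.\<close>
    have "G - Z \<le> (\<Sum>k\<in>Q. (if ynorm d k = 0 then 0 else (1 / n\<^sup>2) / (2 * ynorm d k))
          + 8 * (geg_param d k * \<bar>geg_param d k - 1\<bar>) / (real (M j))\<^sup>2) * G
      + real (card Q) * ((real (N j) + 1) * (E\<^sup>2 / (2 * (1 / n\<^sup>2))))"
      unfolding G_def Z_def
    proof (rule sphere_expansion_estimate[OF d Q ex _ _ M])
      show "0 < 1 / n\<^sup>2" using n by simp
      show "0 \<le> E" using c by (simp add: E_def)
      show "coefficient d (\<Psi> j) (int (tail_deg k + q)) k = 0" if "tail_deg k + q \<notin> {M j..N j}" for k q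
        using C2(2)[OF N that] .
      show "cmod ((coefficient d (\<Psi> j) (int (tail_deg k + q) + 1) k + coefficient d (\<Psi> j) (int (tail_deg k + q) - 1) k) / 2
          - coefficient d (\<Psi> j) (int (tail_deg k + q)) k) \<le> E"
        if "k \<in> Q" "tail_deg k + q \<in> {M j..N j}" for k q
        unfolding E_def n_def using that Q(2) by (intro C3'[OF N]) (auto simp: indices_iff[OF d])
    qed
    also have "\<dots> \<le> (\<Sum>k\<in>Q. ((if ynorm d k = 0 then 0 else 1 / (2 * ynorm d k))
          + 8 * (geg_param d k * \<bar>geg_param d k - 1\<bar>) * b\<^sup>2) * (1 / n\<^sup>2)) * G
      + real (card Q) * (c\<^sup>2 * a * (1 / n\<^sup>2) * G)"
    proof (intro add_mono mult_right_mono mult_left_mono sum_mono)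
      fix k
      have "1 / (real (M j))\<^sup>2 \<le> b\<^sup>2 * (1 / n\<^sup>2)"
      proof -
        have "n\<^sup>2 \<le> (b * real (M j))\<^sup>2" using nM n by (intro power_mono) auto
        then show ?thesis using n M by (simp add: field_simps power_mult_distrib)
      qed
      then have "8 * (geg_param d k * \<bar>geg_param d k - 1\<bar>) * (1 / (real (M j))\<^sup>2)
          \<le> 8 * (geg_param d k * \<bar>geg_param d k - 1\<bar>) * (b\<^sup>2 * (1 / n\<^sup>2))"
        using \<Lambda>[of k] by (intro mult_left_mono) auto
      then show "(if ynorm d k = 0 then 0 else (1 / n\<^sup>2) / (2 * ynorm d k))
          + 8 * (geg_param d k * \<bar>geg_param d k - 1\<bar>) / (real (M j))\<^sup>2
        \<le> ((if ynorm d k = 0 then 0 else 1 / (2 * ynorm d k))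
          + 8 * (geg_param d k * \<bar>geg_param d k - 1\<bar>) * b\<^sup>2) * (1 / n\<^sup>2)"
        by (simp add: add_divide_distrib mult_ac)
    next
      have "E\<^sup>2 = c\<^sup>2 * n powr (real d - 6)"
      proof -
        have "(n powr ((real d - 6) / 2))\<^sup>2 = n powr (real d - 6)"
          by (simp add: power2_eq_square powr_add[symmetric])
        then show ?thesis by (simp add: E_def power_mult_distrib)
      qed
      \<comment> \<open>Now (n + 1)/2 <= n, and n n^(d-6) n^2 = n^-2 n^(d-1). The power n^(d-1) is
        at most a G by (C1), so this term too is of order n^-2 G.\<close>
      then have "(real (N j) + 1) * (E\<^sup>2 / (2 * (1 / n\<^sup>2))) = (n + 1) / 2 * (c\<^sup>2 * n powr (real d - 6) * n\<^sup>2)"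
        using n by (simp add: n_def)
      also have "\<dots> \<le> n * (c\<^sup>2 * n powr (real d - 6) * n\<^sup>2)"
        using n by (intro mult_right_mono) auto
      also have "\<dots> = c\<^sup>2 * (1 / n\<^sup>2) * n ^ (d - 1)"
      proof -
        have "n ^ (d - 1) = n powr real (d - 1)" using n by (intro powr_realpow[symmetric]) simp
        also have "real (d - 1) = (real d - 6) + real 5" using d by linarith
        also have "n powr ((real d - 6) + real 5) = n powr (real d - 6) * n powr real 5" by (rule powr_add)
        also have "n powr real 5 = n ^ 5" using n by (intro powr_realpow) simp
        also have "n ^ 5 = n * n\<^sup>2 * n\<^sup>2" by (simp add: eval_nat_numeral)
        finally have e: "n ^ (d - 1) = n powr (real d - 6) * (n * n\<^sup>2 * n\<^sup>2)" .
        have "n\<^sup>2 \<noteq> 0" using n by simp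
        then show ?thesis unfolding e by simp
      qed
      also have "\<dots> \<le> c\<^sup>2 * (1 / n\<^sup>2) * (a * G)" by (rule mult_left_mono[OF nG]) simp
      finally show "(real (N j) + 1) * (E\<^sup>2 / (2 * (1 / n\<^sup>2))) \<le> c\<^sup>2 * a * (1 / n\<^sup>2) * G" by (simp add: mult_ac)
    qed (use Gpos in auto)
    also have "\<dots> = C / n\<^sup>2 * G"
      unfolding sum_distrib_right[symmetric] by (simp add: C_def algebra_simps add_divide_distrib)
    finally have "(G - Z) / G \<le> C / n\<^sup>2" using Gpos by (simp add: pos_divide_le_eq)
    moreover have "xi0_pole d (\<Psi> j) = Z / G" using xi0_pole_eq[of d "\<Psi> j"] d by (simp add: G Z_def)
    ultimately show ?thesis using Gpos by (simp add: diff_divide_distrib n_def)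
  qed
  \<comment> \<open>From j0 on N_j exceeds 2C, since N is increasing; then C/N_j^2 <= 1/2 and
    \<open>Var_S_le\<close> applies.\<close>
  obtain j0 where j0: "N j0 > nat \<lceil>2 * C\<rceil>"
    using frame_degrees_unbounded[OF d _ assms(5)] assms(4) unfolding quadrature_def by blast
  have var: "Var_S d (\<Psi> j) \<le> 8 * C / (real (N j))\<^sup>2" if j: "j \<ge> j0" for j
  proof -
    have "N j0 \<le> N j" using assms(2) j by (simp add: incseq_def)
    then have n: "real (N j) \<ge> 2 * C" "N j \<ge> 1" using j0 by linarith+
    have "real (N j) * 1 \<le> real (N j) * real (N j)" using n(2) by (intro mult_left_mono) auto
    then have "2 * C \<le> (real (N j))\<^sup>2" using n(1) by (simp add: power2_eq_square)
    then have "C / (real (N j))\<^sup>2 \<le> 1 / 2" using n(2) by (simp add: field_simps)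
    from Var_S_le[OF _ pole[OF n(2)] _ this] show ?thesis using d C by simp
  qed
  \<comment> \<open>The finitely many j below j0 are covered by their own values of the variance
    times N_j^2; the summand 1 makes the constant positive.\<close>
  define D where "D = 8 * C + (\<Sum>j<j0. \<bar>Var_S d (\<Psi> j)\<bar> * (real (N j))\<^sup>2) + 1"
  have S0: "(\<Sum>j<j0. \<bar>Var_S d (\<Psi> j)\<bar> * (real (N j))\<^sup>2) \<ge> 0" by (intro sum_nonneg) simp
  have powi: "real m powi (- 2) = 1 / (real m)\<^sup>2" for m by (simp add: power_int_minus field_simps)
  have "Var_S d (\<Psi> j) \<le> D / (real (N j))\<^sup>2" if N: "N j \<ge> 1" for j
  proof (cases "j < j0")
    case True
    then have "\<bar>Var_S d (\<Psi> j)\<bar> * (real (N j))\<^sup>2 \<le> (\<Sum>j<j0. \<bar>Var_S d (\<Psi> j)\<bar> * (real (N j))\<^sup>2)"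
      by (intro member_le_sum[of j "{..<j0}"]) auto
    then have "\<bar>Var_S d (\<Psi> j)\<bar> * (real (N j))\<^sup>2 \<le> D" using C by (simp add: D_def)
    then have "\<bar>Var_S d (\<Psi> j)\<bar> \<le> D / (real (N j))\<^sup>2" using N by (simp add: pos_le_divide_eq)
    then show ?thesis by linarith
  next
    case False
    then have "Var_S d (\<Psi> j) \<le> 8 * C / (real (N j))\<^sup>2" by (intro var) simp
    also have "\<dots> \<le> D / (real (N j))\<^sup>2" using S0 by (intro divide_right_mono) (auto simp: D_def)
    finally show ?thesis .
  qed
  moreover have "1 - xi0_pole d (\<Psi> j) \<le> D / (real (N j))\<^sup>2" if "N j \<ge> 1" for j
  proof -
    have "C / (real (N j))\<^sup>2 \<le> D / (real (N j))\<^sup>2" using S0 C by (intro divide_right_mono) (auto simp: D_def)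
    then show ?thesis using pole[OF that] by linarith
  qed
  moreover have "D > 0" using C S0 by (simp add: D_def)
  ultimately show ?thesis unfolding powi by (intro exI[of _ D]) simp
qed

end
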